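(* Let $m$ be an odd prime and $\alpha,\beta$ positive integers, and let $\mathcal{P}$ be an atomic chiral polyhedron of type $\{2m^{\alpha}, m^{\alpha + \beta}\}$, with rotation group $\Gamma^+(\mathcal P)=\langle\sigma_1,\sigma_2\rangle$. Then $\alpha = 1$, and $\Gamma^+(\mathcal{P}) = \Gamma^{2m, m^{\beta+1}}(3,\ 1+k m^{\beta},\ -3,\ -1+k m^{\beta})$ for some integer $k$ with $1 \leq k \leq m-1$.
   Context: For integers $p,q,i_1,j_1,i_2,j_2$, $\Gamma^{p,q}(i_1,j_1,i_2,j_2)$ denotes the group with presentation $\langle \sigma_1,\sigma_2 \mid \sigma_1^p=\sigma_2^q=(\sigma_1\sigma_2)^2=1,\ \sigma_2^{-1}\sigma_1=\sigma_1^{i_1}\sigma_2^{j_1},\ \sigma_2\sigma_1^{-1}=\sigma_1^{i_2}\sigma_2^{j_2}\rangle$; an equality $\Gamma^+(\mathcal P)=\Gamma^{p,q}(\dots)$ means the map sending the generators $\sigma_1,\sigma_2$ of the presented group to the distinguished generators of $\Gamma^+(\mathcal P)$ is an isomorphism. An (abstract) polyhedron is a partially ordered set whose elements have rank $0$, $1$, $2$ (vertices, edges, faces), incidence meaning comparability, such that every edge is incident to exactly two vertices and two faces, whenever a vertex is incident to a face exactly two edges are incident to both, the incidence graph is connected, and for each vertex or face the subgraph of the incidence graph induced on its neighbours is connected. A flag is a mutually incident (vertex, edge, face) triple; $\Phi^i$ is the flag differing from $\Phi$ exactly in its rank-$i$ element. Type $\{p,q\}$: faces are incident to $p$ edges and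 vertices to $q$ edges. A polyhedron is regular if its automorphism group is flag-transitive, and chiral if its flags split into two classes with $\Phi,\Phi^i$ always in different classes and the automorphism group transitive on each class but not on all flags. For a regular or chiral polyhedron with base flag $\Phi$, $\sigma_1:\Phi\mapsto(\Phi^1)^0$ and $\sigma_2:\Phi\mapsto(\Phi^2)^1$ generate the rotation group $\Gamma^+(\mathcal P)$. Tight: exactly $2pq$ flags. $\mathcal P$ covers $\mathcal Q$ if there is a homomorphism $\Gamma^+(\mathcal P)\to\Gamma^+(\mathcal Q)$ sending distinguished generators to distinguished generators. A chiral polyhedron of type $\{p,q\}$ is atomic if it is tight and covers no tight chiral polyhedron of type $\{p',q\}$ with $p'<p$ or $\{p,q'\}$ with $q'<q$. *)

theory Defs
  imports "HOL-Algebra.Bij" "HOL-Algebra.Generated_Groups" "HOL-Computational_Algebra.Primes"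
begin

section \<open>Groups given by generators and relations\<close>

text \<open>A letter \<open>(x, True)\<close> stands for the generator \<open>x\<close> and \<open>(x, False)\<close> for its inverse.
  A pair \<open>(u, v)\<close> in a set of relations stands for the relation \<open>u = v\<close>.\<close>

type_synonym 'g word = "('g \<times> bool) list"

inductive pres_eq :: "('g word \<times> 'g word) set \<Rightarrow> 'g word \<Rightarrow> 'g word \<Rightarrow> bool"
  for R :: "('g word \<times> 'g word) set" where
  relation: "(u, v) \<in> R \<Longrightarrow> pres_eq R u v"
| cancel: "pres_eq R [(x, b), (x, \<not> b)] []"
| refl: "pres_eq R u u"
| sym: "pres_eq R u v \<Longrightarrow> pres_eq R v u"
| trans: "pres_eq R u v \<Longrightarrow> pres_eq R v w \<Longrightarrow> pres_eq R u w"
| cong: "pres_eq R u u' \<Longrightarrow> pres_eq R v v' \<Longrightarrow> pres_eq R (u @ v) (u' @ v')"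

definition pres_class :: "('g word \<times> 'g word) set \<Rightarrow> 'g word \<Rightarrow> 'g word set" where
  "pres_class R u = {v. pres_eq R u v}"

definition presented_group :: "('g word \<times> 'g word) set \<Rightarrow> 'g word set monoid" where
  "presented_group R =
    \<lparr>carrier = range (pres_class R),
     monoid.mult = (\<lambda>A B. {w. \<exists>u\<in>A. \<exists>v\<in>B. pres_eq R (u @ v) w}),
     one = pres_class R []\<rparr>"

lemma pres_class_eq_iff: "pres_class R u = pres_class R v \<longleftrightarrow> pres_eq R u v"
  unfolding pres_class_def by (blast intro: pres_eq.refl pres_eq.sym pres_eq.trans)

lemma mult_pres_class:
  "pres_class R u \<otimes>\<^bsub>presented_group R\<^esub> pres_class R v = pres_class R (u @ v)"
  by (auto simp: presented_group_def pres_class_def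
           intro: pres_eq.refl pres_eq.sym pres_eq.trans pres_eq.cong)

lemma pres_eq_inverse: "\<exists>v. pres_eq R (v @ u) []"
proof (induction u)
  case Nil
  have "pres_eq R ([] @ []) []" by (simp add: pres_eq.refl)
  then show ?case by blast
next
  case (Cons a u)
  then obtain v where v: "pres_eq R (v @ u) []" by blast
  obtain x b where a: "a = (x, b)" by (cases a)
  have "pres_eq R [(x, \<not> b), (x, b)] []"
    using pres_eq.cancel[of R x "\<not> b"] by simp
  then have "pres_eq R (v @ [(x, \<not> b), (x, b)] @ u) (v @ [] @ u)"
    by (intro pres_eq.cong pres_eq.refl)
  then have "pres_eq R ((v @ [(x, \<not> b)]) @ a # u) []"
    using v a by (auto intro: pres_eq.trans)
  then show ?case by blast
qed

lemma group_presented_group: "group (presented_group R)"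
proof (rule groupI)
  fix A B C
  assume A: "A \<in> carrier (presented_group R)" and B: "B \<in> carrier (presented_group R)"
    and C: "C \<in> carrier (presented_group R)"
  obtain u v w where "A = pres_class R u" "B = pres_class R v" "C = pres_class R w"
    using A B C by (auto simp: presented_group_def)
  then show "A \<otimes>\<^bsub>presented_group R\<^esub> B \<otimes>\<^bsub>presented_group R\<^esub> C
      = A \<otimes>\<^bsub>presented_group R\<^esub> (B \<otimes>\<^bsub>presented_group R\<^esub> C)"
    by (simp add: mult_pres_class)
next
  fix A B
  assume A: "A \<in> carrier (presented_group R)" and B: "B \<in> carrier (presented_group R)"
  obtain u v where "A = pres_class R u" "B = pres_class R v"
    using A B by (auto simp: presented_group_def)
  then have "A \<otimes>\<^bsub>presented_group R\<^esub> B = pres_class R (u @ v)" by (simp add: mult_pres_class)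
  then show "A \<otimes>\<^bsub>presented_group R\<^esub> B \<in> carrier (presented_group R)"
    by (simp add: presented_group_def)
next
  show "\<one>\<^bsub>presented_group R\<^esub> \<in> carrier (presented_group R)"
    by (simp add: presented_group_def)
next
  fix A
  assume "A \<in> carrier (presented_group R)"
  then obtain u where u: "A = pres_class R u" by (auto simp: presented_group_def)
  have one: "\<one>\<^bsub>presented_group R\<^esub> = pres_class R []" by (simp add: presented_group_def)
  show "\<one>\<^bsub>presented_group R\<^esub> \<otimes>\<^bsub>presented_group R\<^esub> A = A"
    unfolding one u by (simp add: mult_pres_class)
  obtain v where "pres_eq R (v @ u) []" using pres_eq_inverse by blast
  then have "pres_class R v \<otimes>\<^bsub>presented_group R\<^esub> A = \<one>\<^bsub>presented_group R\<^esub>"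
    unfolding one u by (simp add: mult_pres_class pres_class_eq_iff)
  moreover have "pres_class R v \<in> carrier (presented_group R)"
    by (simp add: presented_group_def)
  ultimately show "\<exists>B\<in>carrier (presented_group R).
      B \<otimes>\<^bsub>presented_group R\<^esub> A = \<one>\<^bsub>presented_group R\<^esub>" by blast
qed

datatype gen = S1 | S2

definition gen_pow :: "gen \<Rightarrow> int \<Rightarrow> gen word" where
  "gen_pow x n = replicate (nat \<bar>n\<bar>) (x, 0 \<le> n)"

definition Gamma_rels :: "int \<Rightarrow> int \<Rightarrow> int \<Rightarrow> int \<Rightarrow> int \<Rightarrow> int \<Rightarrow> (gen word \<times> gen word) set" where
  "Gamma_rels p q i\<^sub>1 j\<^sub>1 i\<^sub>2 j\<^sub>2 =
    {(gen_pow S1 p, []),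
     (gen_pow S2 q, []),
     (gen_pow S1 1 @ gen_pow S2 1 @ gen_pow S1 1 @ gen_pow S2 1, []),
     (gen_pow S2 (- 1) @ gen_pow S1 1, gen_pow S1 i\<^sub>1 @ gen_pow S2 j\<^sub>1),
     (gen_pow S2 1 @ gen_pow S1 (- 1), gen_pow S1 i\<^sub>2 @ gen_pow S2 j\<^sub>2)}"


section \<open>Abstract polyhedra\<close>

record 'a ranked_poset =
  elems :: "'a set"
  le_rel :: "'a rel"
  rk :: "'a \<Rightarrow> nat"

definition of_rank :: "'a ranked_poset \<Rightarrow> nat \<Rightarrow> 'a set" where
  "of_rank P i = {x \<in> elems P. rk P x = i}"

abbreviation vertices :: "'a ranked_poset \<Rightarrow> 'a set" where "vertices P \<equiv> of_rank P 0"
abbreviation edges :: "'a ranked_poset \<Rightarrow> 'a set" where "edges P \<equiv> of_rank P 1"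
abbreviation faces :: "'a ranked_poset \<Rightarrow> 'a set" where "faces P \<equiv> of_rank P 2"

definition incident :: "'a ranked_poset \<Rightarrow> 'a \<Rightarrow> 'a \<Rightarrow> bool" where
  "incident P x y \<longleftrightarrow> (x, y) \<in> le_rel P \<or> (y, x) \<in> le_rel P"

definition neighbours :: "'a ranked_poset \<Rightarrow> 'a \<Rightarrow> 'a set" where
  "neighbours P x = {y \<in> elems P. incident P x y \<and> y \<noteq> x}"

definition incidence_connected :: "'a ranked_poset \<Rightarrow> 'a set \<Rightarrow> bool" where
  "incidence_connected P S \<longleftrightarrow>
    S \<noteq> {} \<and> (\<forall>x\<in>S. \<forall>y\<in>S. (x, y) \<in> {(a, b). a \<in> S \<and> b \<in> S \<and> incident P a b}\<^sup>*)"

definition polyhedron :: "'a ranked_poset \<Rightarrow> bool" where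
  "polyhedron P \<longleftrightarrow>
    partial_order_on (elems P) (le_rel P) \<and>
    (\<forall>x\<in>elems P. rk P x \<in> {0, 1, 2}) \<and>
    (\<forall>x y. (x, y) \<in> le_rel P \<and> x \<noteq> y \<longrightarrow> rk P x < rk P y) \<and>
    (\<forall>e\<in>edges P. card {v \<in> vertices P. incident P v e} = 2 \<and>
                 card {f \<in> faces P. incident P f e} = 2) \<and>
    (\<forall>v\<in>vertices P. \<forall>f\<in>faces P. incident P v f \<longrightarrow>
        card {e \<in> edges P. incident P e v \<and> incident P e f} = 2) \<and>
    incidence_connected P (elems P) \<and>
    (\<forall>x\<in>vertices P \<union> faces P. incidence_connected P (neighbours P x))"

type_synonym 'a flag = "'a \<times> 'a \<times> 'a"

definition flags :: "'a ranked_poset \<Rightarrow> 'a flag set" where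
  "flags P = {(v, e, f). v \<in> vertices P \<and> e \<in> edges P \<and> f \<in> faces P \<and>
                incident P v e \<and> incident P e f \<and> incident P v f}"

fun flag_elem :: "'a flag \<Rightarrow> nat \<Rightarrow> 'a" where
  "flag_elem (v, e, f) i = (if i = 0 then v else if i = 1 then e else f)"

definition flag_adj :: "'a ranked_poset \<Rightarrow> 'a flag \<Rightarrow> nat \<Rightarrow> 'a flag" where
  "flag_adj P \<Phi> i =
    (THE \<Psi>. \<Psi> \<in> flags P \<and> (\<forall>j\<in>{0, 1, 2}. flag_elem \<Psi> j \<noteq> flag_elem \<Phi> j \<longleftrightarrow> j = i))"

text \<open>The finiteness conditions are needed because \<open>card\<close> is \<open>0\<close> on infinite sets.\<close>

definition has_type :: "'a ranked_poset \<Rightarrow> nat \<Rightarrow> nat \<Rightarrow> bool" where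
  "has_type P p q \<longleftrightarrow>
    (\<forall>f\<in>faces P. finite {e \<in> edges P. incident P e f} \<and>
                 card {e \<in> edges P. incident P e f} = p) \<and>
    (\<forall>v\<in>vertices P. finite {e \<in> edges P. incident P e v} \<and>
                 card {e \<in> edges P. incident P e v} = q)"

definition tight_of_type :: "'a ranked_poset \<Rightarrow> nat \<Rightarrow> nat \<Rightarrow> bool" where
  "tight_of_type P p q \<longleftrightarrow> has_type P p q \<and> finite (flags P) \<and> card (flags P) = 2 * p * q"


section \<open>Automorphisms, chirality, rotation groups\<close>

definition automorphisms :: "'a ranked_poset \<Rightarrow> ('a \<Rightarrow> 'a) set" where
  "automorphisms P = {g \<in> Bij (elems P).
     (\<forall>x\<in>elems P. rk P (g x) = rk P x) \<and>
     (\<forall>x\<in>elems P. \<forall>y\<in>elems P. (g x, g y) \<in> le_rel P \<longleftrightarrow> (x, y) \<in> le_rel P)}"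

text \<open>Automorphisms act on the right, as is usual for polytopes: in the product \<open>gh\<close> the
  factor \<open>g\<close> is applied first.\<close>

definition aut_group :: "'a ranked_poset \<Rightarrow> ('a \<Rightarrow> 'a) monoid" where
  "aut_group P =
    \<lparr>carrier = automorphisms P,
     monoid.mult = (\<lambda>g h. compose (elems P) h g),
     one = (\<lambda>x\<in>elems P. x)\<rparr>"

definition flag_map :: "('a \<Rightarrow> 'a) \<Rightarrow> 'a flag \<Rightarrow> 'a flag" where
  "flag_map g = (\<lambda>(v, e, f). (g v, g e, g f))"

definition transitive_on_flags :: "'a ranked_poset \<Rightarrow> 'a flag set \<Rightarrow> bool" where
  "transitive_on_flags P A \<longleftrightarrow> (\<forall>\<Phi>\<in>A. \<forall>\<Psi>\<in>A. \<exists>g\<in>automorphisms P. flag_map g \<Phi> = \<Psi>)"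

definition chiral :: "'a ranked_poset \<Rightarrow> bool" where
  "chiral P \<longleftrightarrow> polyhedron P \<and>
    (\<exists>A B. A \<union> B = flags P \<and> A \<inter> B = {} \<and>
       (\<forall>\<Phi>\<in>flags P. \<forall>i\<in>{0, 1, 2}. \<Phi> \<in> A \<longleftrightarrow> flag_adj P \<Phi> i \<in> B) \<and>
       transitive_on_flags P A \<and> transitive_on_flags P B) \<and>
    \<not> transitive_on_flags P (flags P)"

definition sigma1 :: "'a ranked_poset \<Rightarrow> 'a flag \<Rightarrow> 'a \<Rightarrow> 'a" where
  "sigma1 P \<Phi> = (THE g. g \<in> automorphisms P \<and> flag_map g \<Phi> = flag_adj P (flag_adj P \<Phi> 1) 0)"

definition sigma2 :: "'a ranked_poset \<Rightarrow> 'a flag \<Rightarrow> 'a \<Rightarrow> 'a" where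
  "sigma2 P \<Phi> = (THE g. g \<in> automorphisms P \<and> flag_map g \<Phi> = flag_adj P (flag_adj P \<Phi> 2) 1)"

definition rotation_group :: "'a ranked_poset \<Rightarrow> 'a flag \<Rightarrow> ('a \<Rightarrow> 'a) monoid" where
  "rotation_group P \<Phi> = subgroup_generated (aut_group P) {sigma1 P \<Phi>, sigma2 P \<Phi>}"

definition covers :: "'a ranked_poset \<Rightarrow> 'a flag \<Rightarrow> 'b ranked_poset \<Rightarrow> 'b flag \<Rightarrow> bool" where
  "covers P \<Phi> Q \<Psi> \<longleftrightarrow> (\<exists>h \<in> hom (rotation_group P \<Phi>) (rotation_group Q \<Psi>).
     h (sigma1 P \<Phi>) = sigma1 Q \<Psi> \<and> h (sigma2 P \<Phi>) = sigma2 Q \<Psi>)"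

text \<open>Tight polyhedra are finite, so every isomorphism type of possible \<open>Q\<close> is represented on a
  set of natural numbers. The covered polyhedron may carry any base flag, so both enantiomorphic
  forms of it are excluded.\<close>

definition atomic_chiral :: "'a ranked_poset \<Rightarrow> 'a flag \<Rightarrow> nat \<Rightarrow> nat \<Rightarrow> bool" where
  "atomic_chiral P \<Phi> p q \<longleftrightarrow> chiral P \<and> tight_of_type P p q \<and>
    \<not> (\<exists>(Q :: nat ranked_poset) \<Psi> p'. p' < p \<and> chiral Q \<and> tight_of_type Q p' q \<and>
          \<Psi> \<in> flags Q \<and> covers P \<Phi> Q \<Psi>) \<and>
    \<not> (\<exists>(Q :: nat ranked_poset) \<Psi> q'. q' < q \<and> chiral Q \<and> tight_of_type Q p q' \<and>
          \<Psi> \<in> flags Q \<and> covers P \<Phi> Q \<Psi>)"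

definition rotation_group_eq_Gamma ::
  "'a ranked_poset \<Rightarrow> 'a flag \<Rightarrow> int \<Rightarrow> int \<Rightarrow> int \<Rightarrow> int \<Rightarrow> int \<Rightarrow> int \<Rightarrow> bool" where
  "rotation_group_eq_Gamma P \<Phi> p q i\<^sub>1 j\<^sub>1 i\<^sub>2 j\<^sub>2 \<longleftrightarrow>
    (let R = Gamma_rels p q i\<^sub>1 j\<^sub>1 i\<^sub>2 j\<^sub>2 in
     \<exists>h \<in> iso (presented_group R) (rotation_group P \<Phi>).
       h (pres_class R [(S1, True)]) = sigma1 P \<Phi> \<and>
       h (pres_class R [(S2, True)]) = sigma2 P \<Phi>)"

end

theory Submission
  imports Defs "HOL-Algebra.Weak_Morphisms" "HOL-Algebra.Multiplicative_Group"
    "HOL-Library.Nat_Bijection"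
begin

text \<open>Let \<open>G = \<langle>x, y\<rangle>\<close> be the rotation group, \<open>z = x y\<close> and \<open>u = z x\<^sup>-\<^sup>2 z x\<^sup>2\<close>. Tightness means
  \<open>G = \<langle>x\<rangle>\<langle>y\<rangle>\<close> with trivial intersection, and the polyhedron is regular iff some automorphism of \<open>G\<close>
  inverts \<open>x\<close> and \<open>y\<close>.

  A pigeonhole count shows that the subgroup of order \<open>m\<close> of the larger of \<open>\<langle>x\<rangle>\<close>, \<open>\<langle>y\<rangle>\<close> is normal.
  By induction along such quotients, \<open>u = 1\<close> whenever \<open>x\<close> and \<open>y\<close> can be inverted; conversely
  \<open>u = 1\<close> makes \<open>x\<^sup>2\<close> central, and then \<open>x\<close> and \<open>y\<close> can be inverted. If \<open>P\<close> is atomic, the quotient by the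
  subgroup \<open>K\<close> of order \<open>m\<close> of \<open>\<langle>y\<rangle>\<close> is regular, so \<open>u\<close> is a nontrivial element of \<open>K\<close>. The
  involution \<open>z\<close> acts on \<open>K\<close> as \<open>\<plusminus>1\<close>; the sign \<open>+1\<close> would force \<open>u\<^sup>2 = 1\<close>, and the sign \<open>-1\<close> is
  equivalent to the two relations of the presentation. If \<open>\<alpha> \<ge> 2\<close>, the subgroup of order \<open>m\<close> of \<open>\<langle>x\<rangle>\<close> is
  central and its quotient is regular too, so that \<open>u \<in> \<langle>x\<rangle> \<inter> \<langle>y\<rangle> = 1\<close>.\<close>

section \<open>Flags of polyhedra\<close>

text \<open>Two obstacles shape the proof. Atomicity speaks of polyhedra while the argument is about
  groups, so a tight quotient of the rotation group, with both orders above 2, has to be realised as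
  a coset polyhedron on natural numbers before atomicity says anything about it. The induction along
  quotients must also stay within one type, so quotient groups are moved to the naturals too.

  The element u is the error in z x^2 z = x^2 u^-1. If u is central, conjugating by z once more
  gives x^2 = x^2 u^-2, so u = 1 because the order of u is odd. The constants of the presentation
  come from the same place: y^-1 x = x^3 y u holds identically, so the first relation says u = y^(k
  m^\<beta>), and the second one, given the first, says that x inverts u. For \<alpha> \<ge> 2 the
  power of x^2 generating the subgroup of order m has an exponent divisible by m, which kills the
  power of u that separates it from its conjugate under z.\<close>

lemma card_2_ex1_other:
  assumes "card S = 2" "a \<in> S"
  shows "\<exists>!b. b \<in> S \<and> b \<noteq> a"
proof -
  obtain c d where "S = {c, d}" "c \<noteq> d" using assms(1) by (auto simp: card_2_iff)
  then show ?thesis using assms(2) by auto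
qed

lemma flag_eqI:
  "(\<And>j. j \<in> {0, 1, 2} \<Longrightarrow> flag_elem \<Phi> j = flag_elem \<Psi> j) \<Longrightarrow> \<Phi> = \<Psi>"
  by (cases \<Phi>; cases \<Psi>) force

lemma flag_elem_flag_map [simp]: "flag_elem (flag_map g \<Phi>) i = g (flag_elem \<Phi> i)"
  by (cases \<Phi>) (simp add: flag_map_def)

lemma incident_sym: "incident P a b \<longleftrightarrow> incident P b a"
  by (auto simp: incident_def)

text \<open>The set \<open>J\<close> of allowed ranks is a parameter because flags sharing their
  element of rank i are to be joined by steps that never change rank i.\<close>

definition adj_steps :: "'a ranked_poset \<Rightarrow> nat set \<Rightarrow> 'a flag rel" where
  "adj_steps P J = {(\<Phi>, flag_adj P \<Phi> i) | \<Phi> i. \<Phi> \<in> flags P \<and> i \<in> J}"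

locale poly =
  fixes P :: "'a ranked_poset"
  assumes polyhedron: "polyhedron P"
begin

lemma le_rel_partial_order: "partial_order_on (elems P) (le_rel P)"
  and rk_le: "a \<in> elems P \<Longrightarrow> rk P a \<in> {0, 1, 2}"
  and rk_less: "(a, b) \<in> le_rel P \<Longrightarrow> a \<noteq> b \<Longrightarrow> rk P a < rk P b"
  and card_vertices_of_edge: "e \<in> edges P \<Longrightarrow> card {v \<in> vertices P. incident P v e} = 2"
  and card_faces_of_edge: "e \<in> edges P \<Longrightarrow> card {f \<in> faces P. incident P f e} = 2"
  and card_edges_between: "v \<in> vertices P \<Longrightarrow> f \<in> faces P \<Longrightarrow> incident P v f \<Longrightarrow>
    card {e \<in> edges P. incident P e v \<and> incident P e f} = 2"
  and elems_connected: "incidence_connected P (elems P)"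
  and link_connected: "a \<in> vertices P \<union> faces P \<Longrightarrow> incidence_connected P (neighbours P a)"
  using polyhedron unfolding polyhedron_def by blast+

lemma incident_iff_le: "rk P a < rk P b \<Longrightarrow> incident P a b \<longleftrightarrow> (a, b) \<in> le_rel P"
  unfolding incident_def using rk_less by fastforce

lemma incident_eq_rk: "incident P a b \<Longrightarrow> rk P a = rk P b \<Longrightarrow> a = b"
  unfolding incident_def using rk_less by fastforce

lemma incident_trans:
  assumes "v \<in> vertices P" "e \<in> edges P" "f \<in> faces P" "incident P v e" "incident P e f"
  shows "incident P v f"
proof -
  have "(v, e) \<in> le_rel P" "(e, f) \<in> le_rel P"
    using assms incident_iff_le by (auto simp: of_rank_def)
  then have "(v, f) \<in> le_rel P"
    using partial_order_onD(2)[OF le_rel_partial_order] by (blast dest: transD)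
  then show ?thesis by (simp add: incident_def)
qed

lemma flags_iff:
  "(v, e, f) \<in> flags P \<longleftrightarrow> v \<in> vertices P \<and> e \<in> edges P \<and> f \<in> faces P \<and> incident P v e \<and> incident P e f"
  using incident_trans by (auto simp: flags_def)

text \<open>Each of the three counts equal to 2 in the definition of a polyhedron supplies one rank.
  This is what gives the definite description in \<open>flag_adj\<close> a value.\<close>

lemma ex1_flag_adj:
  assumes "\<Phi> \<in> flags P" "i \<in> {0, 1, 2}"
  shows "\<exists>!\<Psi>. \<Psi> \<in> flags P \<and> (\<forall>j\<in>{0, 1, 2}. flag_elem \<Psi> j \<noteq> flag_elem \<Phi> j \<longleftrightarrow> j = i)"
proof -
  obtain v e f where F: "\<Phi> = (v, e, f)" by (cases \<Phi>)
  have fl: "v \<in> vertices P" "e \<in> edges P" "f \<in> faces P" "incident P v e" "incident P e f"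
    "incident P v f"
    using assms(1) F by (auto simp: flags_def)
  consider "i = 0" | "i = 1" | "i = 2" using assms(2) by auto
  then show ?thesis
  proof cases
    case 1
    obtain v' where v': "v' \<in> {v \<in> vertices P. incident P v e} \<and> v' \<noteq> v"
      and un: "\<And>w. w \<in> {v \<in> vertices P. incident P v e} \<and> w \<noteq> v \<Longrightarrow> w = v'"
      using card_2_ex1_other[OF card_vertices_of_edge[OF fl(2)], of v] fl(1,4) by blast
    show ?thesis
    proof (rule ex1I[of _ "(v', e, f)"])
      show "(v', e, f) \<in> flags P \<and> (\<forall>j\<in>{0, 1, 2}. flag_elem (v', e, f) j \<noteq> flag_elem \<Phi> j \<longleftrightarrow> j = i)"
        using v' fl by (simp add: flags_iff F 1)
    next
      fix \<Psi>
      assume "\<Psi> \<in> flags P \<and> (\<forall>j\<in>{0, 1, 2}. flag_elem \<Psi> j \<noteq> flag_elem \<Phi> j \<longleftrightarrow> j = i)"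
      then show "\<Psi> = (v', e, f)" using un by (cases \<Psi>) (simp add: flags_iff F 1)
    qed
  next
    case 2
    obtain e' where e': "e' \<in> {e \<in> edges P. incident P e v \<and> incident P e f} \<and> e' \<noteq> e"
      and un: "\<And>w. w \<in> {e \<in> edges P. incident P e v \<and> incident P e f} \<and> w \<noteq> e \<Longrightarrow> w = e'"
      using card_2_ex1_other[OF card_edges_between[OF fl(1,3,6)], of e] fl(2,4,5) incident_sym[of P e v]
      by blast
    show ?thesis
    proof (rule ex1I[of _ "(v, e', f)"])
      show "(v, e', f) \<in> flags P \<and> (\<forall>j\<in>{0, 1, 2}. flag_elem (v, e', f) j \<noteq> flag_elem \<Phi> j \<longleftrightarrow> j = i)"
        using e' fl incident_sym[of P e' v] by (simp add: flags_iff F 2)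
    next
      fix \<Psi>
      assume "\<Psi> \<in> flags P \<and> (\<forall>j\<in>{0, 1, 2}. flag_elem \<Psi> j \<noteq> flag_elem \<Phi> j \<longleftrightarrow> j = i)"
      then show "\<Psi> = (v, e', f)"
        using un by (cases \<Psi>) (simp add: flags_iff F 2 incident_sym[of P _ v])
    qed
  next
    case 3
    obtain f' where f': "f' \<in> {f \<in> faces P. incident P f e} \<and> f' \<noteq> f"
      and un: "\<And>w. w \<in> {f \<in> faces P. incident P f e} \<and> w \<noteq> f \<Longrightarrow> w = f'"
      using card_2_ex1_other[OF card_faces_of_edge[OF fl(2)], of f] fl(3,5) incident_sym[of P e f] by blast
    show ?thesis
    proof (rule ex1I[of _ "(v, e, f')"])
      show "(v, e, f') \<in> flags P \<and> (\<forall>j\<in>{0, 1, 2}. flag_elem (v, e, f') j \<noteq> flag_elem \<Phi> j \<longleftrightarrow> j = i)"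
        using f' fl incident_sym[of P e f'] by (simp add: flags_iff F 3)
    next
      fix \<Psi>
      assume "\<Psi> \<in> flags P \<and> (\<forall>j\<in>{0, 1, 2}. flag_elem \<Psi> j \<noteq> flag_elem \<Phi> j \<longleftrightarrow> j = i)"
      then show "\<Psi> = (v, e, f')"
        using un by (cases \<Psi>) (simp add: flags_iff F 3 incident_sym[of P e])
    qed
  qed
qed

lemma
  assumes "\<Phi> \<in> flags P" "i \<in> {0, 1, 2}"
  shows flag_adj_in_flags: "flag_adj P \<Phi> i \<in> flags P"
    and flag_elem_adj_neq: "j \<in> {0, 1, 2} \<Longrightarrow> flag_elem (flag_adj P \<Phi> i) j \<noteq> flag_elem \<Phi> j \<longleftrightarrow> j = i"
  using theI'[OF ex1_flag_adj[OF assms]] unfolding flag_adj_def[symmetric] by blast+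

lemma flag_adj_eqI:
  assumes "\<Phi> \<in> flags P" "i \<in> {0, 1, 2}" "\<Psi> \<in> flags P"
    "\<And>j. j \<in> {0, 1, 2} \<Longrightarrow> flag_elem \<Psi> j \<noteq> flag_elem \<Phi> j \<longleftrightarrow> j = i"
  shows "flag_adj P \<Phi> i = \<Psi>"
  unfolding flag_adj_def by (rule the1_equality[OF ex1_flag_adj]) (use assms in auto)

lemma flag_adj_adj:
  assumes "\<Phi> \<in> flags P" "i \<in> {0, 1, 2}"
  shows "flag_adj P (flag_adj P \<Phi> i) i = \<Phi>"
  using assms flag_adj_in_flags flag_elem_adj_neq by (intro flag_adj_eqI) metis+

lemma eq_or_flag_adj:
  assumes "\<Phi> \<in> flags P" "\<Psi> \<in> flags P" "i \<in> {0, 1, 2}"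
    "\<And>j. j \<in> {0, 1, 2} \<Longrightarrow> j \<noteq> i \<Longrightarrow> flag_elem \<Psi> j = flag_elem \<Phi> j"
  shows "\<Psi> = \<Phi> \<or> \<Psi> = flag_adj P \<Phi> i"
proof (cases "flag_elem \<Psi> i = flag_elem \<Phi> i")
  case True
  have "flag_elem \<Psi> j = flag_elem \<Phi> j" if "j \<in> {0, 1, 2}" for j
    using assms(4)[OF that] True by (cases "j = i") simp_all
  then have "\<Psi> = \<Phi>" by (rule flag_eqI)
  then show ?thesis ..
next
  case False
  then have "flag_elem \<Psi> j \<noteq> flag_elem \<Phi> j \<longleftrightarrow> j = i" if "j \<in> {0, 1, 2}" for j
    using assms(4)[OF that] by (cases "j = i") simp_all
  then have "flag_adj P \<Phi> i = \<Psi>" by (intro flag_adj_eqI assms(1-3))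
  then show ?thesis by simp
qed

text \<open>The new vertex and the new face are both incident to the unchanged edge, hence to each
  other, so both orders lead to the same flag. The relation (x y)^2 = 1 comes from here.\<close>

lemma flag_adj_0_2:
  assumes "\<Phi> \<in> flags P"
  shows "flag_adj P (flag_adj P \<Phi> 0) 2 = flag_adj P (flag_adj P \<Phi> 2) 0"
proof -
  obtain v e f where F: "\<Phi> = (v, e, f)" by (cases \<Phi>)
  obtain v' e' f' where F0: "flag_adj P \<Phi> 0 = (v', e', f')" by (cases "flag_adj P \<Phi> 0")
  obtain v'' e'' f'' where F2: "flag_adj P \<Phi> 2 = (v'', e'', f'')" by (cases "flag_adj P \<Phi> 2")
  have 0: "e' = e" "f' = f" "v' \<noteq> v" "(v', e, f) \<in> flags P"
    using flag_elem_adj_neq[OF assms, of 0 0] flag_elem_adj_neq[OF assms, of 0 1]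
      flag_elem_adj_neq[OF assms, of 0 2] flag_adj_in_flags[OF assms, of 0] F F0 by auto
  have 2: "e'' = e" "v'' = v" "f'' \<noteq> f" "(v, e, f'') \<in> flags P"
    using flag_elem_adj_neq[OF assms, of 2 0] flag_elem_adj_neq[OF assms, of 2 1]
      flag_elem_adj_neq[OF assms, of 2 2] flag_adj_in_flags[OF assms, of 2] F F2 by auto
  have "(v', e, f'') \<in> flags P" using 0(4) 2(4) by (auto simp: flags_iff)
  then have "flag_adj P (v', e, f) 2 = (v', e, f'')" "flag_adj P (v, e, f'') 0 = (v', e, f'')"
    using 0 2 by (auto intro!: flag_adj_eqI)
  then show ?thesis unfolding F0 F2 0(1,2) 2(1,2) by simp
qed

section \<open>From connected incidence graphs to paths of adjacent flags\<close>

lemma incident_flag_elem: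
  "\<Phi> \<in> flags P \<Longrightarrow> i \<in> {0, 1, 2} \<Longrightarrow> j \<in> {0, 1, 2} \<Longrightarrow> i \<noteq> j \<Longrightarrow>
    incident P (flag_elem \<Phi> i) (flag_elem \<Phi> j)"
  by (cases \<Phi>) (auto simp: flags_def incident_def)

lemma flag_elem_in_elems:
  "\<Phi> \<in> flags P \<Longrightarrow> i \<in> {0, 1, 2} \<Longrightarrow> flag_elem \<Phi> i \<in> elems P \<and> rk P (flag_elem \<Phi> i) = i"
  by (cases \<Phi>) (auto simp: flags_def of_rank_def)

lemma ex_flag_of_chain:
  assumes "a \<in> elems P" "b \<in> elems P" "c \<in> elems P"
    "incident P a b" "incident P b c" "incident P a c"
    "rk P a \<noteq> rk P b" "rk P b \<noteq> rk P c" "rk P a \<noteq> rk P c"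
  shows "\<exists>\<Phi>\<in>flags P. flag_elem \<Phi> (rk P a) = a \<and> flag_elem \<Phi> (rk P b) = b \<and> flag_elem \<Phi> (rk P c) = c"
proof -
  have inc: "incident P a b" "incident P b c" "incident P a c"
    "incident P b a" "incident P c b" "incident P c a"
    using assms(4-6) by (simp_all add: incident_def disj_commute)
  have "rk P a = 0 \<and> rk P b = 1 \<and> rk P c = 2 \<or> rk P a = 0 \<and> rk P c = 1 \<and> rk P b = 2 \<or>
    rk P b = 0 \<and> rk P a = 1 \<and> rk P c = 2 \<or> rk P b = 0 \<and> rk P c = 1 \<and> rk P a = 2 \<or>
    rk P c = 0 \<and> rk P a = 1 \<and> rk P b = 2 \<or> rk P c = 0 \<and> rk P b = 1 \<and> rk P a = 2"
    using rk_le[OF assms(1)] rk_le[OF assms(2)] rk_le[OF assms(3)] assms(7-9)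
    by (elim insertE emptyE) simp_all
  then show ?thesis
  proof (elim disjE conjE)
    assume "rk P a = 0" "rk P b = 1" "rk P c = 2"
    then show ?thesis using assms(1-3) inc by (intro bexI[of _ "(a, b, c)"]) (simp_all add: flags_def of_rank_def)
  next
    assume "rk P a = 0" "rk P c = 1" "rk P b = 2"
    then show ?thesis using assms(1-3) inc by (intro bexI[of _ "(a, c, b)"]) (simp_all add: flags_def of_rank_def)
  next
    assume "rk P b = 0" "rk P a = 1" "rk P c = 2"
    then show ?thesis using assms(1-3) inc by (intro bexI[of _ "(b, a, c)"]) (simp_all add: flags_def of_rank_def)
  next
    assume "rk P b = 0" "rk P c = 1" "rk P a = 2"
    then show ?thesis using assms(1-3) inc by (intro bexI[of _ "(b, c, a)"]) (simp_all add: flags_def of_rank_def)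
  next
    assume "rk P c = 0" "rk P a = 1" "rk P b = 2"
    then show ?thesis using assms(1-3) inc by (intro bexI[of _ "(c, a, b)"]) (simp_all add: flags_def of_rank_def)
  next
    assume "rk P c = 0" "rk P b = 1" "rk P a = 2"
    then show ?thesis using assms(1-3) inc by (intro bexI[of _ "(c, b, a)"]) (simp_all add: flags_def of_rank_def)
  qed
qed

text \<open>Each of the three counts equals 2, so the set of elements filling the missing rank is
  nonempty.\<close>

lemma ex_flag_of_incident:
  assumes "a \<in> elems P" "b \<in> elems P" "incident P a b" "a \<noteq> b"
  shows "\<exists>\<Phi>\<in>flags P. flag_elem \<Phi> (rk P a) = a \<and> flag_elem \<Phi> (rk P b) = b"
proof -
  \<comment> \<open>The claim is symmetric in \<open>a\<close> and \<open>b\<close>; here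
    \<open>u\<close> is whichever of them has the smaller rank.\<close>
  have *: ?thesis if le: "rk P u < rk P v" and uv: "{u, v} = {a, b}" for u v
  proof -
    have "u \<in> elems P" "v \<in> elems P" "incident P u v"
      using uv assms le by (auto simp: doubleton_eq_iff incident_def)
    then consider "u \<in> vertices P" "v \<in> edges P" | "u \<in> vertices P" "v \<in> faces P"
      | "u \<in> edges P" "v \<in> faces P"
      using rk_le[of u] rk_le[of v] le by (auto simp: of_rank_def)
    then have "\<exists>\<Phi>\<in>flags P. flag_elem \<Phi> (rk P u) = u \<and> flag_elem \<Phi> (rk P v) = v"
    proof cases
      case 1
      then have "{f \<in> faces P. incident P f v} \<noteq> {}" using card_faces_of_edge[of v] by (metis card.empty zero_neq_numeral)
      then obtain f where "f \<in> faces P" "incident P f v" by blast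
      then have "(u, v, f) \<in> flags P" using 1 \<open>incident P u v\<close> incident_sym[of P f v] by (simp add: flags_iff)
      then show ?thesis using 1 by (intro bexI[of _ "(u, v, f)"]) (auto simp: of_rank_def)
    next
      case 2
      then have "{e \<in> edges P. incident P e u \<and> incident P e v} \<noteq> {}"
        using card_edges_between[of u v] \<open>incident P u v\<close> by (metis card.empty zero_neq_numeral)
      then obtain e where "e \<in> edges P" "incident P e u" "incident P e v" by blast
      then have "(u, e, v) \<in> flags P" using 2 incident_sym[of P e u] by (simp add: flags_iff)
      then show ?thesis using 2 by (intro bexI[of _ "(u, e, v)"]) (auto simp: of_rank_def)
    next
      case 3
      then have "{w \<in> vertices P. incident P w u} \<noteq> {}" using card_vertices_of_edge[of u] by (metis card.empty zero_neq_numeral)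
      then obtain w where "w \<in> vertices P" "incident P w u" by blast
      then have "(w, u, v) \<in> flags P" using 3 \<open>incident P u v\<close> by (simp add: flags_iff)
      then show ?thesis using 3 by (intro bexI[of _ "(w, u, v)"]) (auto simp: of_rank_def)
    qed
    then show ?thesis using uv by (auto simp: doubleton_eq_iff)
  qed
  show ?thesis
    using *[of a b] *[of b a] incident_eq_rk[OF assms(3)] assms(4)
    by (metis insert_commute linorder_neqE_nat)
qed

lemma adj_steps_eq_or_adj:
  assumes "\<Phi> \<in> flags P" "\<Psi> \<in> flags P" "i \<in> {0, 1, 2}" "i \<in> J"
    "\<And>j. j \<in> {0, 1, 2} \<Longrightarrow> j \<noteq> i \<Longrightarrow> flag_elem \<Psi> j = flag_elem \<Phi> j"
  shows "(\<Phi>, \<Psi>) \<in> (adj_steps P J)\<^sup>*"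
  using eq_or_flag_adj[OF assms(1-3,5)] assms(1,4) unfolding adj_steps_def by blast

lemma adj_steps_mono: "J \<subseteq> J' \<Longrightarrow> (adj_steps P J)\<^sup>* \<subseteq> (adj_steps P J')\<^sup>*"
  unfolding adj_steps_def by (intro rtrancl_mono) blast

text \<open>A path in the link of \<open>x\<close> lifts to flags: two flags through
  \<open>x\<close> and a neighbour a differ at most in the third rank, and a step from b to c of the
  path is covered by a flag containing \<open>x\<close>, b and c.\<close>

lemma adj_steps_link:
  assumes "x \<in> vertices P \<union> faces P"
    and "\<Phi> \<in> flags P" "\<Psi> \<in> flags P" "flag_elem \<Phi> (rk P x) = x" "flag_elem \<Psi> (rk P x) = x"
  shows "(\<Phi>, \<Psi>) \<in> (adj_steps P ({0, 1, 2} - {rk P x}))\<^sup>*"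
proof -
  let ?J = "{0, 1, 2} - {rk P x}"
  let ?S = "neighbours P x"
  have xel: "x \<in> elems P" and xrk: "rk P x \<in> {0, 1, 2}"
    using assms(1) rk_le by (auto simp: of_rank_def)
  have nb: "a \<in> elems P" "incident P x a" "rk P a \<noteq> rk P x" "rk P a \<in> {0, 1, 2}" if "a \<in> ?S" for a
    using that incident_eq_rk[of x a] rk_le[of a] by (auto simp: neighbours_def)
  have same: "(\<Phi>, \<Psi>) \<in> (adj_steps P ?J)\<^sup>*"
    if "a \<in> ?S" "\<Phi> \<in> flags P" "\<Psi> \<in> flags P" "flag_elem \<Phi> (rk P x) = x" "flag_elem \<Psi> (rk P x) = x"
      "flag_elem \<Phi> (rk P a) = a" "flag_elem \<Psi> (rk P a) = a" for a \<Phi> \<Psi>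
  proof -
    \<comment> \<open>The three ranks add up to 3, so this is the rank of neither \<open>x\<close>
      nor \<open>a\<close>.\<close>
    define k where "k = 3 - rk P x - rk P a"
    have k: "k \<in> {0, 1, 2}" "k \<noteq> rk P x"
      using nb(3,4)[OF \<open>a \<in> ?S\<close>] xrk by (auto simp: k_def)
    have *: "j = rk P x \<or> j = rk P a" if "j \<in> {0, 1, 2}" "j \<noteq> k" for j
      using nb(3,4)[OF \<open>a \<in> ?S\<close>] xrk that by (auto simp: k_def)
    show ?thesis
    proof (rule adj_steps_eq_or_adj[of _ _ k])
      show "flag_elem \<Psi> j = flag_elem \<Phi> j" if "j \<in> {0, 1, 2}" "j \<noteq> k" for j
        using *[OF that] \<open>flag_elem \<Phi> (rk P x) = x\<close> \<open>flag_elem \<Psi> (rk P x) = x\<close>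
          \<open>flag_elem \<Phi> (rk P a) = a\<close> \<open>flag_elem \<Psi> (rk P a) = a\<close> by auto
    qed (use that k in blast)+
  qed
  have path: "(\<Phi>, \<Psi>) \<in> (adj_steps P ?J)\<^sup>*"
    if ab: "(a, b) \<in> {(a, b). a \<in> ?S \<and> b \<in> ?S \<and> incident P a b}\<^sup>*" and a: "a \<in> ?S"
      "flag_elem \<Phi> (rk P a) = a" and b: "\<Psi> \<in> flags P" "flag_elem \<Psi> (rk P x) = x" "flag_elem \<Psi> (rk P b) = b"
    for a b \<Psi>
    using ab b
  proof (induction arbitrary: \<Psi> rule: rtrancl_induct)
    case base
    then show ?case using same[OF a(1) assms(2) _ assms(4)] a(2) by blast
  next
    case (step b c)
    have bc: "b \<in> ?S" "c \<in> ?S" "incident P b c" using step.hyps(2) by auto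
    show ?case
    proof (cases "b = c")
      case True
      then show ?thesis using step.IH[OF step.prems(1,2)] step.prems(3) by blast
    next
      case False
      then have "rk P b \<noteq> rk P c" using bc(3) incident_eq_rk by blast
      then obtain \<Theta> where T: "\<Theta> \<in> flags P" "flag_elem \<Theta> (rk P x) = x"
        "flag_elem \<Theta> (rk P b) = b" "flag_elem \<Theta> (rk P c) = c"
        using ex_flag_of_chain[OF xel nb(1)[OF bc(1)] nb(1)[OF bc(2)] nb(2)[OF bc(1)] bc(3) nb(2)[OF bc(2)]]
          nb(3)[OF bc(1)] nb(3)[OF bc(2)] by auto
      have "(\<Phi>, \<Theta>) \<in> (adj_steps P ?J)\<^sup>*" by (rule step.IH[OF T(1,2,3)])
      also have "(\<Theta>, \<Psi>) \<in> (adj_steps P ?J)\<^sup>*"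
        by (rule same[OF bc(2) T(1) step.prems(1) T(2) step.prems(2) T(4) step.prems(3)])
      finally show ?thesis .
    qed
  qed
  \<comment> \<open>Any rank other than that of \<open>x\<close> serves: the path in the link runs
    between the elements of this rank in the two flags.\<close>
  let ?i = "if rk P x = 0 then 1 else 0"
  have i: "?i \<in> {0, 1, 2}" "?i \<noteq> rk P x" by auto
  have inS: "flag_elem \<Theta> ?i \<in> ?S" if "\<Theta> \<in> flags P" "flag_elem \<Theta> (rk P x) = x" for \<Theta>
    using that incident_flag_elem[OF that(1) xrk i(1)] flag_elem_in_elems[OF that(1) i(1)] i(2)
    unfolding neighbours_def by auto
  have rki: "rk P (flag_elem \<Theta> ?i) = ?i" if "\<Theta> \<in> flags P" for \<Theta>
    using flag_elem_in_elems[OF that i(1)] by auto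
  have "(flag_elem \<Phi> ?i, flag_elem \<Psi> ?i) \<in> {(a, b). a \<in> ?S \<and> b \<in> ?S \<and> incident P a b}\<^sup>*"
    using link_connected[OF assms(1)] inS[OF assms(2,4)] inS[OF assms(3,5)]
    unfolding incidence_connected_def by blast
  then show ?thesis
    by (rule path[OF _ inS[OF assms(2,4)] _ assms(3,5)]) (simp_all only: rki[OF assms(2)] rki[OF assms(3)])
qed

text \<open>The connectedness axioms speak of links of vertices and faces; around an edge one change
  of vertex followed by one change of face is enough, because a vertex and a face of the same edge
  are always incident.\<close>

lemma adj_steps_edge:
  assumes "\<Phi> \<in> flags P" "\<Psi> \<in> flags P" "flag_elem \<Phi> 1 = flag_elem \<Psi> 1"
  shows "(\<Phi>, \<Psi>) \<in> (adj_steps P {0, 2})\<^sup>*"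
proof -
  obtain v e f v' f' where F: "\<Phi> = (v, e, f)" "\<Psi> = (v', e, f')"
    using assms(3) by (cases \<Phi>; cases \<Psi>) auto
  have m: "(v', e, f) \<in> flags P" using assms F by (auto simp: flags_iff)
  have "(\<Phi>, (v', e, f)) \<in> (adj_steps P {0, 2})\<^sup>*"
    using assms m F by (intro adj_steps_eq_or_adj[of _ _ 0]) auto
  also have "((v', e, f), \<Psi>) \<in> (adj_steps P {0, 2})\<^sup>*"
    using assms m F by (intro adj_steps_eq_or_adj[of _ _ 2]) auto
  finally show ?thesis .
qed

lemma adj_steps_same_elem:
  assumes "i \<in> {0, 1, 2}" "\<Phi> \<in> flags P" "\<Psi> \<in> flags P" "flag_elem \<Phi> i = flag_elem \<Psi> i"
  shows "(\<Phi>, \<Psi>) \<in> (adj_steps P ({0, 1, 2} - {i}))\<^sup>*"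
proof (cases "i = 1")
  case True
  then have "{0, 1, 2} - {i} = {0, 2}" by auto
  then show ?thesis using adj_steps_edge[OF assms(2,3)] assms(4) True by simp
next
  case False
  then have "flag_elem \<Phi> i \<in> vertices P \<union> faces P" "rk P (flag_elem \<Phi> i) = i"
    using flag_elem_in_elems[OF assms(2,1)] assms(1) by (auto simp: of_rank_def)
  then show ?thesis using adj_steps_link[of "flag_elem \<Phi> i" \<Phi> \<Psi>] assms by simp
qed

text \<open>Consecutive elements of a path in the incidence graph lie in a common flag, and flags
  with a common element are already joined.\<close>

lemma adj_steps_all:
  assumes "\<Phi> \<in> flags P" "\<Psi> \<in> flags P"
  shows "(\<Phi>, \<Psi>) \<in> (adj_steps P {0, 1, 2})\<^sup>*"
proof -
  have same: "(\<Phi>, \<Psi>) \<in> (adj_steps P {0, 1, 2})\<^sup>*"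
    if "i \<in> {0, 1, 2}" "\<Phi> \<in> flags P" "\<Psi> \<in> flags P" "flag_elem \<Phi> i = flag_elem \<Psi> i" for i \<Phi> \<Psi>
    using adj_steps_same_elem[OF that] adj_steps_mono[of "{0, 1, 2} - {i}" "{0, 1, 2}"] by blast
  have path: "(\<Phi>, \<Psi>) \<in> (adj_steps P {0, 1, 2})\<^sup>*"
    if ab: "(a, b) \<in> {(a, b). a \<in> elems P \<and> b \<in> elems P \<and> incident P a b}\<^sup>*" and a: "a \<in> elems P"
      "flag_elem \<Phi> (rk P a) = a" and b: "\<Psi> \<in> flags P" "flag_elem \<Psi> (rk P b) = b" for a b \<Psi>
    using ab b
  proof (induction arbitrary: \<Psi> rule: rtrancl_induct)
    case base
    then show ?case using same[OF rk_le[OF a(1)] assms(1)] a(2) by simp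
  next
    case (step b c)
    have bc: "b \<in> elems P" "c \<in> elems P" "incident P b c" using step.hyps(2) by auto
    show ?case
    proof (cases "b = c")
      case True
      then show ?thesis using step.IH[OF step.prems(1)] step.prems(2) by blast
    next
      case False
      then obtain \<Theta> where T: "\<Theta> \<in> flags P" "flag_elem \<Theta> (rk P b) = b" "flag_elem \<Theta> (rk P c) = c"
        using ex_flag_of_incident[OF bc] by blast
      have "(\<Phi>, \<Theta>) \<in> (adj_steps P {0, 1, 2})\<^sup>*" by (rule step.IH[OF T(1,2)])
      also have "(\<Theta>, \<Psi>) \<in> (adj_steps P {0, 1, 2})\<^sup>*"
        by (rule same[OF rk_le[OF bc(2)] T(1) step.prems(1)]) (simp only: T(3) step.prems(2))
      finally show ?thesis .
    qed
  qed
  have "flag_elem \<Phi> 0 \<in> elems P" "flag_elem \<Psi> 0 \<in> elems P"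
    "rk P (flag_elem \<Phi> 0) = 0" "rk P (flag_elem \<Psi> 0) = 0"
    using flag_elem_in_elems assms by auto
  then show ?thesis
    using path[of "flag_elem \<Phi> 0" "flag_elem \<Psi> 0"] elems_connected assms
    unfolding incidence_connected_def by simp
qed

text \<open>The form in which connectedness is used: it shows that a quantity attached to flags
  depends only on their element of rank \<open>i\<close>, and it enumerates all flags around a
  vertex or face.\<close>

lemma flag_closed_induct:
  assumes "\<Phi> \<in> flags P" "\<Psi> \<in> flags P" "i \<in> {0, 1, 2}" "flag_elem \<Phi> i = flag_elem \<Psi> i" "Q \<Phi>"
    "\<And>\<Theta> j. \<Theta> \<in> flags P \<Longrightarrow> Q \<Theta> \<Longrightarrow> j \<in> {0, 1, 2} - {i} \<Longrightarrow> Q (flag_adj P \<Theta> j)"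
  shows "Q \<Psi>"
  using adj_steps_same_elem[OF assms(3,1,2,4)] assms(5,6)
  by (induction rule: rtrancl_induct) (auto simp: adj_steps_def)

lemma flag_induct:
  assumes "\<Phi> \<in> flags P" "\<Psi> \<in> flags P" "Q \<Phi>"
    "\<And>\<Theta> j. \<Theta> \<in> flags P \<Longrightarrow> Q \<Theta> \<Longrightarrow> j \<in> {0, 1, 2} \<Longrightarrow> Q (flag_adj P \<Theta> j)"
  shows "Q \<Psi>"
  using adj_steps_all[OF assms(1,2)] assms(3,4)
  by (induction rule: rtrancl_induct) (auto simp: adj_steps_def)

text \<open>A given flag ensures that the poset is not a single isolated element: either
  \<open>a\<close> belongs to that flag, or a path joins it to another element and has to leave
  \<open>a\<close>.\<close>

lemma ex_flag_of_elem:
  assumes "\<Phi> \<in> flags P" "a \<in> elems P"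
  shows "\<exists>\<Psi>\<in>flags P. flag_elem \<Psi> (rk P a) = a"
proof (cases "flag_elem \<Phi> (rk P a) = a")
  case False
  have "flag_elem \<Phi> (rk P a) \<in> elems P" using flag_elem_in_elems[OF assms(1) rk_le] assms(2) by blast
  then have "(a, flag_elem \<Phi> (rk P a)) \<in> {(a, b). a \<in> elems P \<and> b \<in> elems P \<and> incident P a b}\<^sup>*"
    using elems_connected assms(2) unfolding incidence_connected_def by blast
  then have "\<exists>b. b \<noteq> a \<and> (a, b) \<in> {(a, b). a \<in> elems P \<and> b \<in> elems P \<and> incident P a b}"
    using False
  proof (induction rule: rtrancl_induct)
    case (step y z)
    then show ?case by (cases "y = a") auto
  qed auto
  then show ?thesis using ex_flag_of_incident[of a] by blast
qed (use assms in blast)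

end

section \<open>Automorphisms and their action on flags\<close>

lemma automorphismsD:
  assumes "g \<in> automorphisms P"
  shows "g \<in> Bij (elems P)" "bij_betw g (elems P) (elems P)" "g \<in> extensional (elems P)"
    "a \<in> elems P \<Longrightarrow> g a \<in> elems P" "a \<in> elems P \<Longrightarrow> rk P (g a) = rk P a"
    "a \<in> elems P \<Longrightarrow> b \<in> elems P \<Longrightarrow> (g a, g b) \<in> le_rel P \<longleftrightarrow> (a, b) \<in> le_rel P"
  using assms Bij_imp_funcset[of g "elems P"] unfolding automorphisms_def Bij_def by auto

lemma compose_automorphisms:
  assumes "g \<in> automorphisms P" "h \<in> automorphisms P"
  shows "compose (elems P) h g \<in> automorphisms P"
  using compose_Bij[OF automorphismsD(1)[OF assms(2)] automorphismsD(1)[OF assms(1)]]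
    automorphismsD(4-6)[OF assms(1)] automorphismsD(4-6)[OF assms(2)]
  unfolding automorphisms_def by (simp add: compose_def)

lemma inv_automorphisms:
  assumes "g \<in> automorphisms P"
  shows "(\<lambda>x\<in>elems P. inv_into (elems P) g x) \<in> automorphisms P"
proof -
  let ?g = "inv_into (elems P) g"
  have *: "?g a \<in> elems P \<and> g (?g a) = a" if "a \<in> elems P" for a
    using that automorphismsD(2)[OF assms] by (metis bij_betw_def f_inv_into_f inv_into_into)
  have rk: "rk P (?g a) = rk P a" if "a \<in> elems P" for a
    using automorphismsD(5)[OF assms, of "?g a"] *[OF that] by simp
  have le: "(?g a, ?g b) \<in> le_rel P \<longleftrightarrow> (a, b) \<in> le_rel P" if "a \<in> elems P" "b \<in> elems P" for a b
    using automorphismsD(6)[OF assms, of "?g a" "?g b"] *[OF that(1)] *[OF that(2)] by simp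
  show ?thesis
    using restrict_inv_into_Bij[OF automorphismsD(1)[OF assms]] rk le
    unfolding automorphisms_def by simp
qed

lemma group_aut_group: "group (aut_group P)"
proof (rule groupI)
  show "\<one>\<^bsub>aut_group P\<^esub> \<in> carrier (aut_group P)"
    using id_Bij[of "elems P"] by (simp add: aut_group_def automorphisms_def)
  fix g h k assume g: "g \<in> carrier (aut_group P)"
  then have g': "g \<in> automorphisms P" by (simp add: aut_group_def)
  show "\<one>\<^bsub>aut_group P\<^esub> \<otimes>\<^bsub>aut_group P\<^esub> g = g"
    using automorphismsD(3)[OF g']
    by (auto simp: aut_group_def compose_def restrict_def extensional_def fun_eq_iff)
  show "\<exists>h\<in>carrier (aut_group P). h \<otimes>\<^bsub>aut_group P\<^esub> g = \<one>\<^bsub>aut_group P\<^esub>"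
  proof (rule bexI)
    show "(\<lambda>x\<in>elems P. inv_into (elems P) g x) \<in> carrier (aut_group P)"
      using inv_automorphisms[OF g'] by (simp add: aut_group_def)
    have "g ` elems P = elems P" using automorphismsD(2)[OF g'] by (simp add: bij_betw_def)
    then show "(\<lambda>x\<in>elems P. inv_into (elems P) g x) \<otimes>\<^bsub>aut_group P\<^esub> g = \<one>\<^bsub>aut_group P\<^esub>"
      by (auto simp: aut_group_def compose_def restrict_def fun_eq_iff f_inv_into_f)
  qed
  assume h: "h \<in> carrier (aut_group P)"
  show "g \<otimes>\<^bsub>aut_group P\<^esub> h \<in> carrier (aut_group P)"
    using g h compose_automorphisms by (simp add: aut_group_def)
  assume "k \<in> carrier (aut_group P)"
  show "g \<otimes>\<^bsub>aut_group P\<^esub> h \<otimes>\<^bsub>aut_group P\<^esub> k = g \<otimes>\<^bsub>aut_group P\<^esub> (h \<otimes>\<^bsub>aut_group P\<^esub> k)"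
    using automorphismsD(4)[OF g'] by (auto simp: aut_group_def compose_def fun_eq_iff)
qed

context poly
begin

lemma incident_automorphism:
  assumes "g \<in> automorphisms P" "a \<in> elems P" "b \<in> elems P"
  shows "incident P (g a) (g b) \<longleftrightarrow> incident P a b"
  using automorphismsD(6)[OF assms(1)] assms(2,3) by (simp add: incident_def)

lemma flag_map_in_flags:
  assumes "g \<in> automorphisms P" "\<Phi> \<in> flags P"
  shows "flag_map g \<Phi> \<in> flags P"
  using assms(2) automorphismsD(4,5)[OF assms(1)] incident_automorphism[OF assms(1)]
  by (cases \<Phi>) (simp add: flag_map_def flags_def of_rank_def)

lemma flag_adj_flag_map:
  assumes "g \<in> automorphisms P" "\<Phi> \<in> flags P" "i \<in> {0, 1, 2}"
  shows "flag_adj P (flag_map g \<Phi>) i = flag_map g (flag_adj P \<Phi> i)"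
proof (rule flag_adj_eqI)
  fix j :: nat assume j: "j \<in> {0, 1, 2}"
  have "inj_on g (elems P)" using automorphismsD(2)[OF assms(1)] by (simp add: bij_betw_def)
  then have "g (flag_elem (flag_adj P \<Phi> i) j) = g (flag_elem \<Phi> j) \<longleftrightarrow>
      flag_elem (flag_adj P \<Phi> i) j = flag_elem \<Phi> j"
    using flag_elem_in_elems[OF flag_adj_in_flags[OF assms(2,3)] j] flag_elem_in_elems[OF assms(2) j]
    by (simp add: inj_on_eq_iff)
  then show "flag_elem (flag_map g (flag_adj P \<Phi> i)) j \<noteq> flag_elem (flag_map g \<Phi>) j \<longleftrightarrow> j = i"
    using flag_elem_adj_neq[OF assms(2,3) j] by simp
qed (use assms flag_map_in_flags flag_adj_in_flags in blast)+

text \<open>Automorphisms commute with \<open>flag_adj\<close>, so agreement on one flag spreads to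
  all flags, and every element lies in a flag.\<close>

lemma automorphism_eqI:
  assumes "g \<in> automorphisms P" "h \<in> automorphisms P" "\<Phi> \<in> flags P" "flag_map g \<Phi> = flag_map h \<Phi>"
  shows "g = h"
proof (rule extensionalityI[OF automorphismsD(3)[OF assms(1)] automorphismsD(3)[OF assms(2)]])
  fix a assume a: "a \<in> elems P"
  have all: "flag_map g \<Psi> = flag_map h \<Psi>" if "\<Psi> \<in> flags P" for \<Psi>
    using assms(3) that assms(4)
  proof (rule flag_induct)
    fix \<Theta> and j :: nat assume "\<Theta> \<in> flags P" "flag_map g \<Theta> = flag_map h \<Theta>" "j \<in> {0, 1, 2}"
    then show "flag_map g (flag_adj P \<Theta> j) = flag_map h (flag_adj P \<Theta> j)"
      using flag_adj_flag_map assms(1,2) by metis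
  qed
  obtain \<Psi> where P: "\<Psi> \<in> flags P" "flag_elem \<Psi> (rk P a) = a" using ex_flag_of_elem[OF assms(3) a] by blast
  have "flag_elem (flag_map g \<Psi>) (rk P a) = flag_elem (flag_map h \<Psi>) (rk P a)" using all[OF P(1)] by simp
  then show "g a = h a" using P(2) by simp
qed

lemma flag_map_one: "\<Phi> \<in> flags P \<Longrightarrow> flag_map \<one>\<^bsub>aut_group P\<^esub> \<Phi> = \<Phi>"
  by (cases \<Phi>) (auto simp: flag_map_def aut_group_def flags_def of_rank_def)

lemma flag_map_mult:
  "\<Phi> \<in> flags P \<Longrightarrow> flag_map (g \<otimes>\<^bsub>aut_group P\<^esub> h) \<Phi> = flag_map h (flag_map g \<Phi>)"
  by (cases \<Phi>) (auto simp: flag_map_def aut_group_def flags_def of_rank_def compose_def)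

text \<open>The combinatorial source of automorphisms. Flags with the same element of rank i are
  joined by steps of the other ranks, and since \<open>t\<close> commutes with those steps, their
  images also share their element of rank i; so \<open>t\<close> descends to elements. The inverse
  \<open>t'\<close> descends in the same way and makes the induced map bijective and
  order-reflecting.\<close>

lemma automorphism_of_flag_bijection:
  assumes "\<Phi> \<in> flags P"
    and t: "\<And>\<Psi>. \<Psi> \<in> flags P \<Longrightarrow> t \<Psi> \<in> flags P"
      "\<And>\<Psi> i. \<Psi> \<in> flags P \<Longrightarrow> i \<in> {0, 1, 2} \<Longrightarrow> t (flag_adj P \<Psi> i) = flag_adj P (t \<Psi>) i"
    and t': "\<And>\<Psi>. \<Psi> \<in> flags P \<Longrightarrow> t' \<Psi> \<in> flags P"
      "\<And>\<Psi> i. \<Psi> \<in> flags P \<Longrightarrow> i \<in> {0, 1, 2} \<Longrightarrow> t' (flag_adj P \<Psi> i) = flag_adj P (t' \<Psi>) i"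
    and tt': "\<And>\<Psi>. \<Psi> \<in> flags P \<Longrightarrow> t' (t \<Psi>) = \<Psi>" "\<And>\<Psi>. \<Psi> \<in> flags P \<Longrightarrow> t (t' \<Psi>) = \<Psi>"
  shows "\<exists>g\<in>automorphisms P. \<forall>\<Psi>\<in>flags P. flag_map g \<Psi> = t \<Psi>"
proof -
  \<comment> \<open>An element is moved by looking at some flag through it; the fact
    \<open>ind\<close> below removes the dependence on the choice.\<close>
  define ind where "ind t a = flag_elem (t (SOME \<Psi>. \<Psi> \<in> flags P \<and> flag_elem \<Psi> (rk P a) = a)) (rk P a)"
    for t :: "'a flag \<Rightarrow> 'a flag" and a
  have ind: "ind t (flag_elem \<Psi> i) = flag_elem (t \<Psi>) i"
    if t: "\<And>\<Psi>. \<Psi> \<in> flags P \<Longrightarrow> t \<Psi> \<in> flags P"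
      "\<And>\<Psi> i. \<Psi> \<in> flags P \<Longrightarrow> i \<in> {0, 1, 2} \<Longrightarrow> t (flag_adj P \<Psi> i) = flag_adj P (t \<Psi>) i"
    and Psi: "\<Psi> \<in> flags P" "i \<in> {0, 1, 2}" for t \<Psi> i
  proof -
    define \<Theta> where "\<Theta> = (SOME \<Theta>. \<Theta> \<in> flags P \<and> flag_elem \<Theta> i = flag_elem \<Psi> i)"
    have T: "\<Theta> \<in> flags P \<and> flag_elem \<Theta> i = flag_elem \<Psi> i"
      unfolding \<Theta>_def by (rule someI[of _ \<Psi>]) (use Psi in simp)
    have "flag_elem (t \<Theta>) i = flag_elem (t \<Psi>) i"
    proof (rule flag_closed_induct[OF Psi(1) _ Psi(2), of \<Theta> "\<lambda>\<Theta>. flag_elem (t \<Theta>) i = flag_elem (t \<Psi>) i"])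
      fix \<Xi> and j :: nat
      assume X: "\<Xi> \<in> flags P" "flag_elem (t \<Xi>) i = flag_elem (t \<Psi>) i" "j \<in> {0, 1, 2} - {i}"
      have j: "j \<in> {0, 1, 2}" "i \<noteq> j" using X(3) by auto
      have "flag_elem (t (flag_adj P \<Xi> j)) i = flag_elem (t \<Xi>) i"
        using flag_elem_adj_neq[OF t(1)[OF X(1)] j(1) Psi(2)] j(2) t(2)[OF X(1) j(1)] by simp
      then show "flag_elem (t (flag_adj P \<Xi> j)) i = flag_elem (t \<Psi>) i" using X(2) by simp
    qed (use T in simp_all)
    moreover have "rk P (flag_elem \<Psi> i) = i" using flag_elem_in_elems[OF Psi] by simp
    ultimately show ?thesis by (simp add: ind_def \<Theta>_def)
  qed
  have i: "ind t (flag_elem \<Psi> i) = flag_elem (t \<Psi>) i" if "\<Psi> \<in> flags P" "i \<in> {0, 1, 2}" for \<Psi> i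
    by (rule ind) (use t that in blast)+
  have i': "ind t' (flag_elem \<Psi> i) = flag_elem (t' \<Psi>) i" if "\<Psi> \<in> flags P" "i \<in> {0, 1, 2}" for \<Psi> i
    by (rule ind) (use t' that in blast)+
  have el: "\<exists>\<Psi>\<in>flags P. flag_elem \<Psi> (rk P a) = a" if "a \<in> elems P" for a
    using ex_flag_of_elem[OF assms(1) that] .
  have ti: "ind t a \<in> elems P \<and> rk P (ind t a) = rk P a \<and> ind t' (ind t a) = a"
    if a: "a \<in> elems P" for a
  proof -
    obtain \<Psi> where P: "\<Psi> \<in> flags P" "flag_elem \<Psi> (rk P a) = a" using el[OF a] by blast
    have "ind t a = flag_elem (t \<Psi>) (rk P a)" using i[OF P(1) rk_le[OF a]] P(2) by simp
    then show ?thesis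
      using flag_elem_in_elems[OF t(1)[OF P(1)] rk_le[OF a]] i'[OF t(1)[OF P(1)] rk_le[OF a]] tt'(1)[OF P(1)] P(2)
      by simp
  qed
  have ti': "ind t' a \<in> elems P \<and> rk P (ind t' a) = rk P a \<and> ind t (ind t' a) = a"
    if a: "a \<in> elems P" for a
  proof -
    obtain \<Psi> where P: "\<Psi> \<in> flags P" "flag_elem \<Psi> (rk P a) = a" using el[OF a] by blast
    have "ind t' a = flag_elem (t' \<Psi>) (rk P a)" using i'[OF P(1) rk_le[OF a]] P(2) by simp
    then show ?thesis
      using flag_elem_in_elems[OF t'(1)[OF P(1)] rk_le[OF a]] i[OF t'(1)[OF P(1)] rk_le[OF a]] tt'(2)[OF P(1)] P(2)
      by simp
  qed
  have le: "(s a, s b) \<in> le_rel P"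
    if "\<And>\<Psi> i. \<Psi> \<in> flags P \<Longrightarrow> i \<in> {0, 1, 2} \<Longrightarrow> s (flag_elem \<Psi> i) = flag_elem (t \<Psi>) i"
      "\<And>\<Psi>. \<Psi> \<in> flags P \<Longrightarrow> t \<Psi> \<in> flags P"
      "\<And>a. a \<in> elems P \<Longrightarrow> s a \<in> elems P \<and> rk P (s a) = rk P a"
      "a \<in> elems P" "b \<in> elems P" "(a, b) \<in> le_rel P" for s t a b
  proof (cases "a = b")
    case True
    then show ?thesis
      using partial_order_onD(1)[OF le_rel_partial_order] that(3)[OF that(4)] by (simp add: refl_on_def)
  next
    case False
    then have lt: "rk P a < rk P b" using rk_less[OF that(6)] by simp
    have "incident P a b" using that(6) by (simp add: incident_def)
    then obtain \<Psi> where P: "\<Psi> \<in> flags P" "flag_elem \<Psi> (rk P a) = a" "flag_elem \<Psi> (rk P b) = b"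
      using ex_flag_of_incident[OF \<open>a \<in> elems P\<close> \<open>b \<in> elems P\<close> _ False] by blast
    have "incident P (flag_elem (t \<Psi>) (rk P a)) (flag_elem (t \<Psi>) (rk P b))"
      using incident_flag_elem[OF that(2)[OF P(1)] rk_le[OF that(4)] rk_le[OF that(5)]] lt by simp
    then have "incident P (s a) (s b)"
      using that(1)[OF P(1) rk_le[OF that(4)]] that(1)[OF P(1) rk_le[OF that(5)]] P by simp
    then show ?thesis using incident_iff_le[of "s a" "s b"] that(3)[OF that(4)] that(3)[OF that(5)] lt by simp
  qed
  define g where "g = restrict (ind t) (elems P)"
  have "bij_betw (ind t) (elems P) (elems P)"
    by (rule bij_betw_byWitness[of _ "ind t'"]) (use ti ti' in auto)
  then have "g \<in> Bij (elems P)" by (simp add: g_def Bij_def)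
  moreover have "(g a, g b) \<in> le_rel P \<longleftrightarrow> (a, b) \<in> le_rel P" if ab: "a \<in> elems P" "b \<in> elems P" for a b
  proof
    assume "(a, b) \<in> le_rel P"
    then show "(g a, g b) \<in> le_rel P" using le[of "ind t" t a b] i t(1) ti ab by (simp add: g_def)
  next
    assume "(g a, g b) \<in> le_rel P"
    then have "(ind t a, ind t b) \<in> le_rel P" using ab by (simp add: g_def)
    then have "(ind t' (ind t a), ind t' (ind t b)) \<in> le_rel P"
      using le[of "ind t'" t' "ind t a" "ind t b"] i' t'(1) ti' ti[OF ab(1)] ti[OF ab(2)] by simp
    then show "(a, b) \<in> le_rel P" using ti[OF ab(1)] ti[OF ab(2)] by simp
  qed
  ultimately have "g \<in> automorphisms P" using ti by (simp add: automorphisms_def g_def)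
  moreover have "flag_map g \<Psi> = t \<Psi>" if "\<Psi> \<in> flags P" for \<Psi>
  proof (rule flag_eqI)
    fix j :: nat assume j: "j \<in> {0, 1, 2}"
    show "flag_elem (flag_map g \<Psi>) j = flag_elem (t \<Psi>) j"
      using i[OF that j] flag_elem_in_elems[OF that j] by (simp add: g_def)
  qed
  ultimately show ?thesis by blast
qed

end

section \<open>The twist\<close>

lemma (in group) inv_mult_cancel [simp]:
  "a \<in> carrier G \<Longrightarrow> b \<in> carrier G \<Longrightarrow> inv a \<otimes> (a \<otimes> b) = b"
  "a \<in> carrier G \<Longrightarrow> b \<in> carrier G \<Longrightarrow> a \<otimes> (inv a \<otimes> b) = b"
  by (simp_all flip: m_assoc)

lemma (in group) commute_inv:
  assumes "a \<in> carrier G" "b \<in> carrier G" "a \<otimes> b = b \<otimes> a"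
  shows "inv a \<otimes> b = b \<otimes> inv a"
proof -
  have "inv a \<otimes> b = inv a \<otimes> (b \<otimes> a) \<otimes> inv a" using assms(1,2) by (simp add: m_assoc)
  also have "\<dots> = b \<otimes> inv a" using assms(1,2) by (simp flip: assms(3))
  finally show ?thesis .
qed

lemma (in group) int_pow_commute:
  assumes "a \<in> carrier G" "b \<in> carrier G" "a \<otimes> b = b \<otimes> a"
  shows "a [^] (i::int) \<otimes> b = b \<otimes> a [^] i"
proof (cases "i < 0")
  case True
  then show ?thesis unfolding int_pow_def2 if_P[OF True]
    by (intro commute_inv group_commutes_pow assms) (simp add: assms)
next
  case False
  then show ?thesis unfolding int_pow_def2 if_not_P[OF False] by (intro group_commutes_pow assms)
qed

text \<open>With q = 2k + 1 the power is a^(q+1) = a. Hence whatever commutes with a^2 commutes with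
  a, and a^2 = 1 forces a = 1.\<close>

lemma (in group) odd_order_square_pow:
  assumes "a \<in> carrier G" "odd q" "a [^] (q::nat) = \<one>"
  shows "\<exists>k. (a \<otimes> a) [^] Suc k = a"
proof -
  obtain k where k: "q = 2 * k + 1" using \<open>odd q\<close> by (rule oddE)
  have "(a \<otimes> a) [^] Suc k = (a [^] (2::nat)) [^] Suc k" using assms(1) by (simp add: numeral_2_eq_2)
  also have "\<dots> = a [^] (q + 1)" using assms(1) k nat_pow_pow[of a 2 "Suc k"] by simp
  also have "\<dots> = a" using assms(1,3) by simp
  finally show ?thesis by blast
qed

text \<open>The commutator of \<open>x\<^sup>2\<close> with the involution \<open>x y\<close> measures how far \<open>x\<^sup>2\<close> is from being central.\<close>

definition twist :: "('a, 'b) monoid_scheme \<Rightarrow> 'a \<Rightarrow> 'a \<Rightarrow> 'a" where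
  "twist G x y = (x \<otimes>\<^bsub>G\<^esub> y) \<otimes>\<^bsub>G\<^esub> (inv\<^bsub>G\<^esub> x \<otimes>\<^bsub>G\<^esub> (inv\<^bsub>G\<^esub> x \<otimes>\<^bsub>G\<^esub> ((x \<otimes>\<^bsub>G\<^esub> y) \<otimes>\<^bsub>G\<^esub> (x \<otimes>\<^bsub>G\<^esub> x))))"

text \<open>The automorphism inverting x and y is described only by its effect on left
  multiplication by generators. Such a map can be read off from a labelling of flags or written down
  on normal forms; that it is a homomorphism follows later from generation.\<close>

definition reflexible :: "('a, 'b) monoid_scheme \<Rightarrow> 'a \<Rightarrow> 'a \<Rightarrow> bool" where
  "reflexible G x y \<longleftrightarrow> (\<exists>t. t \<one>\<^bsub>G\<^esub> = \<one>\<^bsub>G\<^esub> \<and>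
    (\<forall>g\<in>carrier G. t g \<in> carrier G \<and> t (x \<otimes>\<^bsub>G\<^esub> g) = inv\<^bsub>G\<^esub> x \<otimes>\<^bsub>G\<^esub> t g \<and> t (y \<otimes>\<^bsub>G\<^esub> g) = inv\<^bsub>G\<^esub> y \<otimes>\<^bsub>G\<^esub> t g))"

text \<open>Only the involution z is assumed, without tightness, so that the same calculations serve
  both the rotation group and the presented group. Rewriting with y = x^-1 z and y^-1 = z x reduces
  identities to words in x and z.\<close>

locale half_turn = group G for G (structure) +
  fixes x y z u
  assumes x_closed [simp]: "x \<in> carrier G" and y_closed [simp]: "y \<in> carrier G"
    and z_eq: "z = x \<otimes> y" and z_square: "z \<otimes> z = \<one>"
    and u_eq: "u = z \<otimes> (inv x \<otimes> (inv x \<otimes> (z \<otimes> (x \<otimes> x))))"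
begin

lemma z_closed [simp]: "z \<in> carrier G"
  by (simp add: z_eq)

lemma u_closed [simp]: "u \<in> carrier G"
  by (simp add: u_eq)

lemma z_z: "b \<in> carrier G \<Longrightarrow> z \<otimes> (z \<otimes> b) = b"
  using z_square by (simp flip: m_assoc)

lemma inv_z: "inv z = z"
  using z_square by (simp add: inv_equality)

lemma y_eq: "y = inv x \<otimes> z"
  by (simp add: z_eq)

lemma inv_y_eq: "inv y = z \<otimes> x"
  by (simp add: y_eq inv_mult_group inv_z)

lemma inv_u_eq: "inv u = inv x \<otimes> (inv x \<otimes> (z \<otimes> (x \<otimes> (x \<otimes> z))))"
  by (simp add: u_eq inv_mult_group inv_z m_assoc)

lemma conj_z_x2: "z \<otimes> (x \<otimes> (x \<otimes> z)) = x \<otimes> (x \<otimes> inv u)"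
  by (simp add: inv_u_eq)

text \<open>Put a = x^2 and b = z a z = a u^-1. Since u commutes with x, so does b, and then y =
  x^-1 z satisfies y a = b y and y b = a y. Thus y^2 commutes with a; as y has odd order, y itself
  does, so a = b. The case of interest is u in the cyclic group of x.\<close>

lemma twist_in_powers_x:
  assumes "odd q" "y [^] (q::nat) = \<one>" and ux: "u \<otimes> x = x \<otimes> u"
  shows "u = \<one>"
proof -
  define a where "a = x \<otimes> x"
  define b where "b = z \<otimes> (a \<otimes> z)"
  have cl [simp]: "a \<in> carrier G" "b \<in> carrier G" by (simp_all add: a_def b_def)
  have b: "b = a \<otimes> inv u" using conj_z_x2 by (simp add: b_def a_def m_assoc)
  have "inv u \<otimes> x = x \<otimes> inv u" by (rule commute_inv) (use ux in simp_all)
  then have "b \<otimes> x = x \<otimes> b" by (simp add: b a_def m_assoc)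
  then have bx: "inv x \<otimes> b = b \<otimes> inv x" by (intro commute_inv) simp_all
  have ax: "inv x \<otimes> a = a \<otimes> inv x" by (simp add: a_def m_assoc)
  have "y \<otimes> a = inv x \<otimes> b \<otimes> z" by (simp add: b_def y_eq m_assoc z_square)
  also have "\<dots> = b \<otimes> y" by (simp add: bx y_eq m_assoc)
  finally have ya: "y \<otimes> a = b \<otimes> y" .
  have "y \<otimes> b = inv x \<otimes> a \<otimes> z" by (simp add: b_def y_eq m_assoc z_z)
  also have "\<dots> = a \<otimes> y" by (simp add: ax y_eq m_assoc)
  finally have yb: "y \<otimes> b = a \<otimes> y" .
  have "(y \<otimes> y) \<otimes> a = y \<otimes> b \<otimes> y" by (simp add: m_assoc ya)
  also have "\<dots> = a \<otimes> (y \<otimes> y)" by (simp add: m_assoc yb)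
  finally have yya: "(y \<otimes> y) \<otimes> a = a \<otimes> (y \<otimes> y)" .
  obtain k where k: "(y \<otimes> y) [^] Suc k = y" using odd_order_square_pow[OF y_closed assms(1,2)] by blast
  have "(y \<otimes> y) [^] Suc k \<otimes> a = a \<otimes> (y \<otimes> y) [^] Suc k"
    by (rule group_commutes_pow[OF yya]) simp_all
  then have "y \<otimes> a = a \<otimes> y" unfolding k .
  then have "b \<otimes> y = a \<otimes> y" using ya by simp
  then have "a \<otimes> inv u = a \<otimes> \<one>" using b by simp
  then show ?thesis by (simp del: r_one)
qed

text \<open>Conjugating z x^2 z = x^2 u^-1 by z gives x^2 on one side and, for central u, x^2 u^-2
  on the other; odd order then turns u^2 = 1 into u = 1.\<close>

lemma twist_central:
  assumes "odd q" "u [^] (q::nat) = \<one>" and uy: "u \<otimes> y = y \<otimes> u" and ux: "u \<otimes> x = x \<otimes> u"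
  shows "u = \<one>"
proof -
  have "u \<otimes> z = z \<otimes> u" 
  proof -
    have "u \<otimes> (x \<otimes> y) = x \<otimes> u \<otimes> y" using ux by (simp flip: m_assoc)
    also have "\<dots> = x \<otimes> y \<otimes> u" using uy by (simp add: m_assoc)
    finally show ?thesis by (simp add: z_eq)
  qed
  then have uz: "inv u \<otimes> z = z \<otimes> inv u" by (intro commute_inv) simp_all
  have "x \<otimes> x = z \<otimes> ((z \<otimes> (x \<otimes> (x \<otimes> z))) \<otimes> z)" by (simp add: m_assoc z_z z_square)
  also have "\<dots> = z \<otimes> (x \<otimes> (x \<otimes> (inv u \<otimes> z)))" unfolding conj_z_x2 by (simp add: m_assoc)
  also have "\<dots> = (z \<otimes> (x \<otimes> (x \<otimes> z))) \<otimes> inv u" unfolding uz by (simp add: m_assoc)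
  also have "\<dots> = (x \<otimes> x) \<otimes> (inv u \<otimes> inv u)" unfolding conj_z_x2 by (simp add: m_assoc)
  finally have "(x \<otimes> x) \<otimes> \<one> = (x \<otimes> x) \<otimes> (inv u \<otimes> inv u)" by simp
  then have "inv (u \<otimes> u) = \<one>" by (simp add: inv_mult_group del: r_one)
  then have "u \<otimes> u = \<one>" by simp
  moreover obtain k where "(u \<otimes> u) [^] Suc k = u"
    using odd_order_square_pow[OF u_closed assms(1,2)] by blast
  ultimately show ?thesis by simp
qed

end

section \<open>Groups with a tight factorisation into two cyclic subgroups\<close>

lemma (in group) pow_mod_of_pow_one:
  assumes "a \<in> carrier G" "a [^] (n::nat) = \<one>"
  shows "a [^] (i mod n) = a [^] i"
proof -
  have "a [^] i = a [^] (n * (i div n) + i mod n)" by simp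
  also have "\<dots> = (a [^] n) [^] (i div n) \<otimes> a [^] (i mod n)"
    using assms(1) by (simp only: nat_pow_mult[symmetric] nat_pow_pow)
  finally show ?thesis using assms by simp
qed

lemma (in group) int_pow_eq_nat_pow:
  assumes "a \<in> carrier G" "a [^] (n::nat) = \<one>" "n > 0"
  shows "a [^] (i::int) = a [^] nat (i mod int n)"
proof -
  have "int (ord a) dvd int n" using pow_eq_id[OF assms(1)] assms(2) by simp
  then have "int (ord a) dvd i mod int n - i" by (meson dvd_minus_mod dvd_trans dvd_diff_commute)
  then have "a [^] i = a [^] (i mod int n)" using int_pow_eq[OF assms(1)] by blast
  then show ?thesis using assms(3) by (simp add: int_pow_int[symmetric])
qed

text \<open>The cardinality encodes the trivial intersection of the two cyclic groups: pq elements,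
  all of the form x^i y^j, leave no room for coincidences between exponents reduced modulo p and q.
  It also makes p and q the exact orders of x and y.\<close>

locale tight_group = group G for G (structure) +
  fixes x y and p q :: nat
  assumes x_in [simp]: "x \<in> carrier G" and y_in [simp]: "y \<in> carrier G"
    and p_pos: "p > 0" and q_pos: "q > 0"
    and x_pow_p: "x [^] p = \<one>" and y_pow_q: "y [^] q = \<one>"
    and xy_square: "(x \<otimes> y) \<otimes> (x \<otimes> y) = \<one>"
    and normal_form: "g \<in> carrier G \<Longrightarrow> \<exists>(i::nat) (j::nat). g = x [^] i \<otimes> y [^] j"
    and card_carrier: "card (carrier G) = p * q"

sublocale tight_group \<subseteq> half: half_turn G x y "x \<otimes> y" "twist G x y"
  by unfold_locales (simp_all add: xy_square twist_def)

context tight_group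
begin

lemma finite_carrier: "finite (carrier G)"
  using card_carrier p_pos q_pos by (metis card.infinite mult_is_0 not_gr_zero)

lemma inj_on_normal_form: "inj_on (\<lambda>(i, j). x [^] i \<otimes> y [^] j) ({..<p} \<times> {..<q})"
proof (rule eq_card_imp_inj_on)
  let ?f = "\<lambda>(i, j). x [^] i \<otimes> y [^] j" and ?I = "{..<p} \<times> {..<q}"
  have "carrier G \<subseteq> ?f ` ?I"
  proof
    fix g assume "g \<in> carrier G"
    then obtain i j :: nat where g: "g = x [^] i \<otimes> y [^] j" using normal_form by metis
    show "g \<in> ?f ` ?I"
    proof (rule image_eqI)
      show "g = ?f (i mod p, j mod q)"
        unfolding g prod.case pow_mod_of_pow_one[OF x_in x_pow_p] pow_mod_of_pow_one[OF y_in y_pow_q] ..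
      show "(i mod p, j mod q) \<in> ?I" using p_pos q_pos by simp
    qed
  qed
  moreover have "?f ` ?I \<subseteq> carrier G" by (rule image_subsetI) (simp add: case_prod_beta)
  ultimately have "?f ` ?I = carrier G" by (rule equalityI[rotated])
  then show "card (?f ` ?I) = card ?I" by (simp only: card_carrier card_cartesian_product card_lessThan)
qed simp

lemma normal_form_eqD:
  fixes i j k l :: nat
  assumes "x [^] i \<otimes> y [^] j = x [^] k \<otimes> y [^] l"
  shows "i mod p = k mod p" "j mod q = l mod q"
proof -
  have "x [^] (i mod p) \<otimes> y [^] (j mod q) = x [^] (k mod p) \<otimes> y [^] (l mod q)"
    unfolding pow_mod_of_pow_one[OF x_in x_pow_p] pow_mod_of_pow_one[OF y_in y_pow_q] by (rule assms)
  then have "(i mod p, j mod q) = (k mod p, l mod q)"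
    using p_pos q_pos by (intro inj_onD[OF inj_on_normal_form]) auto
  then show "i mod p = k mod p" "j mod q = l mod q" by auto
qed

lemma ord_x: "ord x = p"
proof (rule ord_unique[THEN iffD2])
  show "\<forall>n. x [^] n = \<one> \<longleftrightarrow> p dvd n"
  proof
    fix n :: nat
    show "x [^] n = \<one> \<longleftrightarrow> p dvd n"
      using normal_form_eqD(1)[of n 0 0 0] pow_mod_of_pow_one[OF x_in x_pow_p, of n] by (auto simp: mod_eq_0_iff_dvd)
  qed
qed simp

lemma ord_y: "ord y = q"
proof (rule ord_unique[THEN iffD2])
  show "\<forall>n. y [^] n = \<one> \<longleftrightarrow> q dvd n"
  proof
    fix n :: nat
    show "y [^] n = \<one> \<longleftrightarrow> q dvd n"
      using normal_form_eqD(2)[of 0 n 0 0] pow_mod_of_pow_one[OF y_in y_pow_q, of n] by (auto simp: mod_eq_0_iff_dvd)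
  qed
qed simp

text \<open>An element of both cyclic groups has the normal forms x^i y^0 and x^0 y^j, which must
  agree.\<close>

lemma x_pow_eq_y_pow:
  fixes i j :: int
  assumes "x [^] i = y [^] j"
  shows "x [^] i = \<one>"
proof -
  let ?i = "nat (i mod int p)" and ?j = "nat (j mod int q)"
  have i: "x [^] i = x [^] ?i" and j: "y [^] j = y [^] ?j"
    using int_pow_eq_nat_pow x_pow_p y_pow_q p_pos q_pos x_in y_in by blast+
  then have "?i mod p = 0 mod p" using normal_form_eqD(1)[of ?i 0 0 ?j] assms by simp
  then have "x [^] ?i = \<one>" using pow_mod_of_pow_one[OF x_in x_pow_p, of ?i] by simp
  then show ?thesis using i by simp
qed

lemma normal_form_int_eqD:
  fixes i j k l :: int
  assumes "x [^] i \<otimes> y [^] j = x [^] k \<otimes> y [^] l"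
  shows "x [^] i = x [^] k" "y [^] j = y [^] l"
proof -
  have "x [^] (i - k) = inv (x [^] k) \<otimes> x [^] i" 
    by (metis add.commute diff_conv_add_uminus int_pow_mult int_pow_neg x_in)
  also have "\<dots> = inv (x [^] k) \<otimes> (x [^] i \<otimes> y [^] j) \<otimes> inv (y [^] j)" by (simp add: m_assoc)
  also have "\<dots> = y [^] l \<otimes> inv (y [^] j)" unfolding assms by (simp add: m_assoc)
  also have "\<dots> = y [^] (l - j)" by (simp add: int_pow_diff)
  finally have "x [^] (i - k) = \<one>" using x_pow_eq_y_pow by blast
  then show "x [^] i = x [^] k" by (simp add: int_pow_diff inv_solve_right')
  then show "y [^] j = y [^] l" using assms by simp
qed

text \<open>Nonnegative powers already reach everything, so an induction over left multiplication by
  x and y has no case for inverses.\<close>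

lemma carrier_induct [consumes 1, case_names one x y]:
  assumes "g \<in> carrier G" "Q \<one>"
    "\<And>g. g \<in> carrier G \<Longrightarrow> Q g \<Longrightarrow> Q (x \<otimes> g)" "\<And>g. g \<in> carrier G \<Longrightarrow> Q g \<Longrightarrow> Q (y \<otimes> g)"
  shows "Q g"
proof -
  have y: "Q (y [^] j)" for j :: nat
  proof (induction j)
    case (Suc j)
    then show ?case using assms(4)[of "y [^] j"] nat_pow_Suc2[OF y_in, of j] by simp
  qed (use assms in simp)
  have "Q (x [^] i \<otimes> y [^] j)" for i j :: nat
  proof (induction i)
    case (Suc i)
    then show ?case using assms(3)[of "x [^] i \<otimes> y [^] j"] nat_pow_Suc2[OF x_in, of i] by (simp add: m_assoc)
  qed (use y in simp)
  then show ?thesis using normal_form[OF assms(1)] by metis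
qed

lemma generate_normalI:
  assumes h: "h \<in> carrier G"
    and x: "x \<otimes> h \<otimes> inv x \<in> generate G {h}" and y: "y \<otimes> h \<otimes> inv y \<in> generate G {h}"
  shows "generate G {h} \<lhd> G"
  unfolding normal_inv_iff
proof (intro conjI ballI)
  have in_carrier: "k \<in> carrier G" if "k \<in> generate G {h}" for k
    using generate_in_carrier[of "{h}" k] that h by simp
  show "subgroup (generate G {h}) G" using generate_is_subgroup[of "{h}"] h by simp
  then interpret K: subgroup "generate G {h}" G .
  have conj: "\<forall>k\<in>generate G {h}. g \<otimes> k \<otimes> inv g \<in> generate G {h}"
    if g: "g \<in> carrier G" and gh: "g \<otimes> h \<otimes> inv g \<in> generate G {h}" for g
  proof
    fix k assume "k \<in> generate G {h}"
    then show "g \<otimes> k \<otimes> inv g \<in> generate G {h}"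
    proof (induction rule: generate.induct)
      case one
      then show ?case using g K.one_closed by simp
    next
      case (incl a)
      then show ?case using gh by simp
    next
      case (inv a)
      then have "g \<otimes> inv a \<otimes> inv g = inv (g \<otimes> h \<otimes> inv g)" using g h by (simp add: inv_mult_group m_assoc)
      then show ?case using K.m_inv_closed[OF gh] by simp
    next
      case (eng a b)
      then have "g \<otimes> (a \<otimes> b) \<otimes> inv g = (g \<otimes> a \<otimes> inv g) \<otimes> (g \<otimes> b \<otimes> inv g)"
        using g in_carrier by (simp add: m_assoc)
      then show ?case using K.m_closed eng by simp
    qed
  qed
  fix g k assume "g \<in> carrier G" "k \<in> generate G {h}"
  then show "g \<otimes> k \<otimes> inv g \<in> generate G {h}"
  proof (induction arbitrary: k rule: carrier_induct)
    case one
    then show ?case using in_carrier by simp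
  next
    case (x g)
    have "x \<otimes> g \<otimes> k \<otimes> inv (x \<otimes> g) = x \<otimes> (g \<otimes> k \<otimes> inv g) \<otimes> inv x"
      using x.hyps in_carrier[OF x.prems] by (simp add: inv_mult_group m_assoc)
    then show ?case using conj[OF x_in assms(2)] x.IH[OF x.prems] by simp
  next
    case (y g)
    have "y \<otimes> g \<otimes> k \<otimes> inv (y \<otimes> g) = y \<otimes> (g \<otimes> k \<otimes> inv g) \<otimes> inv y"
      using y.hyps in_carrier[OF y.prems] by (simp add: inv_mult_group m_assoc)
    then show ?case using conj[OF y_in assms(3)] y.IH[OF y.prems] by simp
  qed
qed

text \<open>Both sides of the homomorphism law obey the same recursion when the first argument is
  multiplied on the left by a generator.\<close>

lemma reflexible_hom:
  assumes "t \<one> = \<one>" "\<And>g. g \<in> carrier G \<Longrightarrow> t g \<in> carrier G"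
    "\<And>g. g \<in> carrier G \<Longrightarrow> t (x \<otimes> g) = inv x \<otimes> t g" "\<And>g. g \<in> carrier G \<Longrightarrow> t (y \<otimes> g) = inv y \<otimes> t g"
  shows "t \<in> hom G G" "t x = inv x" "t y = inv y"
proof -
  have "t (g \<otimes> h) = t g \<otimes> t h" if "g \<in> carrier G" "h \<in> carrier G" for g h
    using that(1)
  proof (induction rule: carrier_induct)
    case one
    then show ?case using assms that by simp
  next
    case (x g)
    then show ?case using assms that by (simp add: m_assoc)
  next
    case (y g)
    then show ?case using assms that by (simp add: m_assoc)
  qed
  then show "t \<in> hom G G" using assms(2) by (simp add: hom_def)
  show "t x = inv x" "t y = inv y" using assms(1) assms(3,4)[of \<one>] by simp_all
qed

text \<open>Let t invert x and y. Then t z = x^-1 z x, and so t u = x u^-1 x^-1; but u is a power of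
  y, so t u = u^-1. Hence u commutes with x. It commutes with y anyway, and
  \<open>half.twist_central\<close> applies.\<close>

lemma reflexible_twist_in_powers_y:
  assumes refl: "reflexible G x y" and "odd q" and u: "twist G x y = y [^] (j::int)"
  shows "twist G x y = \<one>"
proof -
  let ?u = "twist G x y" and ?z = "x \<otimes> y"
  obtain t where t: "t \<one> = \<one>" "\<And>g. g \<in> carrier G \<Longrightarrow> t g \<in> carrier G"
    "\<And>g. g \<in> carrier G \<Longrightarrow> t (x \<otimes> g) = inv x \<otimes> t g" "\<And>g. g \<in> carrier G \<Longrightarrow> t (y \<otimes> g) = inv y \<otimes> t g"
    using refl unfolding reflexible_def by blast
  interpret t: group_hom G G t
    by (intro group_hom.intro group_hom_axioms.intro is_group reflexible_hom(1)[of t]) (simp_all add: t)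
  have tx: "t x = inv x" and ty: "t y = inv y"
    using reflexible_hom(2,3)[of t] t by blast+
  have tz: "t ?z = inv x \<otimes> (?z \<otimes> x)" 
    by (simp only: t.hom_mult[OF x_in y_in] tx ty half.inv_y_eq)
  have "t ?u = t ?z \<otimes> (x \<otimes> (x \<otimes> (t ?z \<otimes> (inv x \<otimes> inv x))))"
    unfolding half.u_eq using tx by simp
  also have "\<dots> = inv x \<otimes> ((?z \<otimes> (x \<otimes> (x \<otimes> ?z))) \<otimes> inv x)"
    unfolding tz using half.z_closed by (simp only: m_assoc inv_mult_cancel x_in inv_closed m_closed r_inv r_one)
  also have "\<dots> = x \<otimes> (inv ?u \<otimes> inv x)" unfolding half.conj_z_x2 by (simp add: m_assoc)
  finally have tu: "t ?u = x \<otimes> (inv ?u \<otimes> inv x)" .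
  have "t ?u = inv ?u" unfolding u t.hom_int_pow[OF y_in] ty by (simp add: int_pow_inv)
  then have "x \<otimes> (inv ?u \<otimes> inv x) \<otimes> x = inv ?u \<otimes> x" using tu by simp
  then have "x \<otimes> inv ?u = inv ?u \<otimes> x" by (simp add: m_assoc)
  then have ux: "?u \<otimes> x = x \<otimes> ?u" using commute_inv[of "inv ?u" x] by simp
  have uy: "?u \<otimes> y = y \<otimes> ?u" unfolding u by (intro int_pow_commute) simp_all
  have "?u [^] q = \<one>"
  proof -
    have "?u [^] q = y [^] (j * int q)" unfolding u by (simp add: int_pow_pow flip: int_pow_int)
    also have "\<dots> = (y [^] q) [^] j" by (simp add: int_pow_pow mult.commute flip: int_pow_int)
    finally show ?thesis by (simp add: y_pow_q)
  qed
  then show ?thesis using half.twist_central[OF \<open>odd q\<close> _ uy ux] by simp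
qed

end

section \<open>Normal subgroups of prime order\<close>

lemma (in group) conj_nat_pow:
  assumes "g \<in> carrier G" "a \<in> carrier G"
  shows "(g \<otimes> a \<otimes> inv g) [^] (n::nat) = g \<otimes> a [^] n \<otimes> inv g"
proof (induction n)
  case 0
  then show ?case using assms by simp
next
  case (Suc n)
  then show ?case using assms by (simp add: m_assoc)
qed

text \<open>By the hypothesis \<open>t\<close> the order of w^i is a power of m. Taking m-th powers
  of w^i until just before they vanish gives an element of order m, hence a generator of the group
  of w^n. Its conjugate is a power of w whose m-th power vanishes too, so it lies in the same group:
  a cyclic group has only one subgroup of order m.\<close>

lemma (in group) conj_generate_of_conj_pow:
  fixes w g and i j n t m :: nat
  assumes w: "w \<in> carrier G" and g: "g \<in> carrier G" and m: "prime m" and ord: "ord w = m * n"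
    and ij: "g \<otimes> w [^] i \<otimes> inv g = w [^] j" and "w [^] i \<noteq> \<one>" and t: "w [^] (i * m ^ t) = \<one>"
  shows "g \<otimes> w [^] n \<otimes> inv g \<in> generate G {w [^] n}"
proof -
  \<comment> \<open>The predecessor \<open>r\<close> of \<open>s\<close> is the last exponent at
    which the iterated power is still nontrivial.\<close>
  define s where "s = (LEAST s. w [^] (i * m ^ s) = \<one>)"
  have s: "w [^] (i * m ^ s) = \<one>" unfolding s_def by (rule LeastI[of _ t]) (rule t)
  have "s \<noteq> 0" using s \<open>w [^] i \<noteq> \<one>\<close> by (intro notI) simp
  then obtain r where r: "s = Suc r" by (cases s) auto
  have nr: "w [^] (i * m ^ r) \<noteq> \<one>" using not_less_Least[of r "\<lambda>s. w [^] (i * m ^ s) = \<one>"] r s_def by simp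
  have "m * n dvd i * m ^ s" using s pow_eq_id[OF w] ord by metis
  then have "m * n dvd m * (i * m ^ r)" by (simp add: r mult.left_commute)
  then have "n dvd i * m ^ r" using m prime_gt_0_nat by (simp)
  then obtain l where l: "i * m ^ r = n * l" by (rule dvdE)
  have "\<not> m dvd l"
  proof
    assume "m dvd l"
    then have "ord w dvd i * m ^ r" unfolding l ord by (auto simp: dvd_def)
    then show False using nr pow_eq_id[OF w] by blast
  qed
  then have "gcd l m = 1" using m by (metis coprime_commute coprime_iff_gcd_eq_1 prime_imp_coprime)
  moreover have "l \<noteq> 0" using \<open>\<not> m dvd l\<close> by (intro notI) simp
  \<comment> \<open>\<open>l'\<close> inverts \<open>l\<close> modulo m, so the element h^l of order
    m gives back h = w^n as its \<open>l'\<close>-th power.\<close>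
  ultimately obtain l' k where l': "l * l' = m * k + 1" using bezout_nat[of l m] by metis
  define h where "h = w [^] n"
  have h: "h \<in> carrier G" using w by (simp add: h_def)
  have hm: "h [^] m = \<one>" unfolding h_def using pow_eq_id[OF w, of "n * m"] w ord
    by (simp add: nat_pow_pow mult.commute)
  have e: "w [^] (i * m ^ r) = h [^] l" unfolding l h_def using w by (simp add: nat_pow_pow)
  have el: "(h [^] l) [^] l' = h"
  proof -
    have "(h [^] l) [^] l' = h [^] (m * k + 1)" using h by (simp only: nat_pow_pow l')
    also have "\<dots> = (h [^] m) [^] k \<otimes> h" using h by (simp add: nat_pow_pow)
    finally show ?thesis using h by (simp add: hm)
  qed
  have ge: "g \<otimes> h [^] l \<otimes> inv g = w [^] (j * m ^ r)"
    unfolding e[symmetric] using conj_nat_pow[OF g, of "w [^] i" "m ^ r"] w ij by (simp add: nat_pow_pow)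
  \<comment> \<open>Conjugation preserves the vanishing of the m-th power, which makes the exponent
    on the other side a multiple of n.\<close>
  have "(w [^] (j * m ^ r)) [^] m = \<one>"
  proof -
    have "(w [^] (j * m ^ r)) [^] m = g \<otimes> (h [^] l) [^] m \<otimes> inv g"
      unfolding ge[symmetric] using conj_nat_pow[OF g] h by simp
    also have "(h [^] l) [^] m = (h [^] m) [^] l" using h by (simp add: nat_pow_pow mult.commute)
    finally show ?thesis using g by (simp add: hm)
  qed
  then have "m * n dvd m * (j * m ^ r)"
    using pow_eq_id[OF w, of "j * m ^ r * m"] w ord by (simp add: nat_pow_pow mult.commute)
  then have "n dvd j * m ^ r" using m prime_gt_0_nat by simp
  then obtain c where c: "j * m ^ r = n * c" by (rule dvdE)
  have "g \<otimes> h \<otimes> inv g = (g \<otimes> h [^] l \<otimes> inv g) [^] l'" using conj_nat_pow[OF g, of "h [^] l" l'] h el by simp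
  also have "\<dots> = (w [^] (j * m ^ r)) [^] l'" by (simp only: ge)
  also have "\<dots> = h [^] (c * l')" unfolding c h_def using w by (simp add: nat_pow_pow mult.assoc)
  finally have "g \<otimes> h \<otimes> inv g = h [^] int (c * l')" by (simp only: int_pow_int)
  then show ?thesis using generate_pow[OF h] unfolding h_def by blast
qed

lemma (in group) card_generate_prime:
  assumes "w \<in> carrier G" "ord w = m * n" "n > 0"
  shows "card (generate G {w [^] n}) = m"
  using ord_pow[of w n] generate_pow_card[of "w [^] n"] assms by simp

text \<open>The number n - a + b lies strictly between 0 and 2n, so divisibility makes it equal to
  n. Differences of exponents are written in this form to stay within the naturals.\<close>

lemma dvd_diff_add_imp_eq:
  fixes a b n :: nat
  assumes "a < n" "b < n" "n dvd (n - a) + b"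
  shows "a = b"
proof -
  obtain c where c: "(n - a) + b = n * c" using assms(3) by (rule dvdE)
  have "c \<noteq> 0" using c assms by (intro notI) simp
  moreover have "c < 2"
  proof (rule ccontr)
    assume "\<not> c < 2"
    then have "n * 2 \<le> n * c" by simp
    then show False using c assms by linarith
  qed
  ultimately have "c = 1" by simp
  then show ?thesis using c assms by simp
qed

context tight_group
begin

text \<open>There are q^2 words y^i x y^j but only pq < q^2 elements. A coincidence rearranges to x
  y^s x^-1 = y^t with y^s nontrivial, and since q is a power of m,
  \<open>conj_generate_of_conj_pow\<close> passes from y^s to the subgroup of order m.\<close>

lemma generate_y_normal:
  assumes m: "prime m" and q: "q = m ^ b" and "b > 0" and "p < q"
  shows "generate G {y [^] (q div m)} \<lhd> G" "card (generate G {y [^] (q div m)}) = m"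
proof -
  have qm: "q = m * (q div m)" using q \<open>b > 0\<close> by simp
  show "card (generate G {y [^] (q div m)}) = m"
    using card_generate_prime[OF y_in, of m "q div m"] ord_y qm q_pos by (metis mult_0_right not_gr_zero)
  let ?f = "\<lambda>(i, j). y [^] i \<otimes> x \<otimes> y [^] j" and ?I = "{..<q} \<times> {..<q}"
  have "\<not> inj_on ?f ?I"
  proof
    assume "inj_on ?f ?I"
    moreover have "?f ` ?I \<subseteq> carrier G" by (rule image_subsetI) (simp add: case_prod_beta)
    ultimately have "card ?I \<le> card (carrier G)" using card_inj_on_le finite_carrier by blast
    then have "q * q \<le> p * q" by (simp add: card_carrier card_cartesian_product)
    then show False using \<open>p < q\<close> q_pos by simp
  qed
  then obtain i j k l where ijkl: "i < q" "j < q" "k < q" "l < q"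
    "y [^] i \<otimes> x \<otimes> y [^] j = y [^] k \<otimes> x \<otimes> y [^] l" "(i, j) \<noteq> (k, l)"
    unfolding inj_on_def by auto
  have yq: "y [^] (q - l) = inv (y [^] l)" "y [^] (q - i) = inv (y [^] i)"
    using nat_pow_mult[OF y_in, of "q - l" l] nat_pow_mult[OF y_in, of "q - i" i] ijkl y_pow_q
    by (simp_all add: inv_equality)
  \<comment> \<open>The two exponents are nonnegative representatives of j - l and k - i modulo
    q.\<close>
  have "x \<otimes> y [^] (j + (q - l)) \<otimes> inv x
      = inv (y [^] i) \<otimes> (y [^] i \<otimes> x \<otimes> y [^] j) \<otimes> inv (y [^] l) \<otimes> inv x"
    by (simp add: yq m_assoc flip: nat_pow_mult)
  also have "\<dots> = y [^] ((q - i) + k)" unfolding ijkl(5)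
    by (simp add: yq m_assoc flip: nat_pow_mult)
  finally have conj: "x \<otimes> y [^] (j + (q - l)) \<otimes> inv x = y [^] ((q - i) + k)" .
  \<comment> \<open>If this power vanished, so would its conjugate; both differences of exponents
    would be 0 modulo q, against the choice of distinct pairs.\<close>
  have ne: "y [^] (j + (q - l)) \<noteq> \<one>"
  proof
    assume one: "y [^] (j + (q - l)) = \<one>"
    then have "y [^] ((q - i) + k) = \<one>" using conj by simp
    then have "q dvd (q - i) + k" "q dvd j + (q - l)" using one pow_eq_id[OF y_in] ord_y by simp_all
    then have "i = k" "l = j" using ijkl(1-4) dvd_diff_add_imp_eq[of _ q] by (auto simp: add.commute)
    then show False using ijkl(6) by simp
  qed
  have "x \<otimes> y [^] (q div m) \<otimes> inv x \<in> generate G {y [^] (q div m)}"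
  proof (rule conj_generate_of_conj_pow[OF y_in x_in m _ conj ne])
    show "ord y = m * (q div m)" using ord_y qm by simp
    show "y [^] ((j + (q - l)) * m ^ b) = \<one>" using pow_eq_id[OF y_in] ord_y q by simp
  qed
  moreover have "y \<otimes> y [^] (q div m) \<otimes> inv y = y [^] (q div m)"
    by (simp add: m_assoc flip: nat_pow_Suc2)
  ultimately show "generate G {y [^] (q div m)} \<lhd> G"
    by (intro generate_normalI) (simp_all add: generate.incl)
qed

text \<open>Here p is not a power of m, so the left exponents are restricted to even ones: then the
  conjugate is an even power of x, and its order, which is also that of the conjugated element,
  divides m^a. The count is now m^a p words against p m^b elements. For b = a it only says that
  injectivity would mean bijectivity; but a word of value 1 would put y into the cyclic group of
  x.\<close>

lemma generate_x_normal:
  assumes m: "prime m" and p: "p = 2 * m ^ a" and "a > 0" and q: "q = m ^ b" and "b > 0" and "b \<le> a"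
  shows "generate G {x [^] (p div m)} \<lhd> G" "card (generate G {x [^] (p div m)}) = m"
proof -
  have pm: "p = m * (p div m)" using p \<open>a > 0\<close> by simp
  show "card (generate G {x [^] (p div m)}) = m"
    using card_generate_prime[OF x_in, of m "p div m"] ord_x pm p_pos by (metis mult_0_right not_gr_zero)
  let ?f = "\<lambda>(i, j). x [^] (2 * i) \<otimes> y \<otimes> x [^] j" and ?I = "{..<m ^ a} \<times> {..<p}"
  have "\<not> inj_on ?f ?I"
  proof
    assume inj: "inj_on ?f ?I"
    have sub: "?f ` ?I \<subseteq> carrier G" by (rule image_subsetI) (simp add: case_prod_beta)
    have "m ^ b \<le> m ^ a" using power_increasing[OF \<open>b \<le> a\<close>] prime_ge_1_nat[OF m] by blast
    then have "card (carrier G) \<le> card ?I" by (simp add: card_carrier card_cartesian_product p q)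
    also have "\<dots> = card (?f ` ?I)" using inj by (simp add: card_image)
    finally have "?f ` ?I = carrier G" using sub finite_carrier by (simp add: card_seteq)
    then have "\<one> \<in> ?f ` ?I" by simp
    then obtain i j :: nat where "\<one> = x [^] (2 * i) \<otimes> y \<otimes> x [^] j" by auto
    then have "y = inv (x [^] (2 * i)) \<otimes> (x [^] (2 * i) \<otimes> y \<otimes> x [^] j) \<otimes> inv (x [^] j)"
      by (simp add: m_assoc)
    also have "\<dots> = inv (x [^] (2 * i)) \<otimes> inv (x [^] j)"
      using \<open>\<one> = x [^] (2 * i) \<otimes> y \<otimes> x [^] j\<close> by simp
    also have "\<dots> = x [^] (- int (2 * i) - int j)"
      unfolding int_pow_diff[OF x_in] int_pow_neg_int[OF x_in] int_pow_int ..
    finally have "x [^] (- int (2 * i) - int j) = y [^] (1::int)" by simp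
    then have "x [^] (- int (2 * i) - int j) = \<one>" by (rule x_pow_eq_y_pow)
    then have "y = \<one>" using \<open>x [^] (- int (2 * i) - int j) = y [^] (1::int)\<close> by simp
    then have "q = 1" using ord_y by simp
    then show False using q \<open>b > 0\<close> m by (simp add: prime_gt_Suc_0_nat prime_nat_iff)
  qed
  then obtain i j k l where ijkl: "i < m ^ a" "j < p" "k < m ^ a" "l < p"
    "x [^] (2 * i) \<otimes> y \<otimes> x [^] j = x [^] (2 * k) \<otimes> y \<otimes> x [^] l" "(i, j) \<noteq> (k, l)"
    unfolding inj_on_def by auto
  have xq: "x [^] (p - l) = inv (x [^] l)" "x [^] (p - 2 * i) = inv (x [^] (2 * i))"
    using nat_pow_mult[OF x_in, of "p - l" l] nat_pow_mult[OF x_in, of "p - 2 * i" "2 * i"] ijkl x_pow_p p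
    by (simp_all add: inv_equality)
  have "y \<otimes> x [^] (j + (p - l)) \<otimes> inv y
      = inv (x [^] (2 * i)) \<otimes> (x [^] (2 * i) \<otimes> y \<otimes> x [^] j) \<otimes> inv (x [^] l) \<otimes> inv y"
    by (simp add: xq m_assoc flip: nat_pow_mult)
  also have "\<dots> = x [^] ((p - 2 * i) + 2 * k)" unfolding ijkl(5)
    by (simp add: xq m_assoc flip: nat_pow_mult)
  finally have conj: "y \<otimes> x [^] (j + (p - l)) \<otimes> inv y = x [^] ((p - 2 * i) + 2 * k)" .
  have ne: "x [^] (j + (p - l)) \<noteq> \<one>"
  proof
    assume one: "x [^] (j + (p - l)) = \<one>"
    then have "x [^] ((p - 2 * i) + 2 * k) = \<one>" using conj by simp
    then have "p dvd (p - 2 * i) + 2 * k" "p dvd j + (p - l)" using one pow_eq_id[OF x_in] ord_x by simp_all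
    then have "2 * i = 2 * k" "l = j"
      using ijkl(1-4) p dvd_diff_add_imp_eq[of "2 * i" p "2 * k"] dvd_diff_add_imp_eq[of l p j]
      by (simp_all add: add.commute)
    then show False using ijkl(6) by simp
  qed
  \<comment> \<open>The exponent of the conjugate is even, so its m^a-th power is a power of x^p =
    1; conjugating back transfers this to the original element.\<close>
  have one: "x [^] ((j + (p - l)) * m ^ a) = \<one>"
  proof -
    have "p dvd ((p - 2 * i) + 2 * k) * m ^ a"
    proof -
      have "((p - 2 * i) + 2 * k) * m ^ a = p * ((m ^ a - i) + k)" using p by (simp add: algebra_simps diff_mult_distrib2)
      then show ?thesis by simp
    qed
    then have "(x [^] ((p - 2 * i) + 2 * k)) [^] (m ^ a) = \<one>"
      using pow_eq_id[OF x_in] ord_x by (simp add: nat_pow_pow)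
    then have "y \<otimes> x [^] ((j + (p - l)) * m ^ a) \<otimes> inv y = \<one>"
      using conj_nat_pow[OF y_in, of "x [^] (j + (p - l))" "m ^ a"] conj by (simp add: nat_pow_pow)
    then have "inv y \<otimes> (y \<otimes> x [^] ((j + (p - l)) * m ^ a) \<otimes> inv y) \<otimes> y = \<one>" by simp
    then show ?thesis by (simp add: m_assoc)
  qed
  have "y \<otimes> x [^] (p div m) \<otimes> inv y \<in> generate G {x [^] (p div m)}"
    by (rule conj_generate_of_conj_pow[OF x_in y_in m _ conj ne one]) (use ord_x pm in simp)
  moreover have "x \<otimes> x [^] (p div m) \<otimes> inv x = x [^] (p div m)"
    by (simp add: m_assoc flip: nat_pow_Suc2)
  ultimately show "generate G {x [^] (p div m)} \<lhd> G"
    by (intro generate_normalI) (simp_all add: generate.incl)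
qed

end

section \<open>Quotients and reflexibility\<close>

text \<open>Quotients are coded on the naturals because \<open>reflexible_tight_twist\<close> is an
  induction over groups, and an induction cannot change the type of the carrier from a group to its
  cosets. Finiteness provides the injection of the cosets into the naturals.\<close>

lemma (in group) nat_quotient:
  assumes "finite (carrier G)" "N \<lhd> G"
  shows "\<exists>(H :: nat monoid) f. group H \<and> f \<in> hom G H \<and> f ` carrier G = carrier H \<and>
    (\<forall>g\<in>carrier G. f g = \<one>\<^bsub>H\<^esub> \<longleftrightarrow> g \<in> N) \<and> card (carrier H) * card N = card (carrier G)"
proof -
  interpret N: normal N G by fact
  have "finite (rcosets N)" using assms(1) by (simp add: RCOSETS_def)
  then obtain \<phi> :: "_ \<Rightarrow> nat" where phi: "inj_on \<phi> (rcosets N)"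
    using finite_imp_inj_to_nat_seg by metis
  define f where "f g = \<phi> (N #> g)" for g
  have f_eq: "f a = f b \<longleftrightarrow> a \<otimes> inv b \<in> N" if "a \<in> carrier G" "b \<in> carrier G" for a b
  proof -
    have "f a = f b \<longleftrightarrow> N #> a = N #> b"
      unfolding f_def using phi that by (intro inj_on_eq_iff) (auto simp: RCOSETS_def)
    also have "\<dots> \<longleftrightarrow> a \<otimes> inv b \<in> N"
      using N.rcos_module[OF is_group that(2,1)] repr_independence[OF _ that(2) N.is_subgroup, of a]
        rcos_self[OF that(1) N.is_subgroup] by metis
    finally show ?thesis .
  qed
  \<comment> \<open>That f identifies exactly the elements of a common coset of N is enough to move
    the multiplication to the image of f.\<close>
  interpret W: weak_group_morphism f N G by unfold_locales (rule f_eq)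
  let ?H = "image_group f G"
  have W: "weak_group_morphism f N G" ..
  have one: "\<one>\<^bsub>?H\<^esub> = f \<one>" by (simp add: image_group_def)
  have car: "carrier ?H = f ` carrier G" by (simp add: image_group_def)
  have "f ` carrier G = \<phi> ` (rcosets N)" by (auto simp: f_def RCOSETS_def image_iff)
  then have "card (carrier ?H) = card (rcosets N)" using car card_image[OF phi] by simp
  then have "card (carrier ?H) * card N = card (carrier G)"
    using lagrange_finite[OF assms(1) N.is_subgroup] by (simp add: order_def)
  moreover have "\<forall>g\<in>carrier G. f g = \<one>\<^bsub>?H\<^esub> \<longleftrightarrow> g \<in> N" unfolding one using f_eq by simp
  ultimately show ?thesis
    using image_group_is_group[OF W] weak_group_morphism_is_hom[OF W] car by metis
qed

lemma (in group_hom) hom_twist: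
  assumes "x \<in> carrier G" "y \<in> carrier G"
  shows "h (twist G x y) = twist H (h x) (h y)"
  using assms by (simp add: twist_def)

context tight_group
begin

text \<open>The normal form and the relations pass to any image; the numerical condition says that
  the quotient has p' q' elements, so that it is tight again.\<close>

lemma tight_quotient:
  assumes N: "N \<lhd> G" and "p' > 0" "q' > 0" "p' * q' * card N = p * q"
    and "x [^] p' \<in> N" "y [^] q' \<in> N"
  shows "\<exists>(H :: nat monoid) f. f \<in> hom G H \<and> tight_group H (f x) (f y) p' q' \<and>
    f ` carrier G = carrier H \<and> (\<forall>g\<in>carrier G. f g = \<one>\<^bsub>H\<^esub> \<longleftrightarrow> g \<in> N)"
proof -
  obtain H :: "nat monoid" and f where H: "group H" "f \<in> hom G H" "f ` carrier G = carrier H"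
    "\<forall>g\<in>carrier G. f g = \<one>\<^bsub>H\<^esub> \<longleftrightarrow> g \<in> N" "card (carrier H) * card N = card (carrier G)"
    using nat_quotient[OF finite_carrier N] by blast
  interpret H: group H by fact
  interpret f: group_hom G H f by (intro group_hom.intro group_hom_axioms.intro is_group H)
  have "card N > 0" using assms(4) p_pos q_pos by (metis mult_0_right mult_is_0 not_gr_zero)
  then have "card (carrier H) = p' * q'" using H(5) assms(4) card_carrier by (metis mult_right_cancel not_gr_zero)
  moreover have "f x [^]\<^bsub>H\<^esub> p' = \<one>\<^bsub>H\<^esub>" "f y [^]\<^bsub>H\<^esub> q' = \<one>\<^bsub>H\<^esub>"
    using H(4) assms(5,6) f.hom_nat_pow by (metis nat_pow_closed x_in, metis nat_pow_closed y_in)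
  moreover have "(f x \<otimes>\<^bsub>H\<^esub> f y) \<otimes>\<^bsub>H\<^esub> (f x \<otimes>\<^bsub>H\<^esub> f y) = \<one>\<^bsub>H\<^esub>"
    using xy_square f.hom_one f.hom_mult by (metis m_closed x_in y_in)
  moreover have "\<exists>(i::nat) (j::nat). g = f x [^]\<^bsub>H\<^esub> i \<otimes>\<^bsub>H\<^esub> f y [^]\<^bsub>H\<^esub> j" if g: "g \<in> carrier H" for g
  proof -
    obtain k where k: "k \<in> carrier G" "g = f k" using g H(3) by (metis imageE)
    obtain i j :: nat where "k = x [^] i \<otimes> y [^] j" using normal_form[OF k(1)] by metis
    then have "g = f x [^]\<^bsub>H\<^esub> i \<otimes>\<^bsub>H\<^esub> f y [^]\<^bsub>H\<^esub> j" using k by (simp add: f.hom_nat_pow)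
    then show ?thesis by blast
  qed
  ultimately have "tight_group H (f x) (f y) p' q'"
    by unfold_locales (simp_all add: assms(2,3))
  then show ?thesis using H by blast
qed

text \<open>A kernel generated by a power of x or of y is preserved, because the inverting map sends
  its generator to the inverse. So the map descends; \<open>s\<close> evaluates it at an arbitrary
  preimage.\<close>

lemma reflexible_quotient:
  assumes refl: "reflexible G x y" and f: "f \<in> hom G H" "group H" "f ` carrier G = carrier H"
    and ker: "\<forall>g\<in>carrier G. f g = \<one>\<^bsub>H\<^esub> \<longleftrightarrow> g \<in> generate G {h}"
    and h: "h = x [^] (i::nat) \<or> h = y [^] i"
  shows "reflexible H (f x) (f y)"
proof -
  interpret H: group H by fact
  interpret f: group_hom G H f by (intro group_hom.intro group_hom_axioms.intro is_group f)
  have hc: "h \<in> carrier G" using h by auto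
  obtain t where t: "t \<one> = \<one>" "\<And>g. g \<in> carrier G \<Longrightarrow> t g \<in> carrier G"
    "\<And>g. g \<in> carrier G \<Longrightarrow> t (x \<otimes> g) = inv x \<otimes> t g" "\<And>g. g \<in> carrier G \<Longrightarrow> t (y \<otimes> g) = inv y \<otimes> t g"
    using refl unfolding reflexible_def by blast
  interpret t: group_hom G G t
    by (intro group_hom.intro group_hom_axioms.intro is_group reflexible_hom(1)[of t]) (simp_all add: t)
  have tx: "t x = inv x" and ty: "t y = inv y" using reflexible_hom(2,3)[of t] t by blast+
  have th: "t h = inv h" using h tx ty by (auto simp: t.hom_nat_pow nat_pow_inv)
  have tk: "f (t k) = \<one>\<^bsub>H\<^esub>" if k: "k \<in> carrier G" "f k = \<one>\<^bsub>H\<^esub>" for k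
  proof -
    obtain n :: int where "k = h [^] n" using ker k generate_pow[OF hc] by blast
    then have "t k = h [^] (- n)" using hc th by (simp add: t.hom_int_pow int_pow_inv int_pow_neg)
    then have "t k \<in> generate G {h}" using generate_pow[OF hc] by blast
    then show ?thesis using ker k(1) t(2) by simp
  qed
  have wd: "f (t g) = f (t g')" if g: "g \<in> carrier G" "g' \<in> carrier G" "f g = f g'" for g g'
  proof -
    have "f (g \<otimes> inv g') = \<one>\<^bsub>H\<^esub>" using g by simp
    then have "f (t (g \<otimes> inv g')) = \<one>\<^bsub>H\<^esub>" using g tk[of "g \<otimes> inv g'"] by simp
    then have "f (t g) \<otimes>\<^bsub>H\<^esub> inv\<^bsub>H\<^esub> f (t g') = \<one>\<^bsub>H\<^esub>" using g by simp
    then show ?thesis using g by (simp add: H.inv_solve_right')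
  qed
  define s where "s k = f (t (inv_into (carrier G) f k))" for k
  have s: "s (f g) = f (t g)" if "g \<in> carrier G" for g
    unfolding s_def using that wd by (metis f_inv_into_f image_eqI inv_into_into)
  have "s \<one>\<^bsub>H\<^esub> = \<one>\<^bsub>H\<^esub>" using s[of \<one>] t(1) by simp
  moreover have "s k \<in> carrier H \<and> s (f x \<otimes>\<^bsub>H\<^esub> k) = inv\<^bsub>H\<^esub> f x \<otimes>\<^bsub>H\<^esub> s k \<and>
      s (f y \<otimes>\<^bsub>H\<^esub> k) = inv\<^bsub>H\<^esub> f y \<otimes>\<^bsub>H\<^esub> s k" if k: "k \<in> carrier H" for k
  proof -
    obtain g where g: "g \<in> carrier G" "k = f g" using k f(3) by (metis imageE)
    then show ?thesis using s[of g] s[of "x \<otimes> g"] s[of "y \<otimes> g"] t(2)[of g] t(3)[of g] t(4)[of g] by simp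
  qed
  ultimately show ?thesis unfolding reflexible_def by blast
qed

text \<open>For u = 1 the element x^2 commutes with z, hence with y, and the map sending x^i y^j to
  x^-i y^-j works. Left multiplication by x is immediate. For left multiplication by y the even part
  of x^i is passed over, and a remaining odd x is handled by y x = x^-1 y^-1 and x y = y^-1
  x^-1.\<close>

lemma reflexible_of_twist_eq_one:
  assumes u: "twist G x y = \<one>"
  shows "reflexible G x y"
proof -
  define a where "a = x \<otimes> x"
  have a [simp]: "a \<in> carrier G" by (simp add: a_def)
  have ya: "a \<otimes> y = y \<otimes> a"
  proof -
    have "(x \<otimes> y) \<otimes> (a \<otimes> (x \<otimes> y)) = a" using half.conj_z_x2 u by (simp add: a_def m_assoc)
    then have "a \<otimes> (x \<otimes> y) = (x \<otimes> y) \<otimes> a" using half.z_z[of "a \<otimes> (x \<otimes> y)"] by simp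
    then have "x \<otimes> (a \<otimes> y) = x \<otimes> (y \<otimes> a)" by (simp add: a_def m_assoc)
    then show ?thesis by simp
  qed
  have x2: "x [^] (2 * k) = a [^] k" for k :: int
    using int_pow_pow[OF x_in, of 2 k] int_pow_mult[OF x_in, of 1 1] by (simp add: a_def)
  have even: "x [^] (2 * k) \<otimes> y = y \<otimes> x [^] (2 * k)" for k :: int
    unfolding x2 by (rule int_pow_commute) (simp_all add: ya)
  have even': "inv y \<otimes> x [^] (2 * k) = x [^] (2 * k) \<otimes> inv y" for k :: int
    by (rule commute_inv) (simp_all add: even)
  have "inv y = x \<otimes> (y \<otimes> x)" using half.inv_y_eq by (simp add: m_assoc)
  then have yx: "y \<otimes> x = inv x \<otimes> inv y" by simp
  have zz: "inv y \<otimes> inv x = x \<otimes> y" using half.inv_z by (simp add: inv_mult_group)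
  \<comment> \<open>The chosen exponents are determined only modulo the orders;
    \<open>normal_form_int_eqD\<close> shows that the value of \<open>t\<close> does not depend on
    the choice.\<close>
  define r where "r g = (SOME ij :: int \<times> int. g = x [^] fst ij \<otimes> y [^] snd ij)" for g
  define t where "t g = x [^] (- fst (r g)) \<otimes> y [^] (- snd (r g))" for g
  have t: "t (x [^] i \<otimes> y [^] j) = x [^] (- i) \<otimes> y [^] (- j)" for i j :: int
  proof -
    let ?g = "x [^] i \<otimes> y [^] j"
    have "?g = x [^] fst (r ?g) \<otimes> y [^] snd (r ?g)"
      unfolding r_def by (rule someI[of _ "(i, j)"]) simp
    from normal_form_int_eqD[OF this]
    show ?thesis by (simp add: t_def int_pow_neg)
  qed
  have "t \<one> = \<one>" using t[of 0 0] by simp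
  moreover have "t g \<in> carrier G \<and> t (x \<otimes> g) = inv x \<otimes> t g \<and> t (y \<otimes> g) = inv y \<otimes> t g"
    if g: "g \<in> carrier G" for g
  proof -
    obtain i' j' :: nat where "g = x [^] i' \<otimes> y [^] j'" using normal_form[OF g] by metis
    then obtain i j :: int where ij: "g = x [^] i \<otimes> y [^] j" using int_pow_int by metis
    have tg: "t g = x [^] (- i) \<otimes> y [^] (- j)" by (simp add: ij t)
    have "x \<otimes> g = x [^] (1 + i) \<otimes> y [^] j" by (simp add: ij int_pow_mult m_assoc)
    then have "t (x \<otimes> g) = x [^] (- 1 + - i) \<otimes> y [^] (- j)" using t[of "1 + i" j] by simp
    also have "\<dots> = inv x \<otimes> t g" unfolding tg int_pow_mult[OF x_in] by (simp add: int_pow_neg m_assoc)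
    finally have 1: "t (x \<otimes> g) = inv x \<otimes> t g" .
    have 2: "t (y \<otimes> g) = inv y \<otimes> t g"
    proof (cases "even i")
      case True
      then obtain k where k: "i = 2 * k" by (rule evenE)
      have "y \<otimes> g = (y \<otimes> x [^] (2 * k)) \<otimes> y [^] j" by (simp add: ij k m_assoc)
      also have "\<dots> = x [^] (2 * k) \<otimes> y [^] (1 + j)" by (simp add: m_assoc int_pow_mult flip: even)
      finally have "t (y \<otimes> g) = x [^] (2 * (- k)) \<otimes> y [^] (- 1 + - j)" using t[of "2 * k" "1 + j"] by simp
      also have "\<dots> = (x [^] (2 * (- k)) \<otimes> inv y) \<otimes> y [^] (- j)"
        unfolding int_pow_mult[OF y_in] by (simp add: int_pow_neg m_assoc)
      also have "\<dots> = inv y \<otimes> t g" unfolding even'[symmetric] tg k by (simp add: m_assoc)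
      finally show ?thesis .
    next
      case False
      then obtain k where k: "i = 2 * k + 1" by (rule oddE)
      have "y \<otimes> g = (y \<otimes> x [^] (2 * k)) \<otimes> x \<otimes> y [^] j" by (simp add: ij k m_assoc int_pow_mult)
      also have "\<dots> = x [^] (2 * k) \<otimes> (y \<otimes> x) \<otimes> y [^] j" by (simp add: m_assoc flip: even)
      also have "\<dots> = x [^] (2 * k + - 1) \<otimes> y [^] (- 1 + j)"
        unfolding yx int_pow_mult[OF y_in] int_pow_mult[OF x_in] by (simp add: int_pow_neg m_assoc)
      finally have "t (y \<otimes> g) = x [^] (2 * (- k) + 1) \<otimes> y [^] (1 + - j)"
        using t[of "2 * k + - 1" "- 1 + j"] by simp
      also have "\<dots> = x [^] (2 * (- k)) \<otimes> (x \<otimes> y) \<otimes> y [^] (- j)"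
        unfolding int_pow_mult[OF y_in] int_pow_mult[OF x_in] by (simp add: m_assoc)
      also have "\<dots> = (x [^] (2 * (- k)) \<otimes> inv y) \<otimes> inv x \<otimes> y [^] (- j)"
        unfolding zz[symmetric] by (simp add: m_assoc)
      also have "\<dots> = inv y \<otimes> (x [^] (2 * (- k) + - 1) \<otimes> y [^] (- j))"
        unfolding even'[symmetric] int_pow_mult[OF x_in] by (simp add: int_pow_neg m_assoc)
      also have "\<dots> = inv y \<otimes> t g" unfolding tg k by simp
      finally show ?thesis .
    qed
    show ?thesis using 1 2 tg by simp
  qed
  ultimately show ?thesis unfolding reflexible_def by blast
qed

lemma generate_singletonE:
  assumes "h \<in> carrier G" "g \<in> generate G {h}"
  obtains n :: int where "g = h [^] n"
  using assms generate_pow[OF assms(1)] by blast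

text \<open>The induction hypothesis is stated for groups on the naturals, where the quotients live.
  The subgroup of order m is taken in whichever cyclic group the pigeonhole argument covers; u then
  lies in that group, and \<open>reflexible_twist_in_powers_y\<close> or
  \<open>half.twist_in_powers_x\<close> finishes.\<close>

lemma reflexible_twist_step:
  assumes m: "prime m" and "odd m" and pq: "p = 2 * m ^ a" "q = m ^ b" and refl: "reflexible G x y"
    and IH: "\<And>(H :: nat monoid) v w p' q' a' b'. a' + b' < a + b \<Longrightarrow> tight_group H v w p' q' \<Longrightarrow>
      p' = 2 * m ^ a' \<Longrightarrow> q' = m ^ b' \<Longrightarrow> reflexible H v w \<Longrightarrow> twist H v w = \<one>\<^bsub>H\<^esub>"
  shows "twist G x y = \<one>"
proof -
  have "odd q" using pq \<open>odd m\<close> by simp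
  have m0: "m > 0" using m by (simp add: prime_gt_0_nat)
  consider "a = 0" | "b = 0" | "a > 0" "b > 0" "p < q" | "a > 0" "b > 0" "\<not> p < q" by auto
  then show ?thesis
  proof cases
    case 1
    then have "x \<otimes> x = \<one>" using x_pow_p pq by (simp add: numeral_2_eq_2)
    then have "inv x = x" by (simp add: inv_equality)
    then have "twist G x y = (x \<otimes> y) \<otimes> ((x \<otimes> x) \<otimes> ((x \<otimes> y) \<otimes> (x \<otimes> x)))"
      by (simp add: twist_def m_assoc)
    then show ?thesis using \<open>x \<otimes> x = \<one>\<close> xy_square by simp
  next
    case 2
    then have y: "y = \<one>" using y_pow_q pq by simp
    then show ?thesis using xy_square by (simp add: twist_def m_assoc)
  next
    case 3
    let ?h = "y [^] (q div m)"
    have qm: "q div m = m ^ (b - 1)" "q = m * m ^ (b - 1)"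
      using pq(2) m0 \<open>b > 0\<close> by (cases b; simp)+
    note N = generate_y_normal[OF m pq(2) \<open>b > 0\<close> \<open>p < q\<close>]
    have 1: "?h \<in> generate G {?h}" by (simp add: generate.incl)
    have 2: "x [^] p \<in> generate G {?h}" unfolding x_pow_p by (rule generate.one)
    have 3: "p * (q div m) * card (generate G {?h}) = p * q" unfolding N(2) using qm by simp
    have 4: "q div m > 0" using qm(1) m0 by simp
    obtain H :: "nat monoid" and f where H: "f \<in> hom G H" "tight_group H (f x) (f y) p (q div m)"
      "f ` carrier G = carrier H" "\<forall>g\<in>carrier G. f g = \<one>\<^bsub>H\<^esub> \<longleftrightarrow> g \<in> generate G {?h}"
      using tight_quotient[OF N(1) p_pos 4 3 2 1] by blast
    interpret H: tight_group H "f x" "f y" p "q div m" by fact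
    interpret f: group_hom G H f by (intro group_hom.intro group_hom_axioms.intro is_group H.is_group H)
    have "reflexible H (f x) (f y)" using reflexible_quotient[OF refl H(1) H.is_group H(3,4)] by blast
    then have "twist H (f x) (f y) = \<one>\<^bsub>H\<^esub>"
      using IH[OF _ H(2) pq(1) qm(1)] \<open>b > 0\<close> by simp
    then have "twist G x y \<in> generate G {?h}" using H(4) f.hom_twist[OF x_in y_in] half.u_closed by simp
    then obtain n :: int where "twist G x y = ?h [^] n" using generate_singletonE[of ?h] by auto
    then have "twist G x y = y [^] (int (q div m) * n)" by (simp add: int_pow_pow flip: int_pow_int)
    then show ?thesis by (rule reflexible_twist_in_powers_y[OF refl \<open>odd q\<close>])
  next
    case 4
    let ?h = "x [^] (p div m)"
    \<comment> \<open>Because m \<ge> 3, an exponent b > a would give q \<ge> m^(a+1) > 2 m^a =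
      p.\<close>
    have ba: "b \<le> a"
    proof (rule ccontr)
      assume "\<not> b \<le> a"
      then have "m ^ Suc a \<le> m ^ b" using m0 by (intro power_increasing) auto
      moreover have "m > 2" using m \<open>odd m\<close> prime_ge_2_nat[of m] by (cases "m = 2") auto
      then have "2 * m ^ a < m * m ^ a" using m0 by simp
      ultimately show False using \<open>\<not> p < q\<close> pq by simp
    qed
    have pm: "p div m = 2 * m ^ (a - 1)" "p = m * (2 * m ^ (a - 1))"
      using pq(1) m0 \<open>a > 0\<close> by (cases a; simp)+
    note N = generate_x_normal[OF m pq(1) \<open>a > 0\<close> pq(2) \<open>b > 0\<close> ba]
    have 1: "?h \<in> generate G {?h}" by (simp add: generate.incl)
    have 2: "y [^] q \<in> generate G {?h}" unfolding y_pow_q by (rule generate.one)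
    have 3: "p div m * q * card (generate G {?h}) = p * q" unfolding N(2) using pm by simp
    have 4: "p div m > 0" using pm(1) m0 by simp
    obtain H :: "nat monoid" and f where H: "f \<in> hom G H" "tight_group H (f x) (f y) (p div m) q"
      "f ` carrier G = carrier H" "\<forall>g\<in>carrier G. f g = \<one>\<^bsub>H\<^esub> \<longleftrightarrow> g \<in> generate G {?h}"
      using tight_quotient[OF N(1) 4 q_pos 3 1 2] by blast
    interpret H: tight_group H "f x" "f y" "p div m" q by fact
    interpret f: group_hom G H f by (intro group_hom.intro group_hom_axioms.intro is_group H.is_group H)
    have "reflexible H (f x) (f y)" using reflexible_quotient[OF refl H(1) H.is_group H(3,4)] by blast
    then have "twist H (f x) (f y) = \<one>\<^bsub>H\<^esub>"
      using IH[OF _ H(2) pm(1) pq(2)] \<open>a > 0\<close> by simp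
    then have "twist G x y \<in> generate G {?h}" using H(4) f.hom_twist[OF x_in y_in] half.u_closed by simp
    then obtain n :: int where n: "twist G x y = ?h [^] n" using generate_singletonE[of ?h] by auto
    have "twist G x y \<otimes> x = x \<otimes> twist G x y" unfolding n
      by (intro int_pow_commute) (simp_all flip: nat_pow_Suc2)
    then show ?thesis using half.twist_in_powers_x[OF \<open>odd q\<close> y_pow_q] by simp
  qed
qed

end

lemma reflexible_tight_twist:
  fixes G :: "nat monoid" and m a b :: nat
  assumes "tight_group G x y p q" "prime m" "odd m" "p = 2 * m ^ a" "q = m ^ b" "reflexible G x y"
  shows "twist G x y = \<one>\<^bsub>G\<^esub>"
  using assms
proof (induction "a + b" arbitrary: G x y p q a b rule: less_induct)
  case less
  show ?case
    by (rule tight_group.reflexible_twist_step[OF less.prems(1-6)]) (use less.hyps less.prems(2,3) in blast)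
qed

section \<open>The twist of an atomic polyhedron\<close>

lemma (in group) conj_int_pow:
  assumes "g \<in> carrier G" "a \<in> carrier G"
  shows "(g \<otimes> a \<otimes> inv g) [^] (n::int) = g \<otimes> a [^] n \<otimes> inv g"
proof (cases "n < 0")
  case True
  have "inv (g \<otimes> a [^] nat (- n) \<otimes> inv g) = g \<otimes> inv (a [^] nat (- n)) \<otimes> inv g"
    using assms by (simp add: inv_mult_group m_assoc)
  then show ?thesis unfolding int_pow_def2 if_P[OF True] conj_nat_pow[OF assms] .
next
  case False
  show ?thesis unfolding int_pow_def2 if_not_P[OF False] by (rule conj_nat_pow[OF assms])
qed

context half_turn
begin

text \<open>An identity valid for every half-turn: with y^-1 = z x, the twist is exactly the
  correction term. The first relation of the presentation therefore only prescribes which power of y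
  equals u.\<close>

lemma inv_y_x: "inv y \<otimes> x = x \<otimes> (x \<otimes> (x \<otimes> (y \<otimes> u)))"
  unfolding inv_y_eq by (simp add: y_eq u_eq m_assoc z_z)

text \<open>Inversion of u by x turns z x u into x^2 z x^-1, and this is the second relation of the
  presentation.\<close>

lemma y_inv_x:
  assumes "x \<otimes> inv u = u \<otimes> x"
  shows "y \<otimes> inv x = inv x \<otimes> (inv x \<otimes> (inv x \<otimes> (inv y \<otimes> u)))"
proof -
  have "z \<otimes> (x \<otimes> u) = z \<otimes> (x \<otimes> (u \<otimes> x)) \<otimes> inv x" by (simp add: m_assoc)
  also have "\<dots> = z \<otimes> (x \<otimes> (x \<otimes> inv u)) \<otimes> inv x" using assms by simp
  also have "\<dots> = x \<otimes> (x \<otimes> (z \<otimes> inv x))" unfolding conj_z_x2[symmetric] by (simp add: m_assoc z_z)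
  finally show ?thesis unfolding inv_y_eq by (simp add: y_eq m_assoc)
qed

text \<open>As x inverts u, its square commutes with u, so powers of z x^2 z = x^2 u^-1 can be taken
  factor by factor. An exponent divisible by the order of u then yields a power of x^2 fixed by
  z.\<close>

lemma x_conj_pow_x2:
  assumes "x \<otimes> inv u = u \<otimes> x"
  shows "z \<otimes> (x \<otimes> x) [^] (i::nat) \<otimes> z = (x \<otimes> x) [^] i \<otimes> inv u [^] i"
proof -
  have "inv (x \<otimes> inv u) = inv (u \<otimes> x)" using assms by simp
  then have "u \<otimes> inv x = inv x \<otimes> inv u" by (simp add: inv_mult_group)
  then have "x \<otimes> (u \<otimes> inv x) \<otimes> x = x \<otimes> (inv x \<otimes> inv u) \<otimes> x" by simp
  then have xu: "x \<otimes> u = inv u \<otimes> x" by (simp add: m_assoc)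
  have "(x \<otimes> x) \<otimes> inv u = x \<otimes> u \<otimes> x" using assms by (simp add: m_assoc)
  also have "\<dots> = inv u \<otimes> (x \<otimes> x)" using xu by (simp add: m_assoc)
  finally have c: "(x \<otimes> x) \<otimes> inv u = inv u \<otimes> (x \<otimes> x)" .
  have "z \<otimes> (x \<otimes> x) [^] i \<otimes> z = (z \<otimes> (x \<otimes> x) \<otimes> z) [^] i"
    using conj_nat_pow[of z "x \<otimes> x" i] by (simp add: inv_z)
  also have "z \<otimes> (x \<otimes> x) \<otimes> z = (x \<otimes> x) \<otimes> inv u" using conj_z_x2 by (simp add: m_assoc)
  also have "\<dots> [^] i = (x \<otimes> x) [^] i \<otimes> inv u [^] i" by (rule pow_mult_distrib[OF c]) simp_all
  finally show ?thesis .
qed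

end

context tight_group
begin

text \<open>Hypotheses \<open>Hq\<close> and \<open>Hp\<close> are atomicity in group form; the
  bounds above 2 are those under which a tight group is given a coset polyhedron. The two
  conclusions about u are what \<open>relations_of_twist\<close> turns into the
  presentation.\<close>

lemma twist_of_atomic:
  fixes m \<alpha> \<beta> :: nat
  assumes m: "prime m" and "odd m" and "\<alpha> > 0" and "\<beta> > 0"
    and p: "p = 2 * m ^ \<alpha>" and q: "q = m ^ (\<alpha> + \<beta>)" and nrefl: "\<not> reflexible G x y"
    and Hq: "\<And>(H :: nat monoid) f q'. f \<in> hom G H \<Longrightarrow> tight_group H (f x) (f y) p q' \<Longrightarrow>
      2 < q' \<Longrightarrow> q' < q \<Longrightarrow> reflexible H (f x) (f y)"
    and Hp: "\<And>(H :: nat monoid) f p'. f \<in> hom G H \<Longrightarrow> tight_group H (f x) (f y) p' q \<Longrightarrow>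
      2 < p' \<Longrightarrow> p' < p \<Longrightarrow> reflexible H (f x) (f y)"
  shows "\<alpha> = 1" and "\<exists>k::int. 1 \<le> k \<and> k \<le> int m - 1 \<and> twist G x y = y [^] (k * int m ^ \<beta>) \<and>
    x \<otimes> inv (twist G x y) = twist G x y \<otimes> x"
proof -
  let ?u = "twist G x y" and ?z = "x \<otimes> y"
  have m2: "m > 2" using m \<open>odd m\<close> prime_ge_2_nat[of m] by (cases "m = 2") auto
  have u1: "?u \<noteq> \<one>" using nrefl reflexible_of_twist_eq_one by blast
  have "p < q"
  proof -
    have "m ^ Suc \<alpha> \<le> m ^ (\<alpha> + \<beta>)" using m2 \<open>\<beta> > 0\<close> by (intro power_increasing) auto
    moreover have "2 * m ^ \<alpha> < m ^ Suc \<alpha>" using m2 by simp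
    ultimately show ?thesis unfolding p q by (rule order.strict_trans2[rotated])
  qed
  obtain b where b: "\<alpha> + \<beta> = Suc b" using \<open>\<alpha> > 0\<close> by (cases "\<alpha> + \<beta>") auto
  have qm: "q div m = m ^ b" "q = m * m ^ b" using q b m2 by simp_all
  define h where "h = y [^] (q div m)"
  have h: "h \<in> carrier G" by (simp add: h_def)
  note N = generate_y_normal[OF m q _ \<open>p < q\<close>, folded h_def]
  have b0: "b > 0" using b \<open>\<alpha> > 0\<close> \<open>\<beta> > 0\<close> by simp
  have N1: "generate G {h} \<lhd> G" and N2: "card (generate G {h}) = m" using N \<open>\<alpha> > 0\<close> by simp_all
  have ordh: "ord h = m" using N2 generate_pow_card[OF h] by simp
  have hm: "h [^] m = \<one>" using ordh pow_ord_eq_1[OF h] by simp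
  have "?u \<in> generate G {h}"
  proof -
    have 1: "y [^] (q div m) \<in> generate G {h}" unfolding h_def by (simp add: generate.incl)
    have 2: "x [^] p \<in> generate G {h}" unfolding x_pow_p by (rule generate.one)
    have 3: "p * (q div m) * card (generate G {h}) = p * q" unfolding N2 using qm by simp
    \<comment> \<open>Here \<alpha> + \<beta> \<ge> 2 enters: in the quotient y still has order at
      least m > 2, as \<open>Hq\<close> demands.\<close>
    have "m ^ 1 \<le> m ^ b" using m2 b0 by (intro power_increasing) auto
    then have 4: "q div m > 2" using qm(1) m2 by simp
    have 5: "q div m < q" using m2 q_pos by simp
    obtain H :: "nat monoid" and f where H: "f \<in> hom G H" "tight_group H (f x) (f y) p (q div m)"
      "f ` carrier G = carrier H" "\<forall>g\<in>carrier G. f g = \<one>\<^bsub>H\<^esub> \<longleftrightarrow> g \<in> generate G {h}"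
      using tight_quotient[OF N1 p_pos _ 3 2 1] 4 by (metis gr_implies_not0 not_gr_zero)
    interpret H: tight_group H "f x" "f y" p "q div m" by fact
    interpret f: group_hom G H f by (intro group_hom.intro group_hom_axioms.intro is_group H.is_group H)
    have "twist H (f x) (f y) = \<one>\<^bsub>H\<^esub>"
      using reflexible_tight_twist[OF H(2) m \<open>odd m\<close> p qm(1) Hq[OF H(1,2) 4 5]] .
    then show ?thesis using H(4) f.hom_twist[OF x_in y_in] half.u_closed by simp
  qed
  then obtain n :: int where n: "?u = h [^] n" using generate_singletonE[OF h] by blast
  have um: "?u [^] m = \<one>"
  proof -
    have "?u [^] m = h [^] (n * int m)" unfolding n using h by (simp add: int_pow_pow flip: int_pow_int)
    also have "\<dots> = (h [^] m) [^] n" using h by (simp add: int_pow_pow mult.commute flip: int_pow_int)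
    finally show ?thesis by (simp add: hm)
  qed
  have yh: "h \<otimes> y = y \<otimes> h" unfolding h_def by (intro group_commutes_pow) simp_all
  have yu: "?u \<otimes> y = y \<otimes> ?u" unfolding n by (intro int_pow_commute h yh y_in)
  have "x \<otimes> h \<otimes> inv x \<in> generate G {h}" using N1 generate.incl[of h "{h}" G] by (simp add: normal_inv_iff)
  then obtain c :: int where c: "x \<otimes> h \<otimes> inv x = h [^] c" using generate_singletonE[OF h] by blast
  \<comment> \<open>Since y commutes with h, the involution z acts on h as x does; applying it twice
    yields c^2 = 1 modulo m.\<close>
  have zh: "?z \<otimes> h \<otimes> inv ?z = h [^] c"
  proof -
    have "?z \<otimes> h \<otimes> inv ?z = x \<otimes> (y \<otimes> h \<otimes> inv y) \<otimes> inv x" using h by (simp add: inv_mult_group m_assoc)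
    also have "y \<otimes> h \<otimes> inv y = h" unfolding yh[symmetric] using h by (simp add: m_assoc)
    finally show ?thesis using c by simp
  qed
  have "h = ?z \<otimes> (?z \<otimes> h \<otimes> inv ?z) \<otimes> inv ?z"
  proof -
    have "?z \<otimes> (?z \<otimes> h \<otimes> inv ?z) \<otimes> inv ?z = (?z \<otimes> ?z) \<otimes> h \<otimes> inv (?z \<otimes> ?z)"
      using h half.z_closed by (simp only: inv_mult_group m_assoc m_closed inv_closed)
    then show ?thesis unfolding xy_square using h by simp
  qed
  also have "\<dots> = (?z \<otimes> h \<otimes> inv ?z) [^] c" unfolding zh conj_int_pow[OF half.z_closed h, symmetric] ..
  also have "\<dots> = h [^] (c * c)" unfolding zh using h by (simp add: int_pow_pow)
  finally have "h [^] (1::int) = h [^] (c * c)" using h by simp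
  then have "int m dvd c * c - 1" using int_pow_eq[OF h] ordh by (metis)
  then have "int m dvd (c - 1) * (c + 1)" by (simp add: algebra_simps)
  then have "int m dvd c - 1 \<or> int m dvd c + 1" using m by (simp add: prime_dvd_mult_iff)
  \<comment> \<open>If x centralised h, then u would be central, and
    \<open>half.twist_central\<close> would give u = 1.\<close>
  moreover have "\<not> int m dvd c - 1"
  proof
    assume "int m dvd c - 1"
    then have "h [^] (1::int) = h [^] c" using int_pow_eq[OF h] ordh by metis
    then have "x \<otimes> h \<otimes> inv x \<otimes> x = h \<otimes> x" using c h by simp
    then have "h \<otimes> x = x \<otimes> h" using h by (simp add: m_assoc)
    then have "?u \<otimes> x = x \<otimes> ?u" unfolding n using h by (intro int_pow_commute) simp_all
    then show False using half.twist_central[OF \<open>odd m\<close> um yu] u1 by blast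
  qed
  ultimately have "int m dvd c - (- 1)" by simp
  then have "h [^] (- 1 :: int) = h [^] c" using int_pow_eq[OF h] ordh by metis
  then have "x \<otimes> h \<otimes> inv x = inv h" using c h by (simp add: int_pow_neg)
  then have "x \<otimes> ?u \<otimes> inv x = inv ?u" using conj_int_pow[OF x_in h, of n] h by (simp add: n int_pow_inv)
  then have "inv (x \<otimes> ?u \<otimes> inv x) = ?u" by simp
  then have "x \<otimes> inv ?u \<otimes> inv x = ?u" by (simp add: inv_mult_group m_assoc)
  then have "x \<otimes> inv ?u \<otimes> inv x \<otimes> x = ?u \<otimes> x" by simp
  then have xu: "x \<otimes> inv ?u = ?u \<otimes> x" by (simp add: m_assoc)
  show "\<alpha> = 1"
  proof (rule ccontr)
    assume "\<alpha> \<noteq> 1"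
    then obtain a where a: "\<alpha> = Suc (Suc a)" using \<open>\<alpha> > 0\<close> by (metis One_nat_def not0_implies_Suc not_gr_zero)
    have pm: "p div m = 2 * m ^ Suc a" "p = m * (2 * m ^ Suc a)" using p a m2 by simp_all
    \<comment> \<open>w generates the subgroup of order m of the powers of x. It is written as a
      power of x^2 with exponent m^(\<alpha>-1), a multiple of m since \<alpha> \<ge> 2, so
      \<open>half.x_conj_pow_x2\<close> shows that it commutes with z; commuting with x as well, it
      is central.\<close>
    define w where "w = (x \<otimes> x) [^] (m ^ Suc a)"
    have w: "w \<in> carrier G" by (simp add: w_def)
    have wx: "w = x [^] (p div m)"
      unfolding pm w_def using nat_pow_pow[OF x_in, of 2 "m ^ Suc a"] by (simp add: numeral_2_eq_2)
    have "inv ?u [^] (m ^ Suc a) = (inv ?u [^] m) [^] (m ^ a)" by (simp add: nat_pow_pow)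
    also have "\<dots> = \<one>" using um by (simp add: nat_pow_inv)
    finally have zw: "?z \<otimes> w \<otimes> ?z = w" using half.x_conj_pow_x2[OF xu, of "m ^ Suc a"] w by (simp add: w_def)
    have xw: "w \<otimes> x = x \<otimes> w" unfolding wx by (intro group_commutes_pow) simp_all
    have "y \<otimes> w \<otimes> inv y = inv x \<otimes> (?z \<otimes> w \<otimes> ?z) \<otimes> x"
      using w by (simp add: half.inv_y_eq m_assoc)
    also have "\<dots> = w" unfolding zw using w by (simp add: m_assoc xw)
    finally have yw: "y \<otimes> w \<otimes> inv y \<in> generate G {w}" by (simp add: generate.incl)
    have "x \<otimes> w \<otimes> inv x = w" unfolding xw[symmetric] using w by (simp add: m_assoc)
    then have N1: "generate G {w} \<lhd> G" by (intro generate_normalI w yw) (simp add: generate.incl)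
    have N2: "card (generate G {w}) = m"
      unfolding wx using card_generate_prime[OF x_in, of m "p div m"] ord_x pm m2 by simp
    have 1: "x [^] (p div m) \<in> generate G {w}" unfolding wx by (simp add: generate.incl)
    have 2: "y [^] q \<in> generate G {w}" unfolding y_pow_q by (rule generate.one)
    have 3: "p div m * q * card (generate G {w}) = p * q" unfolding N2 using pm by simp
    have "m \<le> m ^ Suc a" using m2 self_le_power[of m "Suc a"] by simp
    then have 4: "p div m > 2" using pm(1) m2 by linarith
    have 5: "p div m < p" using m2 p_pos by simp
    obtain H :: "nat monoid" and f where H: "f \<in> hom G H" "tight_group H (f x) (f y) (p div m) q"
      "f ` carrier G = carrier H" "\<forall>g\<in>carrier G. f g = \<one>\<^bsub>H\<^esub> \<longleftrightarrow> g \<in> generate G {w}"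
      using tight_quotient[OF N1 _ q_pos 3 1 2] 4 by (metis gr_implies_not0 not_gr_zero)
    interpret H: tight_group H "f x" "f y" "p div m" q by fact
    interpret f: group_hom G H f by (intro group_hom.intro group_hom_axioms.intro is_group H.is_group H)
    have "twist H (f x) (f y) = \<one>\<^bsub>H\<^esub>"
      using reflexible_tight_twist[OF H(2) m \<open>odd m\<close> pm(1) q Hp[OF H(1,2) 4 5]] .
    then have "?u \<in> generate G {w}" using H(4) f.hom_twist[OF x_in y_in] half.u_closed by simp
    then obtain l :: int where "?u = w [^] l" using generate_singletonE[OF w] by blast
    then have "?u = x [^] (int (p div m) * l)" unfolding wx by (simp add: int_pow_pow flip: int_pow_int)
    moreover have "?u = y [^] (int (q div m) * n)" unfolding n h_def by (simp add: int_pow_pow flip: int_pow_int)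
    ultimately show False using x_pow_eq_y_pow[of "int (p div m) * l" "int (q div m) * n"] u1 by simp
  qed
  then have "b = \<beta>" using b by simp
  \<comment> \<open>Only n modulo m matters, since h has order m; the representative is nonzero
    because u is not 1.\<close>
  define k where "k = n mod int m"
  have "int (ord h) dvd k - n" unfolding ordh k_def by (metis dvd_minus_mod dvd_diff_commute)
  then have uk: "?u = h [^] k" using int_pow_eq[OF h] n by metis
  then have "k \<noteq> 0" using u1 by (intro notI) simp
  moreover have "0 \<le> k" "k < int m" unfolding k_def using m2 by simp_all
  moreover have "?u = y [^] (k * int m ^ \<beta>)"
    unfolding uk h_def qm(1) \<open>b = \<beta>\<close> by (simp add: int_pow_pow mult.commute flip: int_pow_int)
  ultimately show "\<exists>k::int. 1 \<le> k \<and> k \<le> int m - 1 \<and> ?u = y [^] (k * int m ^ \<beta>) \<and>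
    x \<otimes> inv ?u = ?u \<otimes> x"
    using xu by (intro exI[of _ k]) simp
qed

end

section \<open>The presented group\<close>

definition eval_word :: "('a, 'b) monoid_scheme \<Rightarrow> ('g \<Rightarrow> 'a) \<Rightarrow> 'g word \<Rightarrow> 'a" where
  "eval_word G f w = foldr (\<lambda>(g, b) a. (if b then f g else inv\<^bsub>G\<^esub> f g) \<otimes>\<^bsub>G\<^esub> a) w \<one>\<^bsub>G\<^esub>"

context group
begin

lemma eval_word_Nil [simp]: "eval_word G f [] = \<one>"
  by (simp add: eval_word_def)

lemma eval_word_Cons [simp]: "eval_word G f ((g, b) # w) = (if b then f g else inv f g) \<otimes> eval_word G f w"
  by (simp add: eval_word_def)

lemma eval_word_closed [simp]: "(\<And>g. f g \<in> carrier G) \<Longrightarrow> eval_word G f w \<in> carrier G"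
  by (induction w) auto

lemma eval_word_append:
  assumes "\<And>g. f g \<in> carrier G"
  shows "eval_word G f (v @ w) = eval_word G f v \<otimes> eval_word G f w"
  using assms by (induction v) (auto simp: m_assoc)

lemma eval_word_gen_pow:
  assumes "\<And>g. f g \<in> carrier G"
  shows "eval_word G f (gen_pow g n) = f g [^] n"
proof -
  have fg: "f g \<in> carrier G" using assms .
  have pos: "eval_word G f (replicate k (g, True)) = f g [^] k" for k :: nat
  proof (induction k)
    case (Suc k)
    then show ?case by (simp only: replicate_Suc eval_word_Cons if_True nat_pow_Suc2[OF fg])
  qed simp
  have neg: "eval_word G f (replicate k (g, False)) = inv f g [^] k" for k :: nat
  proof (induction k)
    case (Suc k)
    then show ?case by (simp only: replicate_Suc eval_word_Cons if_False nat_pow_Suc2[OF inv_closed[OF fg]])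
  qed simp
  show ?thesis
  proof (cases "n < 0")
    case True
    then have "gen_pow g n = replicate (nat (- n)) (g, False)" by (simp add: gen_pow_def)
    then show ?thesis unfolding int_pow_def2 if_P[OF True] using neg[of "nat (- n)"] fg by (simp add: nat_pow_inv)
  next
    case False
    then have "gen_pow g n = replicate (nat n) (g, True)" by (simp add: gen_pow_def)
    then show ?thesis unfolding int_pow_def2 if_not_P[OF False] using pos[of "nat n"] by simp
  qed
qed

lemma eval_word_respects:
  assumes f: "\<And>g. f g \<in> carrier G" and R: "\<And>v w. (v, w) \<in> R \<Longrightarrow> eval_word G f v = eval_word G f w"
    and "pres_eq R v w"
  shows "eval_word G f v = eval_word G f w"
  using assms(3)
proof (induction rule: pres_eq.induct)
  case (cong v v' w w')
  then show ?case using f by (simp add: eval_word_append)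
qed (use f R in auto)

text \<open>Von Dyck's theorem: evaluation of words respects the relations, so it factors through
  classes; \<open>h\<close> evaluates an arbitrary representative.\<close>

lemma presented_group_lift:
  assumes f: "\<And>g. f g \<in> carrier G" and R: "\<And>v w. (v, w) \<in> R \<Longrightarrow> eval_word G f v = eval_word G f w"
  shows "\<exists>h\<in>hom (presented_group R) G. \<forall>w. h (pres_class R w) = eval_word G f w"
proof -
  define h where "h A = eval_word G f (SOME w. A = pres_class R w)" for A
  have h: "h (pres_class R w) = eval_word G f w" for w
  proof -
    have "pres_class R w = pres_class R (SOME v. pres_class R w = pres_class R v)"
      by (rule someI[of _ w]) (rule HOL.refl)
    then have "pres_eq R w (SOME v. pres_class R w = pres_class R v)" by (simp only: pres_class_eq_iff)
    then have "eval_word G f w = eval_word G f (SOME v. pres_class R w = pres_class R v)"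
      by (rule eval_word_respects[rotated 2]) (use f R in blast)+
    then show ?thesis by (simp only: h_def)
  qed
  have "h \<in> hom (presented_group R) G"
  proof (rule homI)
    fix A B assume "A \<in> carrier (presented_group R)" "B \<in> carrier (presented_group R)"
    then obtain v w where vw: "A = pres_class R v" "B = pres_class R w" by (auto simp: presented_group_def)
    then show "h A \<in> carrier G" using h f by simp
    show "h (A \<otimes>\<^bsub>presented_group R\<^esub> B) = h A \<otimes> h B"
      unfolding vw mult_pres_class h using f by (simp add: eval_word_append)
  qed
  then show ?thesis using h by blast
qed

end

text \<open>Lets the lemmas on \<open>eval_word\<close> be applied inside the presented group, where
  they turn each relation between words into an equation between the classes of the
  generators.\<close>

lemma eval_word_presented:
  "eval_word (presented_group R) (\<lambda>g. pres_class R [(g, True)]) w = pres_class R w"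
proof -
  interpret group "presented_group R" by (rule group_presented_group)
  have cl: "pres_class R v \<in> carrier (presented_group R)" for v by (simp add: presented_group_def)
  have one: "\<one>\<^bsub>presented_group R\<^esub> = pres_class R []" by (simp add: presented_group_def)
  show ?thesis
  proof (induction w)
    case Nil
    then show ?case by (simp add: one)
  next
    case (Cons a w)
    obtain g b where a: "a = (g, b)" by (cases a)
    have "pres_class R [(g, False)] \<otimes>\<^bsub>presented_group R\<^esub> pres_class R [(g, True)] = \<one>\<^bsub>presented_group R\<^esub>"
      using pres_eq.cancel[of R g False] by (simp add: mult_pres_class one pres_class_eq_iff)
    then have "inv\<^bsub>presented_group R\<^esub> pres_class R [(g, True)] = pres_class R [(g, False)]"
      by (intro inv_equality cl)
    then show ?case unfolding a by (cases b) (simp_all add: Cons mult_pres_class)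
  qed
qed

context half_turn
begin

text \<open>Comparing the first relation with the identity \<open>inv_y_x\<close> forces v = u.
  Substituting this into the second and multiplying by z yields x u x = x^2 u^-1, so x inverts
  u.\<close>

lemma twist_relations:
  assumes v: "v \<in> carrier G"
    and r1: "inv y \<otimes> x = x \<otimes> (x \<otimes> (x \<otimes> (y \<otimes> v)))"
    and r2: "y \<otimes> inv x = inv x \<otimes> (inv x \<otimes> (inv x \<otimes> (inv y \<otimes> v)))"
  shows "v \<otimes> x = x \<otimes> inv v" "y \<otimes> (x \<otimes> x) = (x \<otimes> x) \<otimes> (y \<otimes> v)"
proof -
  have vu: "v = u" using r1 v unfolding inv_y_x by simp
  have "z \<otimes> (x \<otimes> u) = x \<otimes> (x \<otimes> (x \<otimes> (y \<otimes> inv x)))"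
    unfolding r2 inv_y_eq vu by (simp add: m_assoc)
  then have "z \<otimes> (x \<otimes> u) \<otimes> x = x \<otimes> (x \<otimes> (x \<otimes> (y \<otimes> inv x))) \<otimes> x" by simp
  then have "z \<otimes> (x \<otimes> (u \<otimes> x)) = x \<otimes> (x \<otimes> z)" by (simp add: m_assoc z_eq)
  then have "z \<otimes> (z \<otimes> (x \<otimes> (u \<otimes> x))) = z \<otimes> (x \<otimes> (x \<otimes> z))" by simp
  then have "x \<otimes> (u \<otimes> x) = x \<otimes> (x \<otimes> inv u)" unfolding conj_z_x2 by (simp add: z_z)
  then show "v \<otimes> x = x \<otimes> inv v" unfolding vu by simp
  have "x \<otimes> (y \<otimes> (x \<otimes> x)) = inv y \<otimes> x" unfolding inv_y_eq by (simp add: z_eq m_assoc)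
  then have "x \<otimes> (y \<otimes> (x \<otimes> x)) = x \<otimes> ((x \<otimes> x) \<otimes> (y \<otimes> v))" unfolding r1 using v by (simp add: m_assoc)
  then show "y \<otimes> (x \<otimes> x) = (x \<otimes> x) \<otimes> (y \<otimes> v)" using v by simp
qed

text \<open>With v = y^c and a = x^2 the hypotheses give y a^k = a^k v^k y. For even i this already
  brings y to the right; for odd i the leftover y x becomes x^-1 y^-1, and v^k crosses x^-1 as v^-k.
  The lemma serves to bound the order of the presented group, whose elements are a priori arbitrary
  words.\<close>

lemma y_mult_normal_form:
  fixes i j c :: int
  assumes vx: "y [^] c \<otimes> x = x \<otimes> inv (y [^] c)" and ya: "y \<otimes> (x \<otimes> x) = (x \<otimes> x) \<otimes> (y \<otimes> y [^] c)"
  shows "\<exists>(k::int) (l::int). y \<otimes> (x [^] i \<otimes> y [^] j) = x [^] k \<otimes> y [^] l"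
proof -
  define v where "v = y [^] c"
  define a where "a = x \<otimes> x"
  have cl [simp]: "v \<in> carrier G" "a \<in> carrier G" by (simp_all add: v_def a_def)
  have vy: "v \<otimes> y = y \<otimes> v" unfolding v_def by (intro int_pow_commute) simp_all
  have xv: "x \<otimes> v \<otimes> inv x = inv v"
  proof -
    have "inv (v \<otimes> x) = inv (x \<otimes> inv v)" using vx v_def by simp
    then have "inv x \<otimes> inv v = v \<otimes> inv x" by (simp add: inv_mult_group)
    then have "x \<otimes> (inv x \<otimes> inv v) = x \<otimes> (v \<otimes> inv x)" by simp
    then show ?thesis by (simp add: m_assoc)
  qed
  have av: "a \<otimes> v = v \<otimes> a"
  proof -
    have "v \<otimes> a = v \<otimes> x \<otimes> x" by (simp add: a_def m_assoc)
    also have "\<dots> = x \<otimes> (inv v \<otimes> x)" using vx by (simp add: v_def m_assoc)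
    also have "\<dots> = x \<otimes> (x \<otimes> v)" unfolding xv[symmetric] by (simp add: m_assoc)
    finally show ?thesis by (simp add: a_def m_assoc)
  qed
  have "y \<otimes> a \<otimes> inv y = a \<otimes> (y \<otimes> v) \<otimes> inv y" using ya by (simp add: a_def v_def)
  also have "\<dots> = a \<otimes> v" unfolding vy[symmetric] by (simp add: m_assoc)
  finally have yay: "y \<otimes> a \<otimes> inv y = a \<otimes> v" .
  have yak: "y \<otimes> a [^] k = a [^] k \<otimes> (v [^] k \<otimes> y)" for k :: int
  proof -
    have "y \<otimes> a [^] k \<otimes> inv y = (a \<otimes> v) [^] k"
      unfolding conj_int_pow[OF y_closed cl(2), symmetric] yay ..
    also have "\<dots> = a [^] k \<otimes> v [^] k" by (rule int_pow_mult_distrib[OF av]) simp_all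
    finally have "y \<otimes> a [^] k \<otimes> inv y \<otimes> y = a [^] k \<otimes> v [^] k \<otimes> y" by simp
    then show ?thesis by (simp add: m_assoc)
  qed
  have x2: "x [^] (2 * k) = a [^] k" for k :: int
    using int_pow_pow[OF x_closed, of 2 k] int_pow_mult[OF x_closed, of 1 1] by (simp add: a_def)
  have vk: "v [^] k = y [^] (c * k)" for k :: int by (simp add: v_def int_pow_pow)
  show ?thesis
  proof (cases "even i")
    case True
    then obtain k where k: "i = 2 * k" by (rule evenE)
    have "y \<otimes> (x [^] i \<otimes> y [^] j) = (y \<otimes> a [^] k) \<otimes> y [^] j" by (simp add: k x2 m_assoc)
    also have "\<dots> = x [^] (2 * k) \<otimes> y [^] (c * k + 1 + j)"
      unfolding yak x2 vk int_pow_mult[OF y_closed] by (simp add: m_assoc)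
    finally show ?thesis by blast
  next
    case False
    then obtain k where k: "i = 2 * k + 1" by (rule oddE)
    have yx: "y \<otimes> x = inv x \<otimes> inv y" unfolding inv_y_eq by (simp add: z_eq m_assoc)
    have "x \<otimes> v [^] k \<otimes> inv x = inv v [^] k"
      unfolding conj_int_pow[OF x_closed cl(1), symmetric] xv ..
    then have "inv x \<otimes> (x \<otimes> v [^] k \<otimes> inv x) = inv x \<otimes> inv v [^] k" by simp
    then have "v [^] k \<otimes> inv x = inv x \<otimes> v [^] (- k)"
      by (simp add: m_assoc int_pow_inv flip: int_pow_neg)
    then have vkx: "v [^] k \<otimes> inv x = inv x \<otimes> y [^] (c * (- k))" by (simp only: vk)
    have "y \<otimes> (x [^] i \<otimes> y [^] j) = (y \<otimes> a [^] k) \<otimes> x \<otimes> y [^] j"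
      by (simp add: k x2 m_assoc int_pow_mult)
    also have "\<dots> = a [^] k \<otimes> (v [^] k \<otimes> (y \<otimes> x)) \<otimes> y [^] j" unfolding yak by (simp add: m_assoc)
    also have "\<dots> = a [^] k \<otimes> ((v [^] k \<otimes> inv x) \<otimes> inv y) \<otimes> y [^] j" unfolding yx by (simp add: m_assoc)
    also have "\<dots> = x [^] (2 * k + - 1) \<otimes> y [^] (c * (- k) + - 1 + j)"
      unfolding vkx int_pow_mult[OF y_closed] int_pow_mult[OF x_closed] x2 by (simp add: m_assoc int_pow_neg)
    finally show ?thesis by blast
  qed
qed

end

context tight_group
begin

text \<open>Von Dyck's theorem gives a surjection onto G. In the presented group the normal forms
  X^i Y^j exhaust everything, so its order is at most pq, the order of G, and the surjection is
  injective.\<close>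

lemma presented_group_iso:
  fixes c :: int
  assumes r1: "inv y \<otimes> x = x [^] (3::int) \<otimes> y [^] (1 + c)"
    and r2: "y \<otimes> inv x = x [^] (- 3 :: int) \<otimes> y [^] (- 1 + c)"
    and R_def: "R = Gamma_rels (int p) (int q) 3 (1 + c) (- 3) (- 1 + c)"
  shows "\<exists>h\<in>iso (presented_group R) G. h (pres_class R [(S1, True)]) = x \<and> h (pres_class R [(S2, True)]) = y"
proof -
  define \<Gamma> where "\<Gamma> = presented_group R"
  define X where "X = pres_class R [(S1, True)]"
  define Y where "Y = pres_class R [(S2, True)]"
  interpret \<Gamma>: group \<Gamma> unfolding \<Gamma>_def by (rule group_presented_group)
  have XY [simp]: "X \<in> carrier \<Gamma>" "Y \<in> carrier \<Gamma>" by (simp_all add: X_def Y_def \<Gamma>_def presented_group_def)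
  define f where "f g = (case g of S1 \<Rightarrow> x | S2 \<Rightarrow> y)" for g
  have f [simp]: "f g \<in> carrier G" "f S1 = x" "f S2 = y" for g by (simp_all add: f_def split: gen.split)
  note ev = eval_word_append[of f, OF f(1)] eval_word_gen_pow[of f, OF f(1)]
  have xp: "x [^] int p = \<one>" "y [^] int q = \<one>" by (simp_all add: int_pow_int x_pow_p y_pow_q)
  have "eval_word G f v = eval_word G f w" if "(v, w) \<in> R" for v w
    using that r1 r2 xy_square unfolding R_def Gamma_rels_def
    by (auto simp: ev xp int_pow_neg m_assoc)
  then obtain h where h: "h \<in> hom \<Gamma> G" "\<And>w. h (pres_class R w) = eval_word G f w"
    using presented_group_lift[of f R] f(1) unfolding \<Gamma>_def by metis
  interpret h: group_hom \<Gamma> G h by (intro group_hom.intro group_hom_axioms.intro is_group \<Gamma>.is_group h(1))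
  have hXY: "h X = x" "h Y = y" by (simp_all add: X_def Y_def h(2))
  define F where "F = (\<lambda>g. pres_class R [(g, True)])"
  have F: "F g \<in> carrier \<Gamma>" "F S1 = X" "F S2 = Y" for g
    by (simp_all add: F_def X_def Y_def \<Gamma>_def presented_group_def)
  note EV = \<Gamma>.eval_word_append[of F, OF F(1)] \<Gamma>.eval_word_gen_pow[of F, OF F(1)]
  have rel: "eval_word \<Gamma> F v = eval_word \<Gamma> F w" if "(v, w) \<in> R" for v w
    unfolding \<Gamma>_def F_def eval_word_presented pres_class_eq_iff using that by (rule pres_eq.relation)
  have Xp: "X [^]\<^bsub>\<Gamma>\<^esub> p = \<one>\<^bsub>\<Gamma>\<^esub>" and Yq: "Y [^]\<^bsub>\<Gamma>\<^esub> q = \<one>\<^bsub>\<Gamma>\<^esub>"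
    using rel[of "gen_pow S1 (int p)" "[]"] rel[of "gen_pow S2 (int q)" "[]"]
    by (simp_all add: EV F R_def Gamma_rels_def int_pow_int)
  have inv: "(X \<otimes>\<^bsub>\<Gamma>\<^esub> Y) \<otimes>\<^bsub>\<Gamma>\<^esub> (X \<otimes>\<^bsub>\<Gamma>\<^esub> Y) = \<one>\<^bsub>\<Gamma>\<^esub>"
    using rel[of "gen_pow S1 1 @ gen_pow S2 1 @ gen_pow S1 1 @ gen_pow S2 1" "[]"]
    by (simp add: EV F R_def Gamma_rels_def \<Gamma>.m_assoc)
  have R1: "inv\<^bsub>\<Gamma>\<^esub> Y \<otimes>\<^bsub>\<Gamma>\<^esub> X = X [^]\<^bsub>\<Gamma>\<^esub> (3::int) \<otimes>\<^bsub>\<Gamma>\<^esub> Y [^]\<^bsub>\<Gamma>\<^esub> (1 + c)"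
    using rel[of "gen_pow S2 (- 1) @ gen_pow S1 1" "gen_pow S1 3 @ gen_pow S2 (1 + c)"]
    by (simp add: EV F R_def Gamma_rels_def \<Gamma>.int_pow_neg)
  have R2: "Y \<otimes>\<^bsub>\<Gamma>\<^esub> inv\<^bsub>\<Gamma>\<^esub> X = X [^]\<^bsub>\<Gamma>\<^esub> (- 3::int) \<otimes>\<^bsub>\<Gamma>\<^esub> Y [^]\<^bsub>\<Gamma>\<^esub> (- 1 + c)"
    using rel[of "gen_pow S2 1 @ gen_pow S1 (- 1)" "gen_pow S1 (- 3) @ gen_pow S2 (- 1 + c)"]
    by (simp add: EV F R_def Gamma_rels_def \<Gamma>.int_pow_neg)
  interpret H: half_turn \<Gamma> X Y "X \<otimes>\<^bsub>\<Gamma>\<^esub> Y" "twist \<Gamma> X Y"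
    by unfold_locales (simp_all add: inv twist_def)
  have X3: "X [^]\<^bsub>\<Gamma>\<^esub> (3::int) = X \<otimes>\<^bsub>\<Gamma>\<^esub> (X \<otimes>\<^bsub>\<Gamma>\<^esub> X)"
    using \<Gamma>.int_pow_mult[OF XY(1), of 1 2] \<Gamma>.int_pow_mult[OF XY(1), of 1 1] by simp
  have X3': "X [^]\<^bsub>\<Gamma>\<^esub> (- 3::int) = inv\<^bsub>\<Gamma>\<^esub> X \<otimes>\<^bsub>\<Gamma>\<^esub> (inv\<^bsub>\<Gamma>\<^esub> X \<otimes>\<^bsub>\<Gamma>\<^esub> inv\<^bsub>\<Gamma>\<^esub> X)"
    unfolding \<Gamma>.int_pow_neg[OF XY(1)] X3 by (simp add: \<Gamma>.inv_mult_group \<Gamma>.m_assoc)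
  have Yc: "Y [^]\<^bsub>\<Gamma>\<^esub> (1 + c) = Y \<otimes>\<^bsub>\<Gamma>\<^esub> Y [^]\<^bsub>\<Gamma>\<^esub> c" "Y [^]\<^bsub>\<Gamma>\<^esub> (- 1 + c) = inv\<^bsub>\<Gamma>\<^esub> Y \<otimes>\<^bsub>\<Gamma>\<^esub> Y [^]\<^bsub>\<Gamma>\<^esub> c"
    unfolding \<Gamma>.int_pow_mult[OF XY(2)] by (simp_all add: \<Gamma>.int_pow_neg)
  note tw = H.twist_relations[of "Y [^]\<^bsub>\<Gamma>\<^esub> c"]
  have tw: "Y [^]\<^bsub>\<Gamma>\<^esub> c \<otimes>\<^bsub>\<Gamma>\<^esub> X = X \<otimes>\<^bsub>\<Gamma>\<^esub> inv\<^bsub>\<Gamma>\<^esub> (Y [^]\<^bsub>\<Gamma>\<^esub> c)"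
    "Y \<otimes>\<^bsub>\<Gamma>\<^esub> (X \<otimes>\<^bsub>\<Gamma>\<^esub> X) = (X \<otimes>\<^bsub>\<Gamma>\<^esub> X) \<otimes>\<^bsub>\<Gamma>\<^esub> (Y \<otimes>\<^bsub>\<Gamma>\<^esub> Y [^]\<^bsub>\<Gamma>\<^esub> c)"
    using R1 R2 unfolding X3 X3' Yc by (intro tw; simp add: \<Gamma>.m_assoc)+
  define NF where "NF A \<longleftrightarrow> (\<exists>(i::int) (j::int). A = X [^]\<^bsub>\<Gamma>\<^esub> i \<otimes>\<^bsub>\<Gamma>\<^esub> Y [^]\<^bsub>\<Gamma>\<^esub> j)" for A
  have NFX: "NF (X [^]\<^bsub>\<Gamma>\<^esub> k \<otimes>\<^bsub>\<Gamma>\<^esub> A)" if A: "NF A" for A and k :: int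
  proof -
    obtain i j :: int where ij: "A = X [^]\<^bsub>\<Gamma>\<^esub> i \<otimes>\<^bsub>\<Gamma>\<^esub> Y [^]\<^bsub>\<Gamma>\<^esub> j" using A unfolding NF_def by blast
    have "X [^]\<^bsub>\<Gamma>\<^esub> k \<otimes>\<^bsub>\<Gamma>\<^esub> A = X [^]\<^bsub>\<Gamma>\<^esub> (k + i) \<otimes>\<^bsub>\<Gamma>\<^esub> Y [^]\<^bsub>\<Gamma>\<^esub> j"
      unfolding ij \<Gamma>.int_pow_mult[OF XY(1)] by (simp add: \<Gamma>.m_assoc)
    then show ?thesis unfolding NF_def by blast
  qed
  have NFY: "NF (Y \<otimes>\<^bsub>\<Gamma>\<^esub> A)" if A: "NF A" for A
    using A H.y_mult_normal_form[OF tw] unfolding NF_def by metis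
  \<comment> \<open>Inverse letters of Y are treated as nonnegative powers, which Y^q = 1 makes
    possible, since \<open>H.y_mult_normal_form\<close> speaks of left multiplication by Y
    itself.\<close>
  have NFYn: "NF (Y [^]\<^bsub>\<Gamma>\<^esub> n \<otimes>\<^bsub>\<Gamma>\<^esub> A)" if A: "NF A" "A \<in> carrier \<Gamma>" for A and n :: nat
  proof (induction n)
    case (Suc n)
    have "Y [^]\<^bsub>\<Gamma>\<^esub> Suc n \<otimes>\<^bsub>\<Gamma>\<^esub> A = Y \<otimes>\<^bsub>\<Gamma>\<^esub> (Y [^]\<^bsub>\<Gamma>\<^esub> n \<otimes>\<^bsub>\<Gamma>\<^esub> A)"
      unfolding \<Gamma>.nat_pow_Suc2[OF XY(2)] using A(2) by (simp add: \<Gamma>.m_assoc)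
    then show ?case using NFY[OF Suc] by simp
  qed (use A in simp)
  have NFw: "NF (eval_word \<Gamma> F w)" for w
  proof (induction w)
    case Nil
    have "\<one>\<^bsub>\<Gamma>\<^esub> = X [^]\<^bsub>\<Gamma>\<^esub> (0::int) \<otimes>\<^bsub>\<Gamma>\<^esub> Y [^]\<^bsub>\<Gamma>\<^esub> (0::int)" by simp
    then show ?case unfolding NF_def by (auto simp del: int_pow_0)
  next
    case (Cons s w)
    obtain g b where s: "s = (g, b)" by (cases s)
    have c: "eval_word \<Gamma> F w \<in> carrier \<Gamma>" using F(1) by simp
    have e: "eval_word \<Gamma> F (s # w) = F g [^]\<^bsub>\<Gamma>\<^esub> (if b then 1 else - 1 :: int) \<otimes>\<^bsub>\<Gamma>\<^esub> eval_word \<Gamma> F w"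
      using F(1) by (simp add: s \<Gamma>.int_pow_neg)
    show ?case
    proof (cases g)
      case S1
      then show ?thesis unfolding e using NFX[OF Cons] F by simp
    next
      case S2
      then show ?thesis
        unfolding e using NFYn[OF Cons c] F \<Gamma>.int_pow_eq_nat_pow[OF XY(2) Yq q_pos] by simp
    qed
  qed
  let ?I = "{..<p} \<times> {..<q}" and ?n = "\<lambda>(i, j). X [^]\<^bsub>\<Gamma>\<^esub> i \<otimes>\<^bsub>\<Gamma>\<^esub> Y [^]\<^bsub>\<Gamma>\<^esub> j"
  have sub: "carrier \<Gamma> \<subseteq> ?n ` ?I"
  proof
    fix A assume "A \<in> carrier \<Gamma>"
    then obtain w where "A = pres_class R w" by (auto simp: \<Gamma>_def presented_group_def)
    then have "NF A" using NFw[of w] eval_word_presented[of R w] by (simp add: \<Gamma>_def F_def)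
    then obtain i j :: int where "A = X [^]\<^bsub>\<Gamma>\<^esub> i \<otimes>\<^bsub>\<Gamma>\<^esub> Y [^]\<^bsub>\<Gamma>\<^esub> j" unfolding NF_def by blast
    then have "A = ?n (nat (i mod int p), nat (j mod int q))"
      using \<Gamma>.int_pow_eq_nat_pow[OF XY(1) Xp p_pos] \<Gamma>.int_pow_eq_nat_pow[OF XY(2) Yq q_pos] by simp
    moreover have "(nat (i mod int p), nat (j mod int q)) \<in> ?I"
      using p_pos q_pos by (simp add: nat_less_iff)
    ultimately show "A \<in> ?n ` ?I" by (rule image_eqI)
  qed
  have fin: "finite (carrier \<Gamma>)" using finite_subset[OF sub] by simp
  have "card (carrier \<Gamma>) \<le> card ?I" using surj_card_le[OF _ sub] by simp
  then have le: "card (carrier \<Gamma>) \<le> card (carrier G)" by (simp add: card_carrier card_cartesian_product)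
  have surj: "h ` carrier \<Gamma> = carrier G"
  proof
    show "carrier G \<subseteq> h ` carrier \<Gamma>"
    proof
      fix g assume "g \<in> carrier G"
      then obtain i j :: nat where "g = x [^] i \<otimes> y [^] j" using normal_form by metis
      then have "g = h (X [^]\<^bsub>\<Gamma>\<^esub> i \<otimes>\<^bsub>\<Gamma>\<^esub> Y [^]\<^bsub>\<Gamma>\<^esub> j)" by (simp add: h.hom_nat_pow hXY)
      then show "g \<in> h ` carrier \<Gamma>" by (rule image_eqI) simp
    qed
  qed (use h.hom_closed in blast)
  then have "card (h ` carrier \<Gamma>) = card (carrier \<Gamma>)" using le card_image_le[OF fin, of h] by simp
  then have "inj_on h (carrier \<Gamma>)" using fin by (simp add: eq_card_imp_inj_on)
  then have "h \<in> iso \<Gamma> G" using h(1) surj by (simp add: iso_def bij_betw_def)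
  then show ?thesis using hXY unfolding X_def Y_def \<Gamma>_def by blast
qed

end

section \<open>Polyhedra whose flags are labelled by a group\<close>

text \<open>Two copies of G label the flags, one copy for each class; \<open>Fm g\<close> is the
  flag differing from \<open>Fp g\<close> in its face. Adjacency multiplies labels on the left, so
  right multiplication of labels commutes with it, and this is how G acts by automorphisms. Both the
  given chiral polyhedron and the coset polyhedra are treated through this locale.\<close>

locale rotary_flags = poly P + tight_group G x y p q
  for P :: "'a ranked_poset" and G (structure) and x y and p q :: nat +
  fixes Fp Fm :: "'b \<Rightarrow> 'a flag"
  assumes flags_eq: "flags P = Fp ` carrier G \<union> Fm ` carrier G"
    and inj_Fp: "inj_on Fp (carrier G)" and inj_Fm: "inj_on Fm (carrier G)"
    and disjoint: "g \<in> carrier G \<Longrightarrow> h \<in> carrier G \<Longrightarrow> Fp g \<noteq> Fm h"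
    and adj_Fp: "g \<in> carrier G \<Longrightarrow> flag_adj P (Fp g) 0 = Fm ((x \<otimes> y) \<otimes> g)"
      "g \<in> carrier G \<Longrightarrow> flag_adj P (Fp g) 1 = Fm (inv y \<otimes> g)"
      "g \<in> carrier G \<Longrightarrow> flag_adj P (Fp g) 2 = Fm g"
begin

lemma Fp_in_flags: "g \<in> carrier G \<Longrightarrow> Fp g \<in> flags P"
  and Fm_in_flags: "g \<in> carrier G \<Longrightarrow> Fm g \<in> flags P"
  using flags_eq by auto

lemma adj_Fm:
  assumes g: "g \<in> carrier G"
  shows "flag_adj P (Fm g) 0 = Fp ((x \<otimes> y) \<otimes> g)"
    "flag_adj P (Fm g) 1 = Fp (y \<otimes> g)" "flag_adj P (Fm g) 2 = Fp g"
proof -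
  have a: "flag_adj P (flag_adj P (Fp h) i) i = Fp h" if "h \<in> carrier G" "i \<in> {0, 1, 2}" for h i
    using flag_adj_adj[OF Fp_in_flags[OF that(1)] that(2)] .
  have "(x \<otimes> y) \<otimes> ((x \<otimes> y) \<otimes> g) = g" using half.z_z[OF g] .
  then show "flag_adj P (Fm g) 0 = Fp ((x \<otimes> y) \<otimes> g)"
    using a[of "(x \<otimes> y) \<otimes> g" 0] adj_Fp(1)[of "(x \<otimes> y) \<otimes> g"] g by simp
  show "flag_adj P (Fm g) 1 = Fp (y \<otimes> g)"
    using a[of "y \<otimes> g" 1] adj_Fp(2)[of "y \<otimes> g"] g by simp
  show "flag_adj P (Fm g) 2 = Fp g" using a[of g 2] adj_Fp(3)[of g] g by simp
qed

lemma z_inv_y: "g \<in> carrier G \<Longrightarrow> (x \<otimes> y) \<otimes> (inv y \<otimes> g) = x \<otimes> g"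
  by (simp add: m_assoc)

text \<open>An automorphism sending the base flag to its 1-adjacent flag reverses the sense of
  rotation about both the base face and the base vertex. Since it commutes with adjacency, it turns
  steps by x and y into steps by their inverses, and \<open>t\<close> is its effect on
  labels.\<close>

lemma reflexible_of_transitive:
  assumes "transitive_on_flags P (flags P)"
  shows "reflexible G x y"
proof -
  obtain r where r: "r \<in> automorphisms P" "flag_map r (Fp \<one>) = Fm (inv y \<otimes> \<one>)"
    using assms Fp_in_flags[of \<one>] Fm_in_flags[of "inv y \<otimes> \<one>"] unfolding transitive_on_flags_def by auto
  have yz: "(x \<otimes> y) \<otimes> k = inv y \<otimes> (inv x \<otimes> k)" if "k \<in> carrier G" for k
    using half.inv_z that by (simp add: inv_mult_group flip: m_assoc)
  have comm: "flag_map r (flag_adj P \<Psi> i) = flag_adj P (flag_map r \<Psi>) i"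
    if "\<Psi> \<in> flags P" "i \<in> {0, 1, 2}" for \<Psi> i
    using flag_adj_flag_map[OF r(1) that] by simp
  have rx: "flag_map r (Fp (x \<otimes> g)) = Fm (inv y \<otimes> (inv x \<otimes> k))"
    if "g \<in> carrier G" "k \<in> carrier G" "flag_map r (Fp g) = Fm (inv y \<otimes> k)" for g k
  proof -
    have "Fp (x \<otimes> g) = flag_adj P (flag_adj P (Fp g) 1) 0"
      using that(1) adj_Fp(2)[of g] adj_Fm(1)[of "inv y \<otimes> g"] z_inv_y[of g] by simp
    then have "flag_map r (Fp (x \<otimes> g)) = flag_adj P (flag_adj P (flag_map r (Fp g)) 1) 0"
      using comm[of "Fp g" 1] comm[of "flag_adj P (Fp g) 1" 0] Fp_in_flags[OF that(1)]
        flag_adj_in_flags[OF Fp_in_flags[OF that(1)], of 1] by simp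
    also have "\<dots> = Fm ((x \<otimes> y) \<otimes> k)"
      using that(2,3) adj_Fm(2)[of "inv y \<otimes> k"] adj_Fp(1)[of k] by simp
    finally show ?thesis using yz[OF that(2)] by simp
  qed
  have ry: "flag_map r (Fp (y \<otimes> g)) = Fm (inv y \<otimes> (inv y \<otimes> k))"
    if "g \<in> carrier G" "k \<in> carrier G" "flag_map r (Fp g) = Fm (inv y \<otimes> k)" for g k
  proof -
    have "Fp (y \<otimes> g) = flag_adj P (flag_adj P (Fp g) 2) 1"
      using that(1) adj_Fp(3)[of g] adj_Fm(2)[of g] by simp
    then have "flag_map r (Fp (y \<otimes> g)) = flag_adj P (flag_adj P (flag_map r (Fp g)) 2) 1"
      using comm[of "Fp g" 2] comm[of "flag_adj P (Fp g) 2" 1] Fp_in_flags[OF that(1)]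
        flag_adj_in_flags[OF Fp_in_flags[OF that(1)], of 2] by simp
    also have "\<dots> = Fm (inv y \<otimes> (inv y \<otimes> k))"
      using that(2,3) adj_Fm(3)[of "inv y \<otimes> k"] adj_Fp(2)[of "inv y \<otimes> k"] by simp
    finally show ?thesis .
  qed
  have ex: "\<exists>k\<in>carrier G. flag_map r (Fp g) = Fm (inv y \<otimes> k)" if "g \<in> carrier G" for g
    using that
  proof (induction rule: carrier_induct)
    case one
    then show ?case using r(2) by blast
  next
    case (x g)
    then show ?case using rx by (metis inv_closed m_closed x_in)
  next
    case (y g)
    then show ?case using ry by (metis inv_closed m_closed y_in)
  qed
  define t where "t g = (SOME k. k \<in> carrier G \<and> flag_map r (Fp g) = Fm (inv y \<otimes> k))" for g
  have t: "t g \<in> carrier G \<and> flag_map r (Fp g) = Fm (inv y \<otimes> t g)" if "g \<in> carrier G" for g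
    unfolding t_def using someI_ex[of "\<lambda>k. k \<in> carrier G \<and> flag_map r (Fp g) = Fm (inv y \<otimes> k)"] ex[OF that] by blast
  have t_eq: "t g = k" if "g \<in> carrier G" "k \<in> carrier G" "flag_map r (Fp g) = Fm (inv y \<otimes> k)" for g k
  proof -
    have "Fm (inv y \<otimes> t g) = Fm (inv y \<otimes> k)" using t[OF that(1)] that(3) by simp
    then have "inv y \<otimes> t g = inv y \<otimes> k"
      using t[OF that(1)] that(2) by (intro inj_onD[OF inj_Fm]) simp_all
    then show ?thesis using t[OF that(1)] that(2) by simp
  qed
  have "t \<one> = \<one>" by (rule t_eq) (simp_all add: r(2)[simplified])
  moreover have "t g \<in> carrier G \<and> t (x \<otimes> g) = inv x \<otimes> t g \<and> t (y \<otimes> g) = inv y \<otimes> t g"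
    if "g \<in> carrier G" for g
    using t[OF that] rx[OF that, of "t g"] ry[OF that, of "t g"] that
      t_eq[of "x \<otimes> g" "inv x \<otimes> t g"] t_eq[of "y \<otimes> g" "inv y \<otimes> t g"] by simp
  ultimately show ?thesis unfolding reflexible_def by blast
qed

section \<open>Automorphisms built from maps of labels\<close>

definition lift :: "('b \<Rightarrow> 'a flag) \<Rightarrow> ('b \<Rightarrow> 'a flag) \<Rightarrow> 'a flag \<Rightarrow> 'a flag" where
  "lift A B \<Psi> = (if \<Psi> \<in> Fp ` carrier G then A (inv_into (carrier G) Fp \<Psi>) else B (inv_into (carrier G) Fm \<Psi>))"

lemma lift_Fp: "g \<in> carrier G \<Longrightarrow> lift A B (Fp g) = A g"
  by (simp add: lift_def inj_Fp)

lemma lift_Fm: "g \<in> carrier G \<Longrightarrow> lift A B (Fm g) = B g"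
proof -
  assume g: "g \<in> carrier G"
  then have "Fm g \<notin> Fp ` carrier G" using disjoint by fastforce
  then show ?thesis using g by (simp add: lift_def inj_Fm)
qed

text \<open>The pair is subject to the adjacency rules of \<open>Fp\<close> and \<open>Fm\<close>,
  which is what makes \<open>lift\<close> commute with adjacency on all flags.\<close>

definition flag_system :: "('b \<Rightarrow> 'a flag) \<Rightarrow> ('b \<Rightarrow> 'a flag) \<Rightarrow> bool" where
  "flag_system A B \<longleftrightarrow> (\<forall>g\<in>carrier G. A g \<in> flags P \<and> B g \<in> flags P \<and>
    flag_adj P (A g) 0 = B ((x \<otimes> y) \<otimes> g) \<and> flag_adj P (A g) 1 = B (inv y \<otimes> g) \<and> flag_adj P (A g) 2 = B g)"

lemma lift_system:
  assumes "flag_system A B" "\<Psi> \<in> flags P"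
  shows "lift A B \<Psi> \<in> flags P"
    "i \<in> {0, 1, 2} \<Longrightarrow> lift A B (flag_adj P \<Psi> i) = flag_adj P (lift A B \<Psi>) i"
proof -
  note S = assms(1)[unfolded flag_system_def, rule_format]
  have BA: "flag_adj P (B g) 0 = A ((x \<otimes> y) \<otimes> g)" "flag_adj P (B g) 1 = A (y \<otimes> g)" "flag_adj P (B g) 2 = A g"
    if g: "g \<in> carrier G" for g
  proof -
    have a: "flag_adj P (flag_adj P (A h) i) i = A h" if "h \<in> carrier G" "i \<in> {0, 1, 2}" for h i
      using flag_adj_adj[of "A h" i] S[OF that(1)] that(2) by blast
    have "(x \<otimes> y) \<otimes> ((x \<otimes> y) \<otimes> g) = g" using half.z_z[OF g] .
    then show "flag_adj P (B g) 0 = A ((x \<otimes> y) \<otimes> g)"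
      using a[of "(x \<otimes> y) \<otimes> g" 0] S[of "(x \<otimes> y) \<otimes> g"] g by simp
    show "flag_adj P (B g) 1 = A (y \<otimes> g)" using a[of "y \<otimes> g" 1] S[of "y \<otimes> g"] g by simp
    show "flag_adj P (B g) 2 = A g" using a[of g 2] S[of g] g by simp
  qed
  consider g where "g \<in> carrier G" "\<Psi> = Fp g" | g where "g \<in> carrier G" "\<Psi> = Fm g"
    using assms(2) flags_eq by auto
  then have "lift A B \<Psi> \<in> flags P \<and> (\<forall>i\<in>{0, 1, 2}. lift A B (flag_adj P \<Psi> i) = flag_adj P (lift A B \<Psi>) i)"
  proof cases
    case 1
    then show ?thesis using S[OF 1(1)] adj_Fp[OF 1(1)] by (simp add: lift_Fp lift_Fm)
  next
    case 2
    then show ?thesis using S[OF 2(1)] adj_Fm[OF 2(1)] BA[OF 2(1)] by (simp add: lift_Fp lift_Fm)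
  qed
  then show "lift A B \<Psi> \<in> flags P"
    "i \<in> {0, 1, 2} \<Longrightarrow> lift A B (flag_adj P \<Psi> i) = flag_adj P (lift A B \<Psi>) i" by blast+
qed

text \<open>The second system supplies the inverse required by
  \<open>automorphism_of_flag_bijection\<close>.\<close>

lemma automorphism_of_systems:
  assumes S: "flag_system A B" "flag_system A' B'"
    and inv: "\<And>g. g \<in> carrier G \<Longrightarrow> lift A' B' (A g) = Fp g" "\<And>g. g \<in> carrier G \<Longrightarrow> lift A' B' (B g) = Fm g"
      "\<And>g. g \<in> carrier G \<Longrightarrow> lift A B (A' g) = Fp g" "\<And>g. g \<in> carrier G \<Longrightarrow> lift A B (B' g) = Fm g"
  shows "\<exists>r\<in>automorphisms P. \<forall>g\<in>carrier G. flag_map r (Fp g) = A g \<and> flag_map r (Fm g) = B g"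
proof -
  have fl: "\<exists>g\<in>carrier G. \<Psi> = Fp g \<or> \<Psi> = Fm g" if "\<Psi> \<in> flags P" for \<Psi>
    using that flags_eq by auto
  have "\<exists>r\<in>automorphisms P. \<forall>\<Psi>\<in>flags P. flag_map r \<Psi> = lift A B \<Psi>"
  proof (rule automorphism_of_flag_bijection[of "Fp \<one>" "lift A B" "lift A' B'"])
    show "Fp \<one> \<in> flags P" by (rule Fp_in_flags[OF one_closed])
    fix \<Psi> and i :: nat assume P: "\<Psi> \<in> flags P"
    show "lift A B \<Psi> \<in> flags P" "lift A' B' \<Psi> \<in> flags P"
      using lift_system(1)[OF S(1) P] lift_system(1)[OF S(2) P] .
    obtain g where g: "g \<in> carrier G" "\<Psi> = Fp g \<or> \<Psi> = Fm g" using fl[OF P] by blast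
    show "lift A' B' (lift A B \<Psi>) = \<Psi>" using g(2) lift_Fp[OF g(1)] lift_Fm[OF g(1)] inv[OF g(1)] by metis
    show "lift A B (lift A' B' \<Psi>) = \<Psi>" using g(2) lift_Fp[OF g(1)] lift_Fm[OF g(1)] inv[OF g(1)] by metis
    assume i: "i \<in> {0, 1, 2}"
    show "lift A B (flag_adj P \<Psi> i) = flag_adj P (lift A B \<Psi>) i" by (rule lift_system(2)[OF S(1) P i])
    show "lift A' B' (flag_adj P \<Psi> i) = flag_adj P (lift A' B' \<Psi>) i" by (rule lift_system(2)[OF S(2) P i])
  qed
  then obtain r where r: "r \<in> automorphisms P" "\<And>\<Psi>. \<Psi> \<in> flags P \<Longrightarrow> flag_map r \<Psi> = lift A B \<Psi>" by blast
  have "flag_map r (Fp g) = A g \<and> flag_map r (Fm g) = B g" if "g \<in> carrier G" for g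
    using r(2)[OF Fp_in_flags[OF that]] r(2)[OF Fm_in_flags[OF that]] lift_Fp[OF that] lift_Fm[OF that] by simp
  then show ?thesis using r(1) by blast
qed

lemma ex_translation:
  assumes h: "h \<in> carrier G"
  shows "\<exists>r\<in>automorphisms P. \<forall>g\<in>carrier G. flag_map r (Fp g) = Fp (g \<otimes> h) \<and> flag_map r (Fm g) = Fm (g \<otimes> h)"
proof -
  have S: "flag_system (\<lambda>g. Fp (g \<otimes> h)) (\<lambda>g. Fm (g \<otimes> h))" if "h \<in> carrier G" for h
    unfolding flag_system_def using that adj_Fp(2)[unfolded One_nat_def]
    by (simp add: Fp_in_flags Fm_in_flags adj_Fp m_assoc)
  show ?thesis
    by (rule automorphism_of_systems[OF S[OF h] S[OF inv_closed[OF h]]])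
      (simp_all add: lift_Fp lift_Fm h m_assoc)
qed

text \<open>The construction converse to \<open>reflexible_of_transitive\<close>: labels are sent
  through \<open>t\<close>, the two classes are exchanged, and the factor y^-1 places the image of
  the base flag at its 1-adjacent flag. The system is its own inverse because \<open>t\<close> is an
  involution.\<close>

lemma ex_reflection:
  assumes "reflexible G x y"
  shows "\<exists>r\<in>automorphisms P. flag_map r (Fp \<one>) = Fm (inv y)"
proof -
  obtain t where t: "t \<one> = \<one>" "\<And>g. g \<in> carrier G \<Longrightarrow> t g \<in> carrier G"
    "\<And>g. g \<in> carrier G \<Longrightarrow> t (x \<otimes> g) = inv x \<otimes> t g" "\<And>g. g \<in> carrier G \<Longrightarrow> t (y \<otimes> g) = inv y \<otimes> t g"
    using assms unfolding reflexible_def by blast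
  have t': "t (inv y \<otimes> g) = y \<otimes> t g" if g: "g \<in> carrier G" for g
    using t(2)[of "inv y \<otimes> g"] t(4)[of "inv y \<otimes> g"] g by simp
  have t'': "t (inv x \<otimes> g) = x \<otimes> t g" if g: "g \<in> carrier G" for g
    using t(2)[of "inv x \<otimes> g"] t(3)[of "inv x \<otimes> g"] g by simp
  have tt: "t (t g) = g" if "g \<in> carrier G" for g
    using that by (induction rule: carrier_induct) (simp_all add: t t' t'')
  have yz: "inv y \<otimes> (inv x \<otimes> k) = (x \<otimes> y) \<otimes> k" if "k \<in> carrier G" for k
    using half.inv_z that by (simp add: inv_mult_group flip: m_assoc)
  have tz: "inv y \<otimes> t ((x \<otimes> y) \<otimes> g) = (x \<otimes> y) \<otimes> (inv y \<otimes> t g)" if g: "g \<in> carrier G" for g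
    using g yz[of "inv y \<otimes> t g"] t(3)[of "y \<otimes> g"] by (simp add: t m_assoc)
  let ?A = "\<lambda>g. Fm (inv y \<otimes> t g)" and ?B = "\<lambda>g. Fp (inv y \<otimes> t g)"
  have S: "flag_system ?A ?B"
    unfolding flag_system_def
  proof (intro ballI conjI)
    fix g assume g: "g \<in> carrier G"
    have k: "inv y \<otimes> t g \<in> carrier G" using g t(2) by simp
    show "?A g \<in> flags P" "?B g \<in> flags P" using Fp_in_flags[OF k] Fm_in_flags[OF k] by simp_all
    show "flag_adj P (?A g) 0 = ?B ((x \<otimes> y) \<otimes> g)" using adj_Fm(1)[OF k] tz[OF g] by simp
    show "flag_adj P (?A g) 1 = ?B (inv y \<otimes> g)" using adj_Fm(2)[OF k] g t' t(2) by simp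
    show "flag_adj P (?A g) 2 = ?B g" using adj_Fm(3)[OF k] .
  qed
  have inv: "lift ?A ?B (?A g) = Fp g" "lift ?A ?B (?B g) = Fm g" if g: "g \<in> carrier G" for g
    using g t(2) by (simp_all add: lift_Fp lift_Fm t' tt)
  obtain r where "r \<in> automorphisms P" "\<forall>g\<in>carrier G. flag_map r (Fp g) = ?A g \<and> flag_map r (Fm g) = ?B g"
    using automorphism_of_systems[OF S S inv(1) inv(2) inv(1) inv(2)] by blast
  then show ?thesis using t(1) by (intro bexI[of _ r]) simp_all
qed

lemma transitive_of_reflexible:
  assumes "reflexible G x y"
  shows "transitive_on_flags P (flags P)"
proof -
  interpret A: group "aut_group P" by (rule group_aut_group)
  have car: "carrier (aut_group P) = automorphisms P" by (simp add: aut_group_def)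
  have base: "Fp \<one> \<in> flags P" by (simp add: Fp_in_flags)
  have reach: "\<exists>r\<in>automorphisms P. flag_map r (Fp \<one>) = \<Psi>" if "\<Psi> \<in> flags P" for \<Psi>
  proof -
    consider g where "g \<in> carrier G" "\<Psi> = Fp g" | g where "g \<in> carrier G" "\<Psi> = Fm g"
      using \<open>\<Psi> \<in> flags P\<close> unfolding flags_eq by blast
    then show ?thesis
    proof cases
      case 1
      obtain r where "r \<in> automorphisms P" "\<forall>k\<in>carrier G. flag_map r (Fp k) = Fp (k \<otimes> g)"
        using ex_translation[OF 1(1)] by blast
      then show ?thesis using 1 by (intro bexI[of _ r]) simp_all
    next
      case 2
      obtain r where r: "r \<in> automorphisms P" "flag_map r (Fp \<one>) = Fm (inv y)"
        using ex_reflection[OF assms] by blast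
      \<comment> \<open>Translation by y g compensates the factor y^-1 left by the
        reflection.\<close>
      obtain s where s: "s \<in> automorphisms P" "\<forall>k\<in>carrier G. flag_map s (Fm k) = Fm (k \<otimes> (y \<otimes> g))"
        using ex_translation[of "y \<otimes> g"] 2(1) by auto
      have "flag_map (r \<otimes>\<^bsub>aut_group P\<^esub> s) (Fp \<one>) = Fm g"
        using flag_map_mult[OF base] r s(2) 2(1) by simp
      moreover have "r \<otimes>\<^bsub>aut_group P\<^esub> s \<in> automorphisms P"
        using A.m_closed[of r s] r(1) s(1) by (simp add: car)
      ultimately show ?thesis using 2 by blast
    qed
  qed
  show ?thesis
    unfolding transitive_on_flags_def
  proof (intro ballI)
    fix \<Phi> \<Psi> assume "\<Phi> \<in> flags P" "\<Psi> \<in> flags P"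
    obtain r where r: "r \<in> automorphisms P" "flag_map r (Fp \<one>) = \<Phi>" using reach[OF \<open>\<Phi> \<in> flags P\<close>] by blast
    obtain s where s: "s \<in> automorphisms P" "flag_map s (Fp \<one>) = \<Psi>" using reach[OF \<open>\<Psi> \<in> flags P\<close>] by blast
    let ?i = "inv\<^bsub>aut_group P\<^esub> r"
    have i: "?i \<in> automorphisms P" using A.inv_closed r(1) car by simp
    have "flag_map ?i \<Phi> = flag_map (r \<otimes>\<^bsub>aut_group P\<^esub> ?i) (Fp \<one>)" using flag_map_mult[OF base] r(2) by simp
    also have "\<dots> = Fp \<one>" using A.r_inv[of r] r(1) car flag_map_one[OF base] by simp
    finally have "flag_map (?i \<otimes>\<^bsub>aut_group P\<^esub> s) \<Phi> = \<Psi>"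
      using flag_map_mult[OF \<open>\<Phi> \<in> flags P\<close>] s(2) by simp
    moreover have "?i \<otimes>\<^bsub>aut_group P\<^esub> s \<in> automorphisms P" using A.m_closed[of ?i s] i s(1) by (simp add: car)
    ultimately show "\<exists>g\<in>automorphisms P. flag_map g \<Phi> = \<Psi>" by blast
  qed
qed

text \<open>Translations are transitive on each of the two label classes, and transitivity on all
  flags would make G reflexible.\<close>

lemma chiral_of_not_reflexible:
  assumes "\<not> reflexible G x y"
  shows "chiral P"
proof -
  let ?A = "Fp ` carrier G" and ?B = "Fm ` carrier G"
  have un: "?A \<union> ?B = flags P" using flags_eq by simp
  have AB: "?A \<inter> ?B = {}" 
  proof (rule equals0I)
    fix \<Psi> assume "\<Psi> \<in> ?A \<inter> ?B"
    then obtain g h where "g \<in> carrier G" "h \<in> carrier G" "\<Psi> = Fp g" "\<Psi> = Fm h" by blast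
    then show False using disjoint[of g h] by simp
  qed
  have adj: "\<Phi> \<in> ?A \<longleftrightarrow> flag_adj P \<Phi> i \<in> ?B" if P: "\<Phi> \<in> flags P" "i \<in> {0, 1, 2}" for \<Phi> i
  proof -
    consider g where "g \<in> carrier G" "\<Phi> = Fp g" | g where "g \<in> carrier G" "\<Phi> = Fm g"
      using P(1) unfolding flags_eq by blast
    then show ?thesis
    proof cases
      case 1
      have "flag_adj P (Fp g) 0 \<in> ?B" "flag_adj P (Fp g) 1 \<in> ?B" "flag_adj P (Fp g) 2 \<in> ?B"
        unfolding adj_Fp[OF 1(1)] using 1(1) by simp_all
      then have "flag_adj P \<Phi> i \<in> ?B" using P(2) 1(2) by blast
      then show ?thesis using 1 by blast
    next
      case 2
      have "flag_adj P (Fm g) 0 \<in> ?A" "flag_adj P (Fm g) 1 \<in> ?A" "flag_adj P (Fm g) 2 \<in> ?A"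
        unfolding adj_Fm[OF 2(1)] using 2(1) by simp_all
      then have "flag_adj P \<Phi> i \<in> ?A" using P(2) 2(2) by blast
      then show ?thesis using 2 AB by blast
    qed
  qed
  have tr: "transitive_on_flags P ?A" "transitive_on_flags P ?B"
  proof -
    have ex: "\<exists>r\<in>automorphisms P. flag_map r (Fp g) = Fp h \<and> flag_map r (Fm g) = Fm h"
      if "g \<in> carrier G" "h \<in> carrier G" for g h
    proof -
      have gh: "inv g \<otimes> h \<in> carrier G" using that by simp
      obtain r where "r \<in> automorphisms P" "\<forall>k\<in>carrier G. flag_map r (Fp k) = Fp (k \<otimes> (inv g \<otimes> h)) \<and>
          flag_map r (Fm k) = Fm (k \<otimes> (inv g \<otimes> h))"
        using ex_translation[OF gh] by blast
      then show ?thesis using that by (intro bexI[of _ r]) simp_all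
    qed
    show "transitive_on_flags P ?A"
      unfolding transitive_on_flags_def
    proof (intro ballI)
      fix \<Phi> \<Psi> assume "\<Phi> \<in> ?A" "\<Psi> \<in> ?A"
      then obtain g h where "g \<in> carrier G" "h \<in> carrier G" "\<Phi> = Fp g" "\<Psi> = Fp h" by blast
      then show "\<exists>r\<in>automorphisms P. flag_map r \<Phi> = \<Psi>" using ex[of g h] by blast
    qed
    show "transitive_on_flags P ?B"
      unfolding transitive_on_flags_def
    proof (intro ballI)
      fix \<Phi> \<Psi> assume "\<Phi> \<in> ?B" "\<Psi> \<in> ?B"
      then obtain g h where "g \<in> carrier G" "h \<in> carrier G" "\<Phi> = Fm g" "\<Psi> = Fm h" by blast
      then show "\<exists>r\<in>automorphisms P. flag_map r \<Phi> = \<Psi>" using ex[of g h] by blast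
    qed
  qed
  have ntr: "\<not> transitive_on_flags P (flags P)" using reflexible_of_transitive assms by blast
  have "\<exists>A B. A \<union> B = flags P \<and> A \<inter> B = {} \<and>
      (\<forall>\<Phi>\<in>flags P. \<forall>i\<in>{0, 1, 2}. \<Phi> \<in> A \<longleftrightarrow> flag_adj P \<Phi> i \<in> B) \<and>
      transitive_on_flags P A \<and> transitive_on_flags P B"
  proof (rule exI[of _ ?A], rule exI[of _ ?B], intro conjI ballI)
    show "\<Phi> \<in> ?A \<longleftrightarrow> flag_adj P \<Phi> i \<in> ?B" if "\<Phi> \<in> flags P" "i \<in> {0, 1, 2}" for \<Phi> i
      by (rule adj[OF that])
  qed (fact un AB tr)+
  then show ?thesis unfolding chiral_def by (intro conjI polyhedron ntr)
qed

section \<open>The rotation group of a labelled polyhedron\<close>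

text \<open>The right translation by \<open>h\<close>, pinned down by the image of the base flag. It
  has the same shape as \<open>sigma1\<close> and \<open>sigma2\<close>, so that comparing images of
  the base flag proves \<open>sigma_eq_rot\<close>.\<close>

definition rot :: "'b \<Rightarrow> 'a \<Rightarrow> 'a" where
  "rot h = (THE r. r \<in> automorphisms P \<and> flag_map r (Fp \<one>) = Fp h)"

lemma rot_eqI:
  assumes "r \<in> automorphisms P" "flag_map r (Fp \<one>) = Fp h"
  shows "rot h = r"
  unfolding rot_def
proof (rule the_equality)
  fix s assume "s \<in> automorphisms P \<and> flag_map s (Fp \<one>) = Fp h"
  then show "s = r" using automorphism_eqI[of s r "Fp \<one>"] assms Fp_in_flags[OF one_closed] by simp
qed (use assms in simp)

lemma
  assumes h: "h \<in> carrier G"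
  shows rot_automorphism: "rot h \<in> automorphisms P"
    and flag_map_rot: "g \<in> carrier G \<Longrightarrow> flag_map (rot h) (Fp g) = Fp (g \<otimes> h)"
proof -
  obtain r where r: "r \<in> automorphisms P" "\<forall>g\<in>carrier G. flag_map r (Fp g) = Fp (g \<otimes> h)"
    using ex_translation[OF h] by blast
  then have "rot h = r" using h by (intro rot_eqI) simp_all
  then show "rot h \<in> automorphisms P" "g \<in> carrier G \<Longrightarrow> flag_map (rot h) (Fp g) = Fp (g \<otimes> h)"
    using r by simp_all
qed

lemma sigma_eq_rot: "sigma1 P (Fp \<one>) = rot x" "sigma2 P (Fp \<one>) = rot y"
proof -
  have "flag_adj P (flag_adj P (Fp \<one>) 1) 0 = Fp x"
    using adj_Fp(2)[of \<one>] adj_Fm(1)[of "inv y"] z_inv_y[of \<one>] by simp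
  then show "sigma1 P (Fp \<one>) = rot x" by (simp add: sigma1_def rot_def)
  have "flag_adj P (flag_adj P (Fp \<one>) 2) 1 = Fp y"
    using adj_Fp(3)[of \<one>] adj_Fm(2)[of \<one>] by simp
  then show "sigma2 P (Fp \<one>) = rot y" by (simp add: sigma2_def rot_def)
qed

lemma rot_mult:
  assumes "g \<in> carrier G" "h \<in> carrier G"
  shows "rot (g \<otimes> h) = rot g \<otimes>\<^bsub>aut_group P\<^esub> rot h"
proof (rule rot_eqI)
  interpret A: group "aut_group P" by (rule group_aut_group)
  show "rot g \<otimes>\<^bsub>aut_group P\<^esub> rot h \<in> automorphisms P"
    using A.m_closed[of "rot g" "rot h"] rot_automorphism assms by (simp add: aut_group_def)
  show "flag_map (rot g \<otimes>\<^bsub>aut_group P\<^esub> rot h) (Fp \<one>) = Fp (g \<otimes> h)"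
    using flag_map_mult[OF Fp_in_flags[OF one_closed]] flag_map_rot assms by simp
qed

lemma rot_hom: "rot \<in> hom G (rotation_group P (Fp \<one>))"
proof (rule homI)
  interpret A: group "aut_group P" by (rule group_aut_group)
  fix g assume "g \<in> carrier G"
  have car: "carrier (aut_group P) = automorphisms P" by (simp add: aut_group_def)
  have gens: "rot x \<in> automorphisms P" "rot y \<in> automorphisms P" using rot_automorphism by simp_all
  have c: "carrier (rotation_group P (Fp \<one>)) = generate (aut_group P) {rot x, rot y}"
    unfolding rotation_group_def carrier_subgroup_generated sigma_eq_rot car using gens
    by (simp add: Int_absorb1)
  show "rot g \<in> carrier (rotation_group P (Fp \<one>))"
    unfolding c using \<open>g \<in> carrier G\<close>
  proof (induction rule: carrier_induct)
    case one
    have "rot \<one> = \<one>\<^bsub>aut_group P\<^esub>"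
      using A.one_closed car flag_map_one[OF Fp_in_flags[OF one_closed]] by (intro rot_eqI) simp_all
    then show ?case by (simp add: generate.one)
  next
    case (x g)
    then show ?case using rot_mult[of x g] generate.eng[OF generate.incl x.IH] by simp
  next
    case (y g)
    then show ?case using rot_mult[of y g] generate.eng[OF generate.incl y.IH] by simp
  qed
next
  fix g h assume "g \<in> carrier G" "h \<in> carrier G"
  then show "rot (g \<otimes> h) = rot g \<otimes>\<^bsub>rotation_group P (Fp \<one>)\<^esub> rot h"
    by (simp add: rotation_group_def rot_mult)
qed

end

section \<open>Labelling the flags of a tight chiral polyhedron by its rotation group\<close>

locale tight_chiral = poly P for P :: "'a ranked_poset" +
  fixes \<Phi> and p q :: nat and G (structure) and x y :: "'a \<Rightarrow> 'a"
  assumes chiral: "chiral P" and tight: "tight_of_type P p q" and base: "\<Phi> \<in> flags P"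
    and G_eq: "G = rotation_group P \<Phi>" and x_eq: "x = sigma1 P \<Phi>" and y_eq: "y = sigma2 P \<Phi>"

sublocale tight_chiral \<subseteq> group G
  unfolding G_eq rotation_group_def by (rule group.group_subgroup_generated[OF group_aut_group])

context tight_chiral
begin

text \<open>Two changes of rank return to the class of the base flag, on which the automorphism
  group is transitive.\<close>

lemma ex_even_automorphism:
  assumes "i \<in> {0, 1, 2}" "j \<in> {0, 1, 2}"
  shows "\<exists>g\<in>automorphisms P. flag_map g \<Phi> = flag_adj P (flag_adj P \<Phi> i) j"
proof -
  obtain A B where AB: "A \<union> B = flags P" "A \<inter> B = {}"
    and adj: "\<And>\<Psi> i. \<Psi> \<in> flags P \<Longrightarrow> i \<in> {0, 1, 2} \<Longrightarrow> \<Psi> \<in> A \<longleftrightarrow> flag_adj P \<Psi> i \<in> B"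
    and tr: "transitive_on_flags P A" "transitive_on_flags P B"
    using chiral unfolding chiral_def by blast
  let ?\<Psi> = "flag_adj P (flag_adj P \<Phi> i) j"
  have 1: "flag_adj P \<Phi> i \<in> flags P" using flag_adj_in_flags[OF base assms(1)] .
  have 2: "?\<Psi> \<in> flags P" using flag_adj_in_flags[OF 1 assms(2)] .
  have "\<Phi> \<in> A \<longleftrightarrow> ?\<Psi> \<in> A"
    using adj[OF base assms(1)] adj[OF 1 assms(2)] AB 1 2 by blast
  then have "\<Phi> \<in> A \<and> ?\<Psi> \<in> A \<or> \<Phi> \<in> B \<and> ?\<Psi> \<in> B" using AB base 2 by blast
  then show ?thesis using tr unfolding transitive_on_flags_def by blast
qed

lemma the_automorphism:
  assumes "\<exists>g\<in>automorphisms P. flag_map g \<Phi> = \<Psi>"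
  shows "(THE g. g \<in> automorphisms P \<and> flag_map g \<Phi> = \<Psi>) \<in> automorphisms P \<and>
    flag_map (THE g. g \<in> automorphisms P \<and> flag_map g \<Phi> = \<Psi>) \<Phi> = \<Psi>"
proof (rule theI'[where P = "\<lambda>g. g \<in> automorphisms P \<and> flag_map g \<Phi> = \<Psi>"])
  show "\<exists>!g. g \<in> automorphisms P \<and> flag_map g \<Phi> = \<Psi>"
    using assms automorphism_eqI[OF _ _ base] by blast
qed

lemma x_aut: "x \<in> automorphisms P" and flag_map_x: "flag_map x \<Phi> = flag_adj P (flag_adj P \<Phi> 1) 0"
  and y_aut: "y \<in> automorphisms P" and flag_map_y: "flag_map y \<Phi> = flag_adj P (flag_adj P \<Phi> 2) 1"
  using the_automorphism[OF ex_even_automorphism, of 1 0] the_automorphism[OF ex_even_automorphism, of 2 1]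
  by (simp_all add: x_eq y_eq sigma1_def sigma2_def)

lemma carrier_aut_group: "carrier (aut_group P) = automorphisms P"
  by (simp add: aut_group_def)

lemma carrier_G: "carrier G = generate (aut_group P) {x, y}"
  unfolding G_eq rotation_group_def carrier_subgroup_generated carrier_aut_group x_eq[symmetric] y_eq[symmetric]
  using x_aut y_aut by (simp add: Int_absorb1)

lemma carrier_G_aut: "g \<in> carrier G \<Longrightarrow> g \<in> automorphisms P"
  using group.generate_in_carrier[OF group_aut_group, of "{x, y}" P g] x_aut y_aut
  by (simp add: carrier_G carrier_aut_group)

lemma x_in: "x \<in> carrier G" and y_in: "y \<in> carrier G"
  unfolding carrier_G by (simp_all add: generate.incl)

lemma flag_map_one_G: "\<Psi> \<in> flags P \<Longrightarrow> flag_map \<one> \<Psi> = \<Psi>"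
  using flag_map_one by (simp add: G_eq rotation_group_def)

lemma flag_map_mult_G: "\<Psi> \<in> flags P \<Longrightarrow> flag_map (g \<otimes> h) \<Psi> = flag_map h (flag_map g \<Psi>)"
  using flag_map_mult by (simp add: G_eq rotation_group_def)

lemma flag_map_inv_G:
  assumes "\<Psi> \<in> flags P" "g \<in> carrier G"
  shows "flag_map (inv g) (flag_map g \<Psi>) = \<Psi>"
  using flag_map_mult_G[OF assms(1), of g "inv g"] flag_map_one_G[OF assms(1)] assms(2) by simp

lemma eq_of_flag_map:
  "g \<in> carrier G \<Longrightarrow> h \<in> carrier G \<Longrightarrow> \<Psi> \<in> flags P \<Longrightarrow> flag_map g \<Psi> = flag_map h \<Psi> \<Longrightarrow> g = h"
  using automorphism_eqI carrier_G_aut by blast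

definition Fp :: "('a \<Rightarrow> 'a) \<Rightarrow> 'a flag" where "Fp g = flag_map g \<Phi>"
definition Fm :: "('a \<Rightarrow> 'a) \<Rightarrow> 'a flag" where "Fm g = flag_map g (flag_adj P \<Phi> 2)"

lemma base_adj: "i \<in> {0, 1, 2} \<Longrightarrow> flag_adj P \<Phi> i \<in> flags P"
  using flag_adj_in_flags[OF base] .

text \<open>Together with \<open>adj_0\<close>, this writes the neighbours of the base flag as
  images of its 2-adjacent flag under rotations, which produces the labels in
  \<open>adj_Fp\<close>.\<close>

lemma adj_1: "flag_adj P \<Phi> 1 = flag_map (inv y) (flag_adj P \<Phi> 2)"
proof -
  have "flag_map y (flag_adj P \<Phi> 1) = flag_adj P (flag_map y \<Phi>) 1"
    using flag_adj_flag_map[OF y_aut base, of 1] by simp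
  also have "\<dots> = flag_adj P \<Phi> 2" unfolding flag_map_y using flag_adj_adj[of "flag_adj P \<Phi> 2" 1] base_adj[of 2] by simp
  finally show ?thesis using flag_map_inv_G[OF base_adj y_in, of 1] by simp
qed

lemma adj_1': "flag_adj P \<Phi> 1 = flag_map x (flag_adj P \<Phi> 0)"
proof -
  have "flag_map x (flag_adj P \<Phi> 0) = flag_adj P (flag_map x \<Phi>) 0"
    using flag_adj_flag_map[OF x_aut base, of 0] by simp
  also have "\<dots> = flag_adj P \<Phi> 1" unfolding flag_map_x using flag_adj_adj[of "flag_adj P \<Phi> 1" 0] base_adj[of 1] by simp
  finally show ?thesis by simp
qed

lemma flag_map_z: "flag_map (x \<otimes> y) \<Phi> = flag_adj P (flag_adj P \<Phi> 2) 0"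
proof -
  have "flag_map (x \<otimes> y) \<Phi> = flag_map y (flag_adj P (flag_adj P \<Phi> 1) 0)"
    using flag_map_mult_G[OF base] flag_map_x by simp
  also have "\<dots> = flag_adj P (flag_map y (flag_adj P \<Phi> 1)) 0"
    using flag_adj_flag_map[OF y_aut base_adj[of 1], of 0] by simp
  also have "flag_map y (flag_adj P \<Phi> 1) = flag_adj P (flag_map y \<Phi>) 1"
    using flag_adj_flag_map[OF y_aut base, of 1] by simp
  also have "\<dots> = flag_adj P \<Phi> 2"
    unfolding flag_map_y using flag_adj_adj[of "flag_adj P \<Phi> 2" 1] base_adj[of 2] by simp
  finally show ?thesis .
qed

lemma adj_0: "flag_adj P \<Phi> 0 = flag_map (x \<otimes> y) (flag_adj P \<Phi> 2)"
proof -
  have z: "x \<otimes> y \<in> automorphisms P" using carrier_G_aut x_in y_in by simp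
  have "flag_map (x \<otimes> y) (flag_adj P \<Phi> 2) = flag_adj P (flag_adj P (flag_adj P \<Phi> 2) 0) 2"
    using flag_adj_flag_map[OF z base, of 2] flag_map_z by simp
  also have "\<dots> = flag_adj P (flag_adj P (flag_adj P \<Phi> 0) 2) 2" using flag_adj_0_2[OF base] by simp
  also have "\<dots> = flag_adj P \<Phi> 0" using flag_adj_adj[OF base_adj[of 0], of 2] by simp
  finally show ?thesis by simp
qed

lemma z_square: "(x \<otimes> y) \<otimes> (x \<otimes> y) = \<one>"
proof (rule eq_of_flag_map[OF _ _ base])
  have z: "x \<otimes> y \<in> automorphisms P" using carrier_G_aut x_in y_in by simp
  have "flag_map ((x \<otimes> y) \<otimes> (x \<otimes> y)) \<Phi> = flag_map (x \<otimes> y) (flag_adj P (flag_adj P \<Phi> 2) 0)"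
    using flag_map_mult_G[OF base] flag_map_z by simp
  also have "\<dots> = flag_adj P (flag_map (x \<otimes> y) (flag_adj P \<Phi> 2)) 0"
    using flag_adj_flag_map[OF z base_adj[of 2], of 0] by simp
  also have "\<dots> = \<Phi>" unfolding adj_0[symmetric] using flag_adj_adj[OF base, of 0] by simp
  finally show "flag_map ((x \<otimes> y) \<otimes> (x \<otimes> y)) \<Phi> = flag_map \<one> \<Phi>" using flag_map_one_G[OF base] by simp
qed (use x_in y_in in simp_all)

lemma adj_Fp:
  assumes g: "g \<in> carrier G"
  shows "flag_adj P (Fp g) 0 = Fm ((x \<otimes> y) \<otimes> g)" "flag_adj P (Fp g) 1 = Fm (inv y \<otimes> g)"
    "flag_adj P (Fp g) 2 = Fm g"
  unfolding Fp_def Fm_def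
  using flag_map_mult_G[OF base_adj[of 2], of "x \<otimes> y" g] flag_map_mult_G[OF base_adj[of 2], of "inv y" g] flag_adj_flag_map[OF carrier_G_aut[OF g] base, of 0] flag_adj_flag_map[OF carrier_G_aut[OF g] base, of 1]
    flag_adj_flag_map[OF carrier_G_aut[OF g] base, of 2] adj_0 adj_1 by simp_all

lemma Fp_in_flags: "g \<in> carrier G \<Longrightarrow> Fp g \<in> flags P"
  and Fm_in_flags: "g \<in> carrier G \<Longrightarrow> Fm g \<in> flags P"
  using flag_map_in_flags carrier_G_aut base base_adj[of 2] by (auto simp: Fp_def Fm_def)

lemma adj_Fm:
  assumes g: "g \<in> carrier G"
  shows "flag_adj P (Fm g) 0 = Fp ((x \<otimes> y) \<otimes> g)"
    "flag_adj P (Fm g) 1 = Fp (y \<otimes> g)" "flag_adj P (Fm g) 2 = Fp g"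
proof -
  have a: "flag_adj P (flag_adj P (Fp h) i) i = Fp h" if "h \<in> carrier G" "i \<in> {0, 1, 2}" for h i
    using flag_adj_adj[OF Fp_in_flags[OF that(1)] that(2)] .
  have "(x \<otimes> y) \<otimes> ((x \<otimes> y) \<otimes> g) = ((x \<otimes> y) \<otimes> (x \<otimes> y)) \<otimes> g"
    using g x_in y_in by (simp add: m_assoc)
  then have "(x \<otimes> y) \<otimes> ((x \<otimes> y) \<otimes> g) = g" unfolding z_square using g by simp
  then show "flag_adj P (Fm g) 0 = Fp ((x \<otimes> y) \<otimes> g)"
    using a[of "(x \<otimes> y) \<otimes> g" 0] adj_Fp(1)[of "(x \<otimes> y) \<otimes> g"] g x_in y_in by simp
  show "flag_adj P (Fm g) 1 = Fp (y \<otimes> g)"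
    using a[of "y \<otimes> g" 1] adj_Fp(2)[of "y \<otimes> g"] g y_in by simp
  show "flag_adj P (Fm g) 2 = Fp g" using a[of g 2] adj_Fp(3)[of g] g by simp
qed

lemma flag_cases:
  assumes "\<Psi> \<in> flags P"
  shows "\<exists>g\<in>carrier G. \<Psi> = Fp g \<or> \<Psi> = Fm g"
  using base assms
proof (rule flag_induct)
  show "\<exists>g\<in>carrier G. \<Phi> = Fp g \<or> \<Phi> = Fm g"
    using flag_map_one_G[OF base] by (intro bexI[of _ \<one>]) (simp_all add: Fp_def)
  fix \<Theta> and j :: nat assume T: "\<Theta> \<in> flags P" "\<exists>g\<in>carrier G. \<Theta> = Fp g \<or> \<Theta> = Fm g" "j \<in> {0, 1, 2}"
  then obtain g where g: "g \<in> carrier G" "\<Theta> = Fp g \<or> \<Theta> = Fm g" by blast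
  have c: "(x \<otimes> y) \<otimes> g \<in> carrier G" "inv y \<otimes> g \<in> carrier G" "y \<otimes> g \<in> carrier G"
    using g(1) x_in y_in by simp_all
  have j: "j = 0 \<or> j = 1 \<or> j = 2" using T(3) by simp
  from g(2) show "\<exists>g\<in>carrier G. flag_adj P \<Theta> j = Fp g \<or> flag_adj P \<Theta> j = Fm g"
  proof
    assume "\<Theta> = Fp g"
    then show ?thesis using j adj_Fp[OF g(1)] c g(1) by metis
  next
    assume "\<Theta> = Fm g"
    then show ?thesis using j adj_Fm[OF g(1)] c g(1) by metis
  qed
qed

lemma flags_eq: "flags P = Fp ` carrier G \<union> Fm ` carrier G"
proof (rule equalityI; rule subsetI)
  fix \<Psi> assume "\<Psi> \<in> flags P"
  then show "\<Psi> \<in> Fp ` carrier G \<union> Fm ` carrier G" using flag_cases by blast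
next
  fix \<Psi> assume "\<Psi> \<in> Fp ` carrier G \<union> Fm ` carrier G"
  then show "\<Psi> \<in> flags P" using Fp_in_flags Fm_in_flags by blast
qed

text \<open>Otherwise some rotation k takes the base flag to its 2-adjacent flag, so every flag
  labelled through \<open>Fm\<close> is also labelled through \<open>Fp\<close>, and the rotations
  alone are transitive on all flags, against chirality.\<close>

lemma disjoint:
  assumes "g \<in> carrier G" "h \<in> carrier G"
  shows "Fp g \<noteq> Fm h"
proof
  assume eq: "Fp g = Fm h"
  define k where "k = g \<otimes> inv h"
  have k: "k \<in> carrier G" using assms by (simp add: k_def)
  have "flag_map k \<Phi> = flag_map (inv h) (Fm h)"
    unfolding k_def flag_map_mult_G[OF base] using eq by (simp add: Fp_def)
  also have "\<dots> = flag_adj P \<Phi> 2" unfolding Fm_def using flag_map_inv_G[OF base_adj assms(2), of 2] by simp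
  finally have kP: "flag_map k \<Phi> = flag_adj P \<Phi> 2" .
  have Fm: "Fm l = Fp (k \<otimes> l)" for l
    unfolding Fm_def Fp_def flag_map_mult_G[OF base] kP ..
  have all: "\<exists>l\<in>carrier G. \<Psi> = Fp l" if "\<Psi> \<in> flags P" for \<Psi>
    using flag_cases[OF that] Fm k by (metis m_closed)
  have "transitive_on_flags P (flags P)"
    unfolding transitive_on_flags_def
  proof (intro ballI)
    fix \<Psi> \<Theta> assume P: "\<Psi> \<in> flags P" "\<Theta> \<in> flags P"
    obtain l where l: "l \<in> carrier G" "\<Psi> = Fp l" using all[OF P(1)] by blast
    obtain l' where l': "l' \<in> carrier G" "\<Theta> = Fp l'" using all[OF P(2)] by blast
    have "flag_map (inv l \<otimes> l') \<Psi> = \<Theta>"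
      using flag_map_mult_G[OF P(1), of "inv l" l'] flag_map_inv_G[OF base l(1)] l l' by (simp add: Fp_def)
    moreover have "inv l \<otimes> l' \<in> automorphisms P" using l(1) l'(1) by (intro carrier_G_aut) simp
    ultimately show "\<exists>g\<in>automorphisms P. flag_map g \<Psi> = \<Theta>" by blast
  qed
  then show False using chiral unfolding chiral_def by blast
qed

lemma inj_Fp: "inj_on Fp (carrier G)"
  unfolding Fp_def by (rule inj_onI) (rule eq_of_flag_map[OF _ _ base])

lemma inj_Fm: "inj_on Fm (carrier G)"
  unfolding Fm_def by (rule inj_onI) (rule eq_of_flag_map[OF _ _ base_adj[of 2]]; simp)

lemma finite_G: "finite (carrier G)"
proof -
  have "finite (flags P)" using tight by (simp add: tight_of_type_def)
  then have "finite (Fp ` carrier G)" using flags_eq by simp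
  then show ?thesis using finite_imageD[OF _ inj_Fp] by blast
qed

text \<open>Rotations act freely on flags, so the 2pq flags form two disjoint copies of the
  group.\<close>

lemma card_G: "card (carrier G) = p * q"
proof -
  have "card (flags P) = card (Fp ` carrier G) + card (Fm ` carrier G)"
    unfolding flags_eq
  proof (rule card_Un_disjoint)
    show "Fp ` carrier G \<inter> Fm ` carrier G = {}"
    proof (rule equals0I)
      fix \<Psi> assume "\<Psi> \<in> Fp ` carrier G \<inter> Fm ` carrier G"
      then obtain g h where "g \<in> carrier G" "h \<in> carrier G" "\<Psi> = Fp g" "\<Psi> = Fm h" by blast
      then show False using disjoint[of g h] by simp
    qed
  qed (use finite_G in simp_all)
  also have "\<dots> = 2 * card (carrier G)" using card_image[OF inj_Fp] card_image[OF inj_Fm] by simp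
  finally show ?thesis using tight by (simp add: tight_of_type_def)
qed

lemma Fp_neq_adj:
  assumes "g \<in> carrier G" "i \<in> {0, 1, 2}"
  shows "flag_map g \<Phi> \<noteq> flag_adj P \<Phi> i"
proof -
  have "\<exists>h\<in>carrier G. flag_adj P \<Phi> i = Fm h"
    using assms(2) adj_0 adj_1 flag_map_one_G[OF base_adj[of 2]] x_in y_in
    by (auto simp: Fm_def intro: bexI[of _ "x \<otimes> y"] bexI[of _ "inv y"] bexI[of _ "\<one>"])
  then show ?thesis using disjoint[OF assms(1)] by (metis Fp_def)
qed

text \<open>Fixing two elements of the base flag leaves as its image only the base flag itself or
  one adjacent flag, and the latter carries a label of the other class.\<close>

lemma eq_one_of_fixes:
  assumes "g \<in> carrier G" "i \<in> {0, 1, 2}" "\<And>j. j \<in> {0, 1, 2} \<Longrightarrow> j \<noteq> i \<Longrightarrow> g (flag_elem \<Phi> j) = flag_elem \<Phi> j"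
  shows "g = \<one>"
proof -
  have "flag_map g \<Phi> \<in> flags P" using Fp_in_flags[OF assms(1)] by (simp add: Fp_def)
  then have "flag_map g \<Phi> = \<Phi> \<or> flag_map g \<Phi> = flag_adj P \<Phi> i"
    using assms(3) by (intro eq_or_flag_adj base assms(2)) simp_all
  then have "flag_map g \<Phi> = flag_map \<one> \<Phi>" using Fp_neq_adj[OF assms(1,2)] flag_map_one_G[OF base] by simp
  then show ?thesis using eq_of_flag_map[OF assms(1) one_closed base] by simp
qed

lemma pow_fixes:
  assumes "g \<in> carrier G" "i \<in> {0, 1, 2}" "g (flag_elem \<Phi> i) = flag_elem \<Phi> i"
  shows "(g [^] (n::int)) (flag_elem \<Phi> i) = flag_elem \<Phi> i"
proof -
  let ?a = "flag_elem \<Phi> i"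
  have app: "(h \<otimes> k) ?a = k (h ?a)" if "h \<in> carrier G" for h k
    using flag_map_mult_G[OF base, of h k] by (metis flag_elem_flag_map)
  have nat: "(h [^] (n::nat)) ?a = ?a" if "h \<in> carrier G" "h ?a = ?a" for h n
  proof (induction n)
    case 0
    then show ?case using flag_map_one_G[OF base] by (metis flag_elem_flag_map nat_pow_0)
  next
    case (Suc n)
    then show ?case using app[of "h [^] n" h] that by simp
  qed
  have ig: "(inv g) ?a = ?a"
    using flag_map_inv_G[OF base assms(1)] assms(3) by (metis flag_elem_flag_map)
  show ?thesis
  proof (cases "n < 0")
    case True
    show ?thesis unfolding int_pow_def2 if_P[OF True]
      using nat[OF inv_closed[OF assms(1)] ig, of "nat (- n)"] assms(1) by (simp add: nat_pow_inv)
  next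
    case False
    show ?thesis unfolding int_pow_def2 if_not_P[OF False] by (rule nat[OF assms(1,3)])
  qed
qed

text \<open>To be used with w = x at the base face and w = y^-1 at the base vertex. By
  \<open>w1\<close> the powers of \<open>w\<close> move the base flag and its j-adjacent flag
  through all flags around the element of rank i. These two flags share their edge, so the edges
  there form the orbit of the base edge. A power of \<open>w\<close> fixing that edge fixes the
  ranks 1 and i, hence is trivial.\<close>

lemma card_edges_at:
  assumes w: "w \<in> carrier G" and i: "(i, j) = (0, 2) \<or> (i, j) = (2, 0)"
    and w1: "flag_adj P \<Phi> 1 = flag_map w (flag_adj P \<Phi> j)"
  shows "card {e \<in> edges P. incident P e (flag_elem \<Phi> i)} = ord w" "w (flag_elem \<Phi> i) = flag_elem \<Phi> i"
proof -
  let ?a = "flag_elem \<Phi> i" and ?e = "flag_elem \<Phi> 1"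
  have ij: "i \<in> {0, 1, 2}" "j \<in> {0, 1, 2}" "i \<noteq> j" "i \<noteq> 1" "j \<noteq> 1" using i by auto
  have ind: "k = 1 \<or> k = j" if "k \<in> {0, 1, 2} - {i}" for k using that i by auto
  have same: "flag_elem (flag_adj P \<Phi> k) l = flag_elem \<Phi> l" if "k \<in> {0, 1, 2}" "l \<in> {0, 1, 2}" "l \<noteq> k" for k l
    using flag_elem_adj_neq[OF base that(1,2)] that(3) by blast
  show wa: "w ?a = ?a"
  proof -
    have "flag_elem (flag_adj P \<Phi> 1) i = w (flag_elem (flag_adj P \<Phi> j) i)" unfolding w1 by simp
    then show ?thesis using same[of 1 i] same[of j i] ij by simp
  qed
  \<comment> \<open>The hypothesis \<open>w1\<close> read backwards: leaving the j-adjacent flag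
    across rank 1 lowers the exponent of \<open>w\<close> by one, while leaving the base flag raises
    it.\<close>
  have w2: "flag_adj P (flag_adj P \<Phi> j) 1 = flag_map (inv w) \<Phi>"
  proof -
    have "flag_map w (flag_adj P (flag_adj P \<Phi> j) 1) = flag_adj P (flag_adj P \<Phi> 1) 1"
      unfolding w1 using flag_adj_flag_map[OF carrier_G_aut[OF w] base_adj[OF ij(2)], of 1] by simp
    also have "\<dots> = \<Phi>" using flag_adj_adj[OF base, of 1] by simp
    finally show ?thesis
      using flag_map_inv_G[OF flag_adj_in_flags[OF base_adj[OF ij(2)], of 1] w] by simp
  qed
  have orbit: "\<exists>n::int. \<Psi> = flag_map (w [^] n) \<Phi> \<or> \<Psi> = flag_map (w [^] n) (flag_adj P \<Phi> j)"
    if "\<Psi> \<in> flags P" "?a = flag_elem \<Psi> i" for \<Psi>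
    using base that(1) ij(1) that(2)
  proof (rule flag_closed_induct)
    have "\<Phi> = flag_map (w [^] (0::int)) \<Phi>" using flag_map_one_G[OF base] by simp
    then show "\<exists>n::int. \<Phi> = flag_map (w [^] n) \<Phi> \<or> \<Phi> = flag_map (w [^] n) (flag_adj P \<Phi> j)" by blast
    fix \<Theta> k
    assume T: "\<exists>n::int. \<Theta> = flag_map (w [^] n) \<Phi> \<or> \<Theta> = flag_map (w [^] n) (flag_adj P \<Phi> j)"
      and k: "k \<in> {0, 1, 2} - {i}"
    obtain n :: int where n: "\<Theta> = flag_map (w [^] n) \<Phi> \<or> \<Theta> = flag_map (w [^] n) (flag_adj P \<Phi> j)"
      using T by blast
    have aut: "w [^] n \<in> automorphisms P" using w by (intro carrier_G_aut) simp
    have pow: "flag_map (w [^] n) (flag_map w \<Psi>) = flag_map (w [^] (1 + n)) \<Psi>"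
      "flag_map (w [^] n) (flag_map (inv w) \<Psi>) = flag_map (w [^] (- 1 + n)) \<Psi>" if "\<Psi> \<in> flags P" for \<Psi>
      unfolding int_pow_mult[OF w] using flag_map_mult_G[OF that] w by (simp_all add: int_pow_neg)
    have a1: "flag_adj P (flag_map (w [^] n) \<Phi>) j = flag_map (w [^] n) (flag_adj P \<Phi> j)"
      using flag_adj_flag_map[OF aut base ij(2)] .
    have a2: "flag_adj P (flag_map (w [^] n) (flag_adj P \<Phi> j)) j = flag_map (w [^] n) \<Phi>"
      using flag_adj_flag_map[OF aut base_adj[OF ij(2)] ij(2)] flag_adj_adj[OF base ij(2)] by simp
    have a3: "flag_adj P (flag_map (w [^] n) \<Phi>) 1 = flag_map (w [^] (1 + n)) (flag_adj P \<Phi> j)"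
      using flag_adj_flag_map[OF aut base, of 1] w1 pow(1)[OF base_adj[OF ij(2)]] by simp
    have a4: "flag_adj P (flag_map (w [^] n) (flag_adj P \<Phi> j)) 1 = flag_map (w [^] (- 1 + n)) \<Phi>"
      using flag_adj_flag_map[OF aut base_adj[OF ij(2)], of 1] w2 pow(2)[OF base] by simp
    show "\<exists>n::int. flag_adj P \<Theta> k = flag_map (w [^] n) \<Phi> \<or> flag_adj P \<Theta> k = flag_map (w [^] n) (flag_adj P \<Phi> j)"
      using n ind[OF k] a1 a2 a3 a4 by blast
  qed
  have e_aut: "(w [^] n) ?e \<in> edges P \<and> incident P ((w [^] n) ?e) ?a" for n :: int
  proof -
    have aut: "w [^] n \<in> automorphisms P" using w by (intro carrier_G_aut) simp
    have fl: "flag_map (w [^] n) \<Phi> \<in> flags P" using flag_map_in_flags[OF aut base] .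
    have "incident P (flag_elem (flag_map (w [^] n) \<Phi>) 1) (flag_elem (flag_map (w [^] n) \<Phi>) i)"
      using incident_flag_elem[OF fl, of 1 i] ij by simp
    moreover have "(w [^] n) ?a = ?a" by (rule pow_fixes[OF w ij(1) wa])
    moreover have "flag_elem (flag_map (w [^] n) \<Phi>) 1 \<in> edges P"
      using flag_elem_in_elems[OF fl, of 1] by (simp add: of_rank_def)
    ultimately show ?thesis by simp
  qed
  have inj: "n = 0" if "n < ord w" "(w [^] n) ?e = ?e" for n :: nat
  proof -
    have "w [^] int n = \<one>"
    proof (rule eq_one_of_fixes[OF _ ij(2)])
      fix l :: nat assume l: "l \<in> {0, 1, 2}" "l \<noteq> j"
      then have "l = 1 \<or> l = i" using i by auto
      then show "(w [^] int n) (flag_elem \<Phi> l) = flag_elem \<Phi> l"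
        using that(2) pow_fixes[OF w ij(1) wa, of "int n"] by (auto simp: int_pow_int)
    qed (use w in simp)
    then have "ord w dvd n" using pow_eq_id[OF w] by (simp add: int_pow_int)
    then show ?thesis using that(1) by (auto dest: dvd_imp_le)
  qed
  have ordw: "ord w > 0" using ord_ge_1[OF finite_G w] by simp
  let ?E = "(\<lambda>n::nat. (w [^] n) ?e) ` {..<ord w}"
  have app: "(h \<otimes> k) ?e = k (h ?e)" if "h \<in> carrier G" for h k
    using flag_map_mult_G[OF base, of h k] by (metis flag_elem_flag_map)
  have "inj_on (\<lambda>n::nat. (w [^] n) ?e) {..<ord w}"
  proof (rule linorder_inj_onI')
    fix m n :: nat assume mn: "m \<in> {..<ord w}" "n \<in> {..<ord w}" "m < n"
    show "(w [^] m) ?e \<noteq> (w [^] n) ?e"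
    proof
      assume eq: "(w [^] m) ?e = (w [^] n) ?e"
      have "w [^] n = w [^] (n - m) \<otimes> w [^] m" using w mn by (simp add: nat_pow_mult)
      then have "(w [^] n) ?e = (w [^] m) ((w [^] (n - m)) ?e)" using app w by simp
      then have "(w [^] m) ((w [^] (n - m)) ?e) = (w [^] m) ?e" using eq by simp
      moreover have "inj_on (w [^] m) (elems P)"
        using automorphismsD(2)[OF carrier_G_aut[of "w [^] m"]] w by (simp add: bij_betw_def)
      moreover have "(w [^] (n - m)) ?e \<in> elems P" using e_aut[of "int (n - m)"] by (simp add: int_pow_int of_rank_def)
      moreover have "?e \<in> elems P" using flag_elem_in_elems[OF base, of 1] by simp
      ultimately have "(w [^] (n - m)) ?e = ?e" by (meson inj_onD)
      moreover have "n - m < ord w" using mn by simp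
      ultimately have "n - m = 0" by (intro inj)
      then show False using mn by simp
    qed
  qed
  then have "card ?E = ord w" by (simp add: card_image)
  moreover have "{e \<in> edges P. incident P e ?a} = ?E"
  proof (rule equalityI; rule subsetI)
    fix e assume "e \<in> ?E"
    then obtain n :: nat where "e = (w [^] n) ?e" by blast
    then show "e \<in> {e \<in> edges P. incident P e ?a}" using e_aut[of "int n"] by (simp add: int_pow_int)
  next
    fix e assume e: "e \<in> {e \<in> edges P. incident P e ?a}"
    have rk: "rk P e = 1" "rk P ?a = i" "e \<in> elems P" "?a \<in> elems P"
      using e flag_elem_in_elems[OF base ij(1)] by (auto simp: of_rank_def)
    have "\<exists>\<Psi>\<in>flags P. flag_elem \<Psi> (rk P e) = e \<and> flag_elem \<Psi> (rk P ?a) = ?a"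
      by (rule ex_flag_of_incident) (use e rk ij in auto)
    then obtain \<Psi> where P: "\<Psi> \<in> flags P" "flag_elem \<Psi> 1 = e" "?a = flag_elem \<Psi> i" using rk by auto
    obtain n :: int where "\<Psi> = flag_map (w [^] n) \<Phi> \<or> \<Psi> = flag_map (w [^] n) (flag_adj P \<Phi> j)"
      using orbit[OF P(1,3)] by blast
    then have "e = (w [^] n) ?e" using P(2) same[of j 1] ij by auto
    also have "w [^] n = w [^] nat (n mod int (ord w))"
      using int_pow_eq_nat_pow[OF w _ ordw] pow_ord_eq_1[OF w] by simp
    finally have "e = (w [^] nat (n mod int (ord w))) ?e" .
    moreover have "nat (n mod int (ord w)) \<in> {..<ord w}" using ordw by (simp add: nat_less_iff)
    ultimately show "e \<in> ?E" by (rule image_eqI)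
  qed
  ultimately show "card {e \<in> edges P. incident P e ?a} = ord w" by simp
qed

lemma ord_x: "ord x = p" and x_fixes: "x (flag_elem \<Phi> 2) = flag_elem \<Phi> 2"
proof -
  note c = card_edges_at[OF x_in, of 2 0, OF _ adj_1']
  have "flag_elem \<Phi> 2 \<in> faces P" using flag_elem_in_elems[OF base, of 2] by (simp add: of_rank_def)
  then have "card {e \<in> edges P. incident P e (flag_elem \<Phi> 2)} = p"
    using tight by (simp add: tight_of_type_def has_type_def)
  then show "ord x = p" "x (flag_elem \<Phi> 2) = flag_elem \<Phi> 2" using c by simp_all
qed

lemma ord_y: "ord y = q" and y_fixes: "y (flag_elem \<Phi> 0) = flag_elem \<Phi> 0"
proof -
  have iy: "inv y \<in> carrier G" using y_in by simp
  note c = card_edges_at[OF iy, of 0 2, OF _ adj_1]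
  have "flag_elem \<Phi> 0 \<in> vertices P" using flag_elem_in_elems[OF base, of 0] by (simp add: of_rank_def)
  then have "card {e \<in> edges P. incident P e (flag_elem \<Phi> 0)} = q"
    using tight by (simp add: tight_of_type_def has_type_def)
  then show "ord y = q" using c(1) y_in by simp
  have "(inv y) (flag_elem \<Phi> 0) = flag_elem \<Phi> 0" using c(2) by simp
  then have "(inv y [^] (- 1 :: int)) (flag_elem \<Phi> 0) = flag_elem \<Phi> 0"
    by (intro pow_fixes iy) simp_all
  then show "y (flag_elem \<Phi> 0) = flag_elem \<Phi> 0" using y_in by (simp add: int_pow_neg)
qed

lemma pq_pos: "p > 0" "q > 0"
  using ord_ge_1[OF finite_G x_in] ord_ge_1[OF finite_G y_in] ord_x ord_y by simp_all

text \<open>A common value fixes the base face as a power of x and the base vertex as a power of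
  y.\<close>

lemma x_pow_eq_y_pow:
  fixes i j :: int
  assumes "x [^] i = y [^] j"
  shows "x [^] i = \<one>"
proof (rule eq_one_of_fixes[of _ 1])
  show "(x [^] i) (flag_elem \<Phi> l) = flag_elem \<Phi> l" if "l \<in> {0, 1, 2}" "l \<noteq> 1" for l
    using that pow_fixes[OF x_in _ x_fixes, of i] pow_fixes[OF y_in _ y_fixes, of j] assms by auto
qed (use x_in in simp_all)

text \<open>The pq products with reduced exponents are distinct by \<open>x_pow_eq_y_pow\<close>,
  and tightness gives the group only pq elements.\<close>

lemma normal_form:
  assumes "g \<in> carrier G"
  shows "\<exists>(i::nat) (j::nat). g = x [^] i \<otimes> y [^] j"
proof -
  let ?f = "\<lambda>(i, j). x [^] i \<otimes> y [^] j" and ?I = "{..<p} \<times> {..<q}"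
  have "inj_on ?f ?I"
  proof (rule inj_onI)
    fix a b assume "a \<in> ?I" "b \<in> ?I" and eq: "?f a = ?f b"
    then obtain i j k l where ab: "a = (i, j)" "b = (k, l)" "i < p" "j < q" "k < p" "l < q" by auto
    have c: "x [^] i \<otimes> y [^] j = x [^] k \<otimes> y [^] l" using eq ab by simp
    have "x [^] (int i - int k) = x [^] (- int k + int i)" by (simp add: algebra_simps)
    also have "\<dots> = inv (x [^] k) \<otimes> x [^] i"
      unfolding int_pow_mult[OF x_in] int_pow_neg_int[OF x_in] int_pow_int ..
    also have "\<dots> = inv (x [^] k) \<otimes> (x [^] i \<otimes> y [^] j) \<otimes> inv (y [^] j)" using x_in y_in by (simp add: m_assoc)
    also have "\<dots> = y [^] l \<otimes> inv (y [^] j)" unfolding c using x_in y_in by (simp add: m_assoc)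
    also have "\<dots> = y [^] (int l - int j)" using y_in by (simp add: int_pow_diff int_pow_int)
    finally have xy: "x [^] (int i - int k) = y [^] (int l - int j)" .
    have x1: "x [^] (int i - int k) = \<one>" using x_pow_eq_y_pow[OF xy] .
    have y1: "y [^] (int l - int j) = \<one>" using x1 xy by simp
    have "int p dvd int i - int k" "int q dvd int l - int j"
      using int_pow_eq_id[OF x_in, THEN iffD1, OF x1] int_pow_eq_id[OF y_in, THEN iffD1, OF y1] ord_x ord_y
      by simp_all
    then have "int i mod int p = int k mod int p" "int l mod int q = int j mod int q"
      by (simp_all add: mod_eq_dvd_iff)
    then show "a = b" using ab by simp
  qed
  then have "card (?f ` ?I) = card (carrier G)" by (simp add: card_image card_cartesian_product card_G)
  moreover have "?f ` ?I \<subseteq> carrier G" by (rule image_subsetI) (simp add: case_prod_beta x_in y_in)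
  ultimately have "?f ` ?I = carrier G" using finite_G by (simp add: card_subset_eq)
  then have "g \<in> ?f ` ?I" using assms by simp
  then show ?thesis by auto
qed

lemma rotary_flags: "rotary_flags P G x y p q Fp Fm"
proof -
  have tg: "tight_group G x y p q"
  proof (unfold_locales)
    show "x [^] p = \<one>" "y [^] q = \<one>" using pow_ord_eq_1[OF x_in] pow_ord_eq_1[OF y_in] ord_x ord_y by simp_all
  qed (use x_in y_in pq_pos z_square normal_form card_G in simp_all)
  show ?thesis
  proof (rule rotary_flags.intro[OF poly_axioms tg], unfold_locales)
    show "Fp g \<noteq> Fm h" if "g \<in> carrier G" "h \<in> carrier G" for g h by (rule disjoint[OF that])
  qed (fact flags_eq inj_Fp inj_Fm | erule adj_Fp)+
qed

end

section \<open>The coset polyhedron of a tight group\<close>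

text \<open>Vertices, edges and faces are the right cosets of \<open>\<langle>y\<rangle>\<close>, \<open>\<langle>x y\<rangle>\<close> and \<open>\<langle>x\<rangle>\<close>, the coset of
  \<open>g\<close> at rank \<open>i\<close> being named \<open>enc i g\<close>; two of them are incident iff they meet.\<close>

locale coset_polyhedron = tight_group G x y p q for G (structure) and x y and p q :: nat +
  fixes P :: "'c ranked_poset" and enc :: "nat \<Rightarrow> 'a \<Rightarrow> 'c"
  assumes p2: "2 < p" and q2: "2 < q"
    and elems_P: "elems P = {enc i g | i g. i \<in> {0, 1, 2} \<and> g \<in> carrier G}"
    and le_P: "le_rel P = {(enc i g, enc j g) | i j g. i \<in> {0, 1, 2} \<and> j \<in> {0, 1, 2} \<and> i \<le> j \<and> g \<in> carrier G}"
    and rk_enc: "i \<in> {0, 1, 2} \<Longrightarrow> g \<in> carrier G \<Longrightarrow> rk P (enc i g) = i"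
    and enc_0: "g \<in> carrier G \<Longrightarrow> h \<in> carrier G \<Longrightarrow> enc 0 g = enc 0 h \<longleftrightarrow> (\<exists>n::int. h = y [^] n \<otimes> g)"
    and enc_1: "g \<in> carrier G \<Longrightarrow> h \<in> carrier G \<Longrightarrow> enc 1 g = enc 1 h \<longleftrightarrow> h = g \<or> h = (x \<otimes> y) \<otimes> g"
    and enc_2: "g \<in> carrier G \<Longrightarrow> h \<in> carrier G \<Longrightarrow> enc 2 g = enc 2 h \<longleftrightarrow> (\<exists>n::int. h = x [^] n \<otimes> g)"
begin

abbreviation "z \<equiv> x \<otimes> y"

lemma x_neq_y_pow: "x \<noteq> y [^] (n::int)"
proof
  assume "x = y [^] n"
  then have "x [^] (1::int) = \<one>" by (intro x_pow_eq_y_pow[of _ n]) simp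
  then show False using ord_x p2 by simp
qed

lemma y_neq_x_pow: "y \<noteq> x [^] (n::int)"
proof
  assume y: "y = x [^] n"
  then have "x [^] n = \<one>" by (intro x_pow_eq_y_pow[of _ 1]) simp
  then have "y = \<one>" using y by simp
  then show False using ord_y q2 by simp
qed

text \<open>Needed to tell apart the two vertices of an edge; \<open>z_neq_x_pow\<close> does the
  same for its two faces.\<close>

lemma z_neq_y_pow: "z \<noteq> y [^] (n::int)"
proof
  assume z: "z = y [^] n"
  have "x = z \<otimes> inv y" by (simp add: m_assoc)
  also have "\<dots> = y [^] (n - 1)" unfolding z by (simp add: int_pow_diff)
  finally show False using x_neq_y_pow by blast
qed

lemma z_neq_x_pow: "z \<noteq> x [^] (n::int)"
proof
  assume z: "z = x [^] n"
  have "y = inv x \<otimes> z" by simp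
  also have "\<dots> = x [^] (- 1 + n)" unfolding z int_pow_mult[OF x_in] by (simp add: int_pow_neg)
  finally show False using y_neq_x_pow by blast
qed

lemma enc_y_pow: "g \<in> carrier G \<Longrightarrow> enc 0 (y [^] (n::int) \<otimes> g) = enc 0 g"
  using enc_0[of g "y [^] n \<otimes> g"] by auto

lemma enc_x_pow: "g \<in> carrier G \<Longrightarrow> enc 2 (x [^] (n::int) \<otimes> g) = enc 2 g"
  using enc_2[of g "x [^] n \<otimes> g"] by auto

lemma enc_z: "g \<in> carrier G \<Longrightarrow> enc 1 (z \<otimes> g) = enc 1 g"
  using enc_1[of g "z \<otimes> g"] by auto

lemma enc_inv_y: "g \<in> carrier G \<Longrightarrow> enc 0 (inv y \<otimes> g) = enc 0 g"
  using enc_y_pow[of g "- 1"] by (simp add: int_pow_neg)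

lemma enc_x: "g \<in> carrier G \<Longrightarrow> enc 2 (x \<otimes> g) = enc 2 g"
  using enc_x_pow[of g 1] by simp

lemma enc_0_z: "g \<in> carrier G \<Longrightarrow> enc 0 (z \<otimes> g) \<noteq> enc 0 g"
proof
  assume g: "g \<in> carrier G" and "enc 0 (z \<otimes> g) = enc 0 g"
  then obtain n :: int where "z \<otimes> g = y [^] n \<otimes> g" using enc_0[of g "z \<otimes> g"] by auto
  then have "z = y [^] n" using g by simp
  then show False using z_neq_y_pow by blast
qed

lemma enc_2_z: "g \<in> carrier G \<Longrightarrow> enc 2 (z \<otimes> g) \<noteq> enc 2 g"
proof
  assume g: "g \<in> carrier G" and "enc 2 (z \<otimes> g) = enc 2 g"
  then obtain n :: int where "z \<otimes> g = x [^] n \<otimes> g" using enc_2[of g "z \<otimes> g"] by auto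
  then have "z = x [^] n" using g by simp
  then show False using z_neq_x_pow by blast
qed

lemma enc_1_inv_y: "g \<in> carrier G \<Longrightarrow> enc 1 (inv y \<otimes> g) \<noteq> enc 1 g"
proof
  assume g: "g \<in> carrier G" and "enc 1 (inv y \<otimes> g) = enc 1 g"
  then have "inv y \<otimes> g = \<one> \<otimes> g \<or> inv y \<otimes> g = z \<otimes> g" using enc_1[of g "inv y \<otimes> g"] by auto
  then have "inv y = \<one> \<or> inv y = z" using g by (simp only: right_cancel inv_closed one_closed m_closed x_in y_in)
  then have "z = y [^] (- 1 :: int) \<or> y = x [^] (0::int)" by (auto simp: int_pow_neg)
  then show False using z_neq_y_pow y_neq_x_pow by blast
qed

text \<open>A right coset of the group of y and one of the group of x share at most one element,
  since the two groups meet trivially.\<close>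

lemma enc_0_2: "g \<in> carrier G \<Longrightarrow> h \<in> carrier G \<Longrightarrow> enc 0 g = enc 0 h \<Longrightarrow> enc 2 g = enc 2 h \<Longrightarrow> g = h"
proof -
  assume g: "g \<in> carrier G" and h: "h \<in> carrier G" and e: "enc 0 g = enc 0 h" "enc 2 g = enc 2 h"
  obtain n m :: int where nm: "h = y [^] n \<otimes> g" "h = x [^] m \<otimes> g" using e enc_0[OF g h] enc_2[OF g h] by blast
  then have "x [^] m = y [^] n" using g by simp
  then have "x [^] m = \<one>" by (rule x_pow_eq_y_pow)
  then show "g = h" using nm(2) g by simp
qed

text \<open>Because all elements are products x^i y^j, every right coset of the group of y meets
  every right coset of the group of x: in a tight polyhedron each vertex is incident to each
  face.\<close>

lemma common_element:
  assumes g: "g \<in> carrier G" and h: "h \<in> carrier G"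
  shows "\<exists>k\<in>carrier G. enc 0 g = enc 0 k \<and> enc 2 h = enc 2 k"
proof -
  have "h \<otimes> inv g \<in> carrier G" using g h by simp
  then obtain i j :: nat where ij: "h \<otimes> inv g = x [^] i \<otimes> y [^] j" using normal_form by metis
  have "h = (h \<otimes> inv g) \<otimes> g" using g h by (simp add: m_assoc)
  also have "\<dots> = x [^] int i \<otimes> (y [^] int j \<otimes> g)" unfolding ij int_pow_int using g by (simp add: m_assoc)
  finally have "h = x [^] int i \<otimes> (y [^] int j \<otimes> g)" .
  then have "enc 2 h = enc 2 (y [^] int j \<otimes> g)" using enc_x_pow[of "y [^] int j \<otimes> g" "int i"] g by simp
  moreover have "enc 0 g = enc 0 (y [^] int j \<otimes> g)" using enc_y_pow[OF g] by simp
  ultimately show ?thesis using g by (intro bexI[of _ "y [^] int j \<otimes> g"]) simp_all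
qed

lemma of_rank_P: "i \<in> {0, 1, 2} \<Longrightarrow> of_rank P i = enc i ` carrier G"
proof -
  assume i: "i \<in> {0, 1, 2}"
  show ?thesis
  proof (rule equalityI; rule subsetI)
    fix a assume "a \<in> of_rank P i"
    then obtain j g where "a = enc j g" "j \<in> {0, 1, 2}" "g \<in> carrier G" "rk P a = i"
      unfolding of_rank_def elems_P by blast
    then show "a \<in> enc i ` carrier G" using rk_enc by auto
  next
    fix a assume "a \<in> enc i ` carrier G"
    then show "a \<in> of_rank P i" using i rk_enc unfolding of_rank_def elems_P by auto
  qed
qed

lemma incident_iff:
  assumes i: "i \<in> {0, 1, 2}" "j \<in> {0, 1, 2}" and g: "g \<in> carrier G" "h \<in> carrier G"
  shows "incident P (enc i g) (enc j h) \<longleftrightarrow> (\<exists>k\<in>carrier G. enc i g = enc i k \<and> enc j h = enc j k)"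
proof
  assume "incident P (enc i g) (enc j h)"
  then obtain i' j' k where k: "k \<in> carrier G" "i' \<in> {0, 1, 2}" "j' \<in> {0, 1, 2}"
    "enc i g = enc i' k \<and> enc j h = enc j' k \<or> enc i g = enc j' k \<and> enc j h = enc i' k"
    unfolding incident_def le_P by blast
  have "(rk P (enc i g) = i \<and> rk P (enc j h) = j) \<and> rk P (enc i' k) = i' \<and> rk P (enc j' k) = j'"
    using rk_enc i g k(1-3) by simp
  then show "\<exists>k\<in>carrier G. enc i g = enc i k \<and> enc j h = enc j k" using k(1,4) by metis
next
  assume "\<exists>k\<in>carrier G. enc i g = enc i k \<and> enc j h = enc j k"
  then obtain k where k: "k \<in> carrier G" "enc i g = enc i k" "enc j h = enc j k" by blast
  have "i \<le> j \<or> j \<le> i" by linarith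
  then show "incident P (enc i g) (enc j h)"
    unfolding incident_def le_P k(2,3) using i k(1) by blast
qed

lemma incident_0_2: "g \<in> carrier G \<Longrightarrow> h \<in> carrier G \<Longrightarrow> incident P (enc 0 g) (enc 2 h)"
  using incident_iff[of 0 2 g h] common_element[of g h] by simp

lemma incident_1:
  assumes i: "i \<in> {0, 1, 2}" and g: "g \<in> carrier G" and h: "h \<in> carrier G"
  shows "incident P (enc i g) (enc 1 h) \<longleftrightarrow> enc i g = enc i h \<or> enc i g = enc i (z \<otimes> h)"
    "incident P (enc 1 h) (enc i g) \<longleftrightarrow> enc i g = enc i h \<or> enc i g = enc i (z \<otimes> h)"
proof -
  have zh: "z \<otimes> h \<in> carrier G" using h by simp
  show "incident P (enc i g) (enc 1 h) \<longleftrightarrow> enc i g = enc i h \<or> enc i g = enc i (z \<otimes> h)"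
  proof -
    have "incident P (enc i g) (enc 1 h) \<longleftrightarrow> (\<exists>k\<in>carrier G. enc i g = enc i k \<and> enc 1 h = enc 1 k)"
      using incident_iff[of i 1 g h] i g h by simp
    also have "\<dots> \<longleftrightarrow> enc i g = enc i h \<or> enc i g = enc i (z \<otimes> h)"
      using enc_1[OF h] h zh by blast
    finally show ?thesis .
  qed
  then show "incident P (enc 1 h) (enc i g) \<longleftrightarrow> enc i g = enc i h \<or> enc i g = enc i (z \<otimes> h)"
    using incident_sym[of P "enc 1 h"] by simp
qed

lemma edge_at:
  assumes "e \<in> edges P" and i: "i \<in> {0, 1, 2}" and g: "g \<in> carrier G" and "incident P e (enc i g)"
  shows "\<exists>h\<in>carrier G. e = enc 1 h \<and> enc i g = enc i h"
proof -
  obtain h where h: "h \<in> carrier G" "e = enc 1 h" using assms(1) of_rank_P[of 1] by auto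
  then have "enc i g = enc i h \<or> enc i g = enc i (z \<otimes> h)" using incident_1(2)[OF i g h(1)] assms(4) by simp
  then show ?thesis using h enc_z[OF h(1)] by (metis m_closed x_in y_in)
qed

lemma partial_order_P: "partial_order_on (elems P) (le_rel P)"
  unfolding partial_order_on_def preorder_on_def
proof (intro conjI)
  show "le_rel P \<subseteq> elems P \<times> elems P" unfolding le_P elems_P by blast
  show "refl_on (elems P) (le_rel P)" unfolding refl_on_def le_P elems_P by blast
  show "antisym (le_rel P)"
  proof (rule antisymI)
    fix a b assume "(a, b) \<in> le_rel P" "(b, a) \<in> le_rel P"
    then obtain i j g i' j' g' where *: "a = enc i g" "b = enc j g" "b = enc i' g'" "a = enc j' g'"
      "i \<le> j" "i' \<le> j'" "i \<in> {0, 1, 2}" "j \<in> {0, 1, 2}" "i' \<in> {0, 1, 2}" "j' \<in> {0, 1, 2}"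
      "g \<in> carrier G" "g' \<in> carrier G" unfolding le_P by blast
    have "rk P a = i" "rk P b = j" using *(1,2,7,8,11) rk_enc by simp_all
    moreover have "rk P b = i'" "rk P a = j'" using *(3,4,9,10,12) rk_enc by simp_all
    ultimately have "i = j" using *(5,6) by simp
    then show "a = b" using *(1,2) by simp
  qed
  show "trans (le_rel P)"
  proof (rule transI)
    fix a b c assume "(a, b) \<in> le_rel P" "(b, c) \<in> le_rel P"
    then obtain i j g i' j' g' where *: "a = enc i g" "b = enc j g" "b = enc i' g'" "c = enc j' g'"
      "i \<le> j" "i' \<le> j'" "i \<in> {0, 1, 2}" "j \<in> {0, 1, 2}" "i' \<in> {0, 1, 2}" "j' \<in> {0, 1, 2}"
      "g \<in> carrier G" "g' \<in> carrier G" unfolding le_P by blast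
    have "rk P b = j" using rk_enc[OF *(8,11)] *(2) by simp
    moreover have "rk P b = i'" using rk_enc[OF *(9,12)] *(3) by simp
    ultimately have ij: "i' = j" by simp
    have "incident P (enc i g) (enc j' g')"
    proof -
      \<comment> \<open>A chain either repeats a rank or runs from a vertex to a face, and these are
        always incident.\<close>
      consider "i = j" | "j = j'" | "i = 0" "j' = 2" using *(5-10) ij by auto
      then show ?thesis
      proof cases
        case 1
        then have "enc i g = enc i g'" using *(2,3) ij by simp
        then show ?thesis using incident_iff[OF *(7,10,11,12)] *(12) by blast
      next
        case 2
        then have "enc j' g' = enc j' g" using *(2,3) ij by simp
        then show ?thesis using incident_iff[OF *(7,10,11,12)] *(11) by blast
      next
        case 3
        then show ?thesis using incident_0_2 *(11,12) by simp
      qed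
    qed
    then obtain k where "k \<in> carrier G" "enc i g = enc i k" "enc j' g' = enc j' k"
      using incident_iff[OF *(7,10,11,12)] by blast
    moreover have "i \<le> j'" using *(5,6) ij by simp
    ultimately show "(a, c) \<in> le_rel P" unfolding le_P *(1,4) using *(7,10) by blast
  qed
qed

section \<open>The counts equal to 2 in the coset polyhedron\<close>

text \<open>Let k be the common element of v and f. An edge at v is named by some l in v, and it
  meets f when l or z l lies in f. The first means l = k; the second means y l = k, because z l = x
  (y l).\<close>

lemma card_edges_between_P:
  assumes "v \<in> vertices P" "f \<in> faces P"
  shows "card {e \<in> edges P. incident P e v \<and> incident P e f} = 2"
proof -
  obtain g h where gh: "g \<in> carrier G" "h \<in> carrier G" "v = enc 0 g" "f = enc 2 h"
    using assms of_rank_P[of 0] of_rank_P[of 2] by auto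
  obtain k where k: "k \<in> carrier G" "v = enc 0 k" "f = enc 2 k" using common_element[OF gh(1,2)] gh(3,4) by metis
  have iyk: "inv y \<otimes> k \<in> carrier G" using k(1) by simp
  have zy: "z \<otimes> (inv y \<otimes> k) = x \<otimes> k" using k(1) by (simp add: m_assoc)
  have "{e \<in> edges P. incident P e v \<and> incident P e f} = {enc 1 k, enc 1 (inv y \<otimes> k)}"
  proof (rule equalityI; rule subsetI)
    fix e assume "e \<in> {enc 1 k, enc 1 (inv y \<otimes> k)}"
    moreover have "enc 1 k \<in> edges P" "enc 1 (inv y \<otimes> k) \<in> edges P" using of_rank_P[of 1] k(1) iyk by auto
    moreover have "incident P (enc 1 k) v" "incident P (enc 1 k) f"
      using incident_1(2)[of 0 k k] incident_1(2)[of 2 k k] k by simp_all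
    moreover have "incident P (enc 1 (inv y \<otimes> k)) v" "incident P (enc 1 (inv y \<otimes> k)) f"
      using incident_1(2)[of 0 k "inv y \<otimes> k"] incident_1(2)[of 2 k "inv y \<otimes> k"] k iyk
        enc_inv_y[OF k(1)] enc_x[OF k(1)] zy by simp_all
    ultimately show "e \<in> {e \<in> edges P. incident P e v \<and> incident P e f}" by blast
  next
    fix e assume e: "e \<in> {e \<in> edges P. incident P e v \<and> incident P e f}"
    then obtain l where l: "l \<in> carrier G" "e = enc 1 l" "enc 0 k = enc 0 l"
      using edge_at[of e 0 k] k by auto
    have "enc 2 k = enc 2 l \<or> enc 2 k = enc 2 (z \<otimes> l)"
      using e incident_1(2)[of 2 k l] k l by simp
    then show "e \<in> {enc 1 k, enc 1 (inv y \<otimes> k)}"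
    proof
      assume "enc 2 k = enc 2 l"
      then have "k = l" using enc_0_2[OF k(1) l(1) l(3)] by simp
      then show ?thesis using l(2) by simp
    next
      assume a: "enc 2 k = enc 2 (z \<otimes> l)"
      have "enc 2 k = enc 2 (inv x \<otimes> (z \<otimes> l))"
        using a enc_x_pow[of "z \<otimes> l" "- 1"] l(1) by (simp add: int_pow_neg)
      moreover have "inv x \<otimes> (z \<otimes> l) = y \<otimes> l" using l(1) by (simp add: m_assoc)
      moreover have "enc 0 (y \<otimes> l) = enc 0 k" using enc_y_pow[of l 1] l by simp
      ultimately have "k = y \<otimes> l" using enc_0_2[of k "y \<otimes> l"] k(1) l(1) by simp
      then have "inv y \<otimes> k = l" using l(1) by simp
      then show ?thesis using l(2) by simp
    qed
  qed
  then show ?thesis using enc_1_inv_y[OF k(1)] by simp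
qed

lemma card_ends_P:
  assumes "e \<in> edges P" "i = 0 \<or> i = 2"
  shows "card {v \<in> of_rank P i. incident P v e} = 2"
proof -
  have i: "i \<in> {0, 1, 2}" using assms(2) by auto
  obtain g where g: "g \<in> carrier G" "e = enc 1 g" using assms(1) of_rank_P[of 1] by auto
  have zg: "z \<otimes> g \<in> carrier G" using g by simp
  have "{v \<in> of_rank P i. incident P v e} = {enc i g, enc i (z \<otimes> g)}"
  proof (rule equalityI; rule subsetI)
    fix v assume "v \<in> {v \<in> of_rank P i. incident P v e}"
    then show "v \<in> {enc i g, enc i (z \<otimes> g)}" using incident_1(1)[OF i _ g(1)] g(2) of_rank_P[OF i] by auto
  next
    fix v assume "v \<in> {enc i g, enc i (z \<otimes> g)}"
    then show "v \<in> {v \<in> of_rank P i. incident P v e}"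
      using incident_1(1)[OF i g(1) g(1)] incident_1(1)[OF i zg g(1)] g zg of_rank_P[OF i] by auto
  qed
  then show ?thesis using assms(2) enc_0_z[OF g(1)] enc_2_z[OF g(1)] by auto
qed

section \<open>Connectedness of the coset polyhedron and of its links\<close>

lemma sym_incidence: "sym {(a, b). a \<in> S \<and> b \<in> S \<and> incident P a b}"
  using incident_sym by (force simp: sym_def)

lemma incidence_connectedI:
  assumes "c \<in> S" "\<And>a. a \<in> S \<Longrightarrow> (c, a) \<in> {(a, b). a \<in> S \<and> b \<in> S \<and> incident P a b}\<^sup>*"
  shows "incidence_connected P S"
  unfolding incidence_connected_def
proof (intro conjI ballI)
  show "S \<noteq> {}" using assms(1) by blast
  fix a b assume "a \<in> S" "b \<in> S"
  have "(a, c) \<in> {(a, b). a \<in> S \<and> b \<in> S \<and> incident P a b}\<^sup>*"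
    using assms(2)[OF \<open>a \<in> S\<close>] sym_rtrancl[OF sym_incidence] by (meson symE)
  then show "(a, b) \<in> {(a, b). a \<in> S \<and> b \<in> S \<and> incident P a b}\<^sup>*"
    using assms(2)[OF \<open>b \<in> S\<close>] by (rule rtrancl_trans)
qed

lemma enc_in_elems: "i \<in> {0, 1, 2} \<Longrightarrow> g \<in> carrier G \<Longrightarrow> enc i g \<in> elems P"
  unfolding elems_P by blast

lemma elems_cases:
  assumes "a \<in> elems P"
  obtains i g where "i = 0 \<or> i = 1 \<or> i = (2::nat)" "g \<in> carrier G" "a = enc i g"
  using assms unfolding elems_P by auto

lemma enc_rank_neq: "i \<in> {0, 1, 2} \<Longrightarrow> j \<in> {0, 1, 2} \<Longrightarrow> i \<noteq> j \<Longrightarrow> g \<in> carrier G \<Longrightarrow> h \<in> carrier G \<Longrightarrow>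
    enc i g \<noteq> enc j h"
  using rk_enc by metis

text \<open>Vertices and faces form a complete bipartite graph, to which each edge is attached by
  one of its vertices.\<close>

lemma elems_connected_P: "incidence_connected P (elems P)"
proof (rule incidence_connectedI)
  let ?R = "{(a, b). a \<in> elems P \<and> b \<in> elems P \<and> incident P a b}"
  show "enc 0 \<one> \<in> elems P" by (rule enc_in_elems) simp_all
  have el: "enc 0 g \<in> elems P" "enc 1 g \<in> elems P" "enc 2 g \<in> elems P" if "g \<in> carrier G" for g
    using that by (auto intro: enc_in_elems)
  have 2: "(enc 0 h, enc 2 g) \<in> ?R" "(enc 2 g, enc 0 h) \<in> ?R" if "g \<in> carrier G" "h \<in> carrier G" for g h
    using incident_0_2[OF that(2,1)] incident_sym[of P "enc 2 g"] el that by simp_all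
  have 0: "(enc 0 \<one>, enc 0 g) \<in> ?R\<^sup>*" if "g \<in> carrier G" for g
    by (rule rtrancl_trans[OF r_into_rtrancl[OF 2(1)[OF one_closed one_closed]] r_into_rtrancl[OF 2(2)[OF one_closed that]]])
  fix a assume "a \<in> elems P"
  then show "(enc 0 \<one>, a) \<in> ?R\<^sup>*"
  proof (rule elems_cases)
    fix i g assume i: "i = 0 \<or> i = 1 \<or> i = (2::nat)" and g: "g \<in> carrier G" "a = enc i g"
    have "(enc 0 g, enc 1 g) \<in> ?R" using incident_1(1)[of 0 g g] g el by simp
    then have 1: "(enc 0 \<one>, enc 1 g) \<in> ?R\<^sup>*" by (rule rtrancl_into_rtrancl[OF 0[OF g(1)]])
    show ?thesis unfolding g(2)
      using i 0[OF g(1)] 1 r_into_rtrancl[OF 2(1)[OF g(1) one_closed]] by (elim disjE) (simp_all only:)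
  qed
qed

lemma in_neighbours:
  assumes "i \<in> {0, 1, 2}" "j \<in> {0, 1, 2}" "i \<noteq> j" "g \<in> carrier G" "h \<in> carrier G" "incident P (enc i g) (enc j h)"
  shows "enc j h \<in> neighbours P (enc i g)"
  unfolding neighbours_def using assms enc_in_elems[OF assms(2,5)] enc_rank_neq[OF assms(1-5)] by simp

text \<open>A walk around the vertex: the edge of y^n g meets the face of y^n g, and also the face
  of y^(n+1) g because z y^n g = x y^(n+1) g. As y has finite order, nonnegative n reach all edges
  and faces there.\<close>

lemma link_vertex_connected:
  assumes g: "g \<in> carrier G"
  shows "incidence_connected P (neighbours P (enc 0 g))"
proof (rule incidence_connectedI)
  let ?S = "neighbours P (enc 0 g)"
  let ?R = "{(a, b). a \<in> ?S \<and> b \<in> ?S \<and> incident P a b}"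
  have yg: "y [^] n \<otimes> g \<in> carrier G" for n :: nat using g by simp
  have f: "enc 2 h \<in> ?S" if "h \<in> carrier G" for h
    using in_neighbours[of 0 2 g h] incident_0_2[OF g that] g that by simp
  have e: "enc 1 (y [^] n \<otimes> g) \<in> ?S" for n :: nat
    using in_neighbours[of 0 1 g "y [^] n \<otimes> g"] incident_1(1)[of 0 g "y [^] n \<otimes> g"] g yg
      enc_y_pow[OF g, of "int n"] by (simp add: int_pow_int)
  show "enc 2 g \<in> ?S" using f[OF g] .
  have ef: "(enc 1 (y [^] n \<otimes> g), enc 2 (y [^] n \<otimes> g)) \<in> ?R" "(enc 2 (y [^] n \<otimes> g), enc 1 (y [^] n \<otimes> g)) \<in> ?R" for n :: nat
    using incident_1[of 2 "y [^] n \<otimes> g" "y [^] n \<otimes> g"] yg[of n] e[of n] f[OF yg[of n]] by simp_all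
  have ef': "(enc 1 (y [^] n \<otimes> g), enc 2 (y [^] Suc n \<otimes> g)) \<in> ?R" for n :: nat
  proof -
    have "z \<otimes> (y [^] n \<otimes> g) = x \<otimes> (y [^] Suc n \<otimes> g)" unfolding nat_pow_Suc2[OF y_in] using g by (simp add: m_assoc)
    then have "enc 2 (y [^] Suc n \<otimes> g) = enc 2 (z \<otimes> (y [^] n \<otimes> g))" using enc_x[OF yg[of "Suc n"]] by simp
    then have "incident P (enc 1 (y [^] n \<otimes> g)) (enc 2 (y [^] Suc n \<otimes> g))"
      using incident_1(2)[of 2, OF _ yg[of "Suc n"] yg[of n]] by blast
    then show ?thesis using e[of n] f[OF yg[of "Suc n"]] by simp
  qed
  have F: "(enc 2 g, enc 2 (y [^] n \<otimes> g)) \<in> ?R\<^sup>*" for n :: nat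
  proof (induction n)
    case 0
    then show ?case using g by simp
  next
    case (Suc n)
    show ?case by (rule rtrancl_into_rtrancl[OF rtrancl_into_rtrancl[OF Suc ef(2)] ef'])
  qed
  have E: "(enc 2 g, enc 1 (y [^] n \<otimes> g)) \<in> ?R\<^sup>*" for n :: nat
    using F[of n] ef(2)[of n] by (rule rtrancl_into_rtrancl)
  have nat: "\<exists>n::nat. h = y [^] n \<otimes> g" if h: "h \<in> carrier G" "enc 0 g = enc 0 h" for h
  proof -
    obtain n :: int where "h = y [^] n \<otimes> g" using enc_0[OF g h(1)] h(2) by blast
    then show ?thesis using int_pow_eq_nat_pow[OF y_in y_pow_q q_pos, of n] by auto
  qed
  fix a assume a: "a \<in> ?S"
  then have ael: "a \<in> elems P" and inc: "incident P (enc 0 g) a" and ne: "a \<noteq> enc 0 g" by (auto simp: neighbours_def)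
  from ael show "(enc 2 g, a) \<in> ?R\<^sup>*"
  proof (rule elems_cases)
    fix i h assume i: "i = 0 \<or> i = 1 \<or> i = (2::nat)" and h: "h \<in> carrier G" "a = enc i h"
    then have i3: "i \<in> {0, 1, 2}" by auto
    obtain k where k: "k \<in> carrier G" "enc 0 g = enc 0 k" "a = enc i k"
      using incident_iff[of 0 i g h] i3 g h inc by auto
    have "i \<noteq> 0" using k ne by (intro notI) simp
    obtain n :: nat where n: "k = y [^] n \<otimes> g" using nat[OF k(1,2)] by blast
    have "i = 1 \<or> i = 2" using i \<open>i \<noteq> 0\<close> by simp
    then show ?thesis unfolding k(3) n using E[of n] F[of n] by (elim disjE) (simp_all only:)
  qed
qed

text \<open>The dual walk around the face: z x = y^-1 makes the vertex of x^n g meet the edge of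
  x^(n+1) g.\<close>

lemma link_face_connected:
  assumes g: "g \<in> carrier G"
  shows "incidence_connected P (neighbours P (enc 2 g))"
proof (rule incidence_connectedI)
  let ?S = "neighbours P (enc 2 g)"
  let ?R = "{(a, b). a \<in> ?S \<and> b \<in> ?S \<and> incident P a b}"
  have xg: "x [^] n \<otimes> g \<in> carrier G" for n :: nat using g by simp
  have f: "enc 0 h \<in> ?S" if "h \<in> carrier G" for h
    using in_neighbours[of 2 0 g h] incident_0_2[OF that g] incident_sym[of P "enc 2 g" "enc 0 h"] g that by simp
  have e: "enc 1 (x [^] n \<otimes> g) \<in> ?S" for n :: nat
    using in_neighbours[of 2 1 g "x [^] n \<otimes> g"] incident_1(1)[of 2 g "x [^] n \<otimes> g"] g xg
      enc_x_pow[OF g, of "int n"] by (simp add: int_pow_int)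
  show "enc 0 g \<in> ?S" using f[OF g] .
  have ef: "(enc 0 (x [^] n \<otimes> g), enc 1 (x [^] n \<otimes> g)) \<in> ?R" "(enc 1 (x [^] n \<otimes> g), enc 0 (x [^] n \<otimes> g)) \<in> ?R" for n :: nat
    using incident_1[of 0 "x [^] n \<otimes> g" "x [^] n \<otimes> g"] xg[of n] e[of n] f[OF xg[of n]] by simp_all
  have ef': "(enc 0 (x [^] n \<otimes> g), enc 1 (x [^] Suc n \<otimes> g)) \<in> ?R" for n :: nat
  proof -
    have "z \<otimes> (x [^] Suc n \<otimes> g) = (z \<otimes> x) \<otimes> (x [^] n \<otimes> g)"
      unfolding nat_pow_Suc2[OF x_in] using g by (simp add: m_assoc)
    also have "\<dots> = inv y \<otimes> (x [^] n \<otimes> g)" by (simp only: half.inv_y_eq)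
    finally have "enc 0 (x [^] n \<otimes> g) = enc 0 (z \<otimes> (x [^] Suc n \<otimes> g))" using enc_inv_y[OF xg[of n]] by simp
    then have "incident P (enc 0 (x [^] n \<otimes> g)) (enc 1 (x [^] Suc n \<otimes> g))"
      using incident_1(1)[of 0, OF _ xg[of n] xg[of "Suc n"]] by blast
    then show ?thesis using e[of "Suc n"] f[OF xg[of n]] by simp
  qed
  have F: "(enc 0 g, enc 0 (x [^] n \<otimes> g)) \<in> ?R\<^sup>*" for n :: nat
  proof (induction n)
    case 0
    then show ?case using g by simp
  next
    case (Suc n)
    show ?case by (rule rtrancl_into_rtrancl[OF rtrancl_into_rtrancl[OF Suc ef'] ef(2)])
  qed
  have E: "(enc 0 g, enc 1 (x [^] n \<otimes> g)) \<in> ?R\<^sup>*" for n :: nat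
    using F[of n] ef(1)[of n] by (rule rtrancl_into_rtrancl)
  have nat: "\<exists>n::nat. h = x [^] n \<otimes> g" if h: "h \<in> carrier G" "enc 2 g = enc 2 h" for h
  proof -
    obtain n :: int where "h = x [^] n \<otimes> g" using enc_2[OF g h(1)] h(2) by blast
    then show ?thesis using int_pow_eq_nat_pow[OF x_in x_pow_p p_pos, of n] by auto
  qed
  fix a assume a: "a \<in> ?S"
  then have ael: "a \<in> elems P" and inc: "incident P (enc 2 g) a" and ne: "a \<noteq> enc 2 g" by (auto simp: neighbours_def)
  from ael show "(enc 0 g, a) \<in> ?R\<^sup>*"
  proof (rule elems_cases)
    fix i h assume i: "i = 0 \<or> i = 1 \<or> i = (2::nat)" and h: "h \<in> carrier G" "a = enc i h"
    then have i3: "i \<in> {0, 1, 2}" by auto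
    obtain k where k: "k \<in> carrier G" "enc 2 g = enc 2 k" "a = enc i k"
      using incident_iff[of 2 i g h] i3 g h inc by auto
    have "i \<noteq> 2" using k ne by (intro notI) simp
    obtain n :: nat where n: "k = x [^] n \<otimes> g" using nat[OF k(1,2)] by blast
    have "i = 0 \<or> i = 1" using i \<open>i \<noteq> 2\<close> by simp
    then show ?thesis unfolding k(3) n using E[of n] F[of n] by (elim disjE) (simp_all only:)
  qed
qed

lemma polyhedron_P: "polyhedron P"
  unfolding polyhedron_def
proof (intro conjI)
  show "\<forall>a\<in>elems P. rk P a \<in> {0, 1, 2}" unfolding elems_P using rk_enc by auto
  show "\<forall>a b. (a, b) \<in> le_rel P \<and> a \<noteq> b \<longrightarrow> rk P a < rk P b"
  proof (intro allI impI)
    fix a b assume "(a, b) \<in> le_rel P \<and> a \<noteq> b"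
    then obtain i j g where *: "a = enc i g" "b = enc j g" "i \<in> {0, 1, 2}" "j \<in> {0, 1, 2}" "i \<le> j" "g \<in> carrier G"
      "a \<noteq> b" unfolding le_P by blast
    then have "i \<noteq> j" by auto
    then show "rk P a < rk P b" using *(1,2,5) rk_enc[OF *(3,6)] rk_enc[OF *(4,6)] by simp
  qed
  show "\<forall>e\<in>edges P. card {v \<in> vertices P. incident P v e} = 2 \<and> card {f \<in> faces P. incident P f e} = 2"
    using card_ends_P by blast
  show "\<forall>v\<in>vertices P. \<forall>f\<in>faces P. incident P v f \<longrightarrow> card {e \<in> edges P. incident P e v \<and> incident P e f} = 2"
    using card_edges_between_P by blast
  show "\<forall>a\<in>vertices P \<union> faces P. incidence_connected P (neighbours P a)"
    using of_rank_P[of 0] of_rank_P[of 2] link_vertex_connected link_face_connected by auto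
qed (fact partial_order_P elems_connected_P)+

sublocale poly P
  by unfold_locales (rule polyhedron_P)

section \<open>Flags and type of the coset polyhedron\<close>

definition Fp :: "'a \<Rightarrow> 'c flag" where "Fp g = (enc 0 g, enc 1 g, enc 2 g)"
text \<open>The edge of g is also that of z g, so this flag has the other face on the same
  edge.\<close>

definition Fm :: "'a \<Rightarrow> 'c flag" where "Fm g = (enc 0 g, enc 1 g, enc 2 (z \<otimes> g))"

lemma Fp_Fm_in_flags:
  assumes g: "g \<in> carrier G"
  shows "Fp g \<in> flags P" "Fm g \<in> flags P"
proof -
  have zg: "z \<otimes> g \<in> carrier G" using g by simp
  have "enc 0 g \<in> vertices P" "enc 1 g \<in> edges P" "enc 2 g \<in> faces P" "enc 2 (z \<otimes> g) \<in> faces P"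
    using of_rank_P[of 0] of_rank_P[of 1] of_rank_P[of 2] g zg by auto
  moreover have "incident P (enc 0 g) (enc 1 g)" "incident P (enc 1 g) (enc 2 g)" "incident P (enc 1 g) (enc 2 (z \<otimes> g))"
    using incident_1(1)[of 0 g g] incident_1(2)[of 2 g g] incident_1(2)[of 2 "z \<otimes> g" g] g zg by simp_all
  ultimately show "Fp g \<in> flags P" "Fm g \<in> flags P" by (simp_all add: Fp_def Fm_def flags_iff)
qed

lemma z_z: "g \<in> carrier G \<Longrightarrow> z \<otimes> (z \<otimes> g) = g"
  by (rule half.z_z)

lemma flags_P: "flags P = Fp ` carrier G \<union> Fm ` carrier G"
proof (rule equalityI; rule subsetI)
  fix \<Psi> assume "\<Psi> \<in> Fp ` carrier G \<union> Fm ` carrier G"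
  then show "\<Psi> \<in> flags P" using Fp_Fm_in_flags by blast
next
  fix \<Psi> assume P: "\<Psi> \<in> flags P"
  obtain v e f where F: "\<Psi> = (v, e, f)" by (cases \<Psi>)
  have fl: "v \<in> vertices P" "e \<in> edges P" "f \<in> faces P" "incident P v e" "incident P e f"
    using P F by (simp_all add: flags_iff)
  obtain h where h: "h \<in> carrier G" "v = enc 0 h" using fl(1) of_rank_P[of 0] by auto
  obtain l where l: "l \<in> carrier G" "f = enc 2 l" using fl(3) of_rank_P[of 2] by auto
  have "incident P e (enc 0 h)" using fl(4) h incident_sym[of P v e] by simp
  then obtain g where g: "g \<in> carrier G" "e = enc 1 g" "v = enc 0 g"
    using edge_at[OF fl(2) _ h(1), of 0] h(2) by auto
  have "f = enc 2 g \<or> f = enc 2 (z \<otimes> g)" using incident_1(2)[of 2 l g] fl(5) l g by simp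
  then have "\<Psi> = Fp g \<or> \<Psi> = Fm g" using F g by (auto simp: Fp_def Fm_def)
  then show "\<Psi> \<in> Fp ` carrier G \<union> Fm ` carrier G" using g(1) by blast
qed

lemma disjoint_P: "g \<in> carrier G \<Longrightarrow> h \<in> carrier G \<Longrightarrow> Fp g \<noteq> Fm h"
proof
  assume g: "g \<in> carrier G" "h \<in> carrier G" and "Fp g = Fm h"
  then have e: "enc 0 g = enc 0 h" "enc 1 g = enc 1 h" "enc 2 g = enc 2 (z \<otimes> h)" by (simp_all add: Fp_def Fm_def)
  have "h = g \<or> h = z \<otimes> g" using e(2) enc_1[OF g] by simp
  then show False using e(1,3) enc_0_z[OF g(1)] enc_2_z[OF g(2)] by auto
qed

lemma inj_Fp_P: "inj_on Fp (carrier G)"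
  by (rule inj_onI) (auto simp: Fp_def intro: enc_0_2)

lemma inj_Fm_P: "inj_on Fm (carrier G)"
proof (rule inj_onI)
  fix g h assume g: "g \<in> carrier G" "h \<in> carrier G" and "Fm g = Fm h"
  then have e: "enc 0 g = enc 0 h" "enc 1 g = enc 1 h" by (simp_all add: Fm_def)
  have "h = g \<or> h = z \<otimes> g" using e(2) enc_1[OF g] by simp
  then show "g = h" using e(1) enc_0_z[OF g(1)] by auto
qed

lemma adj_P:
  assumes g: "g \<in> carrier G"
  shows "flag_adj P (Fp g) 0 = Fm (z \<otimes> g)" "flag_adj P (Fp g) 1 = Fm (inv y \<otimes> g)" "flag_adj P (Fp g) 2 = Fm g"
proof -
  have c: "z \<otimes> g \<in> carrier G" "inv y \<otimes> g \<in> carrier G" using g by simp_all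
  have zy: "z \<otimes> (inv y \<otimes> g) = x \<otimes> g" using g by (simp add: m_assoc)
  have "Fm (z \<otimes> g) = (enc 0 (z \<otimes> g), enc 1 g, enc 2 g)" unfolding Fm_def z_z[OF g] enc_z[OF g] ..
  then show "flag_adj P (Fp g) 0 = Fm (z \<otimes> g)"
    using Fp_Fm_in_flags(1)[OF g] Fp_Fm_in_flags(2)[OF c(1)] enc_0_z[OF g] by (intro flag_adj_eqI) (auto simp: Fp_def)
  have "Fm (inv y \<otimes> g) = (enc 0 g, enc 1 (inv y \<otimes> g), enc 2 g)" unfolding Fm_def zy enc_inv_y[OF g] enc_x[OF g] ..
  then show "flag_adj P (Fp g) 1 = Fm (inv y \<otimes> g)"
    using Fp_Fm_in_flags(1)[OF g] Fp_Fm_in_flags(2)[OF c(2)] enc_1_inv_y[OF g] by (intro flag_adj_eqI) (auto simp: Fp_def)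
  show "flag_adj P (Fp g) 2 = Fm g"
    using Fp_Fm_in_flags g enc_2_z[OF g] by (intro flag_adj_eqI) (auto simp: Fp_def Fm_def)
qed

lemma rotary_flags_P: "rotary_flags P G x y p q Fp Fm"
proof (rule rotary_flags.intro[OF poly_axioms tight_group_axioms], unfold_locales)
  show "Fp g \<noteq> Fm h" if "g \<in> carrier G" "h \<in> carrier G" for g h by (rule disjoint_P[OF that])
qed (fact flags_P inj_Fp_P inj_Fm_P | erule adj_P)+

text \<open>Edges around the element of rank i are those of w^n g, with w = x for a face and w = y
  for a vertex. They are distinct for n below the order of w, because equal edges with different
  powers would put z into the group of w.\<close>

lemma edges_at_P:
  assumes g: "g \<in> carrier G" and w: "w \<in> carrier G" "ord w = r" "r > 0" and i: "i \<in> {0, 1, 2}"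
    and enc: "\<And>h. h \<in> carrier G \<Longrightarrow> enc i g = enc i h \<longleftrightarrow> (\<exists>n::int. h = w [^] n \<otimes> g)"
    and zw: "\<And>n::int. z \<noteq> w [^] n"
  shows "finite {e \<in> edges P. incident P e (enc i g)}" "card {e \<in> edges P. incident P e (enc i g)} = r"
proof -
  let ?f = "\<lambda>n::nat. enc 1 (w [^] n \<otimes> g)"
  have wg: "w [^] n \<otimes> g \<in> carrier G" for n :: nat using w(1) g by simp
  have "{e \<in> edges P. incident P e (enc i g)} = ?f ` {..<r}"
  proof (rule equalityI; rule subsetI)
    fix e assume "e \<in> ?f ` {..<r}"
    then obtain n where n: "e = ?f n" by blast
    have "enc i g = enc i (w [^] n \<otimes> g)" using enc[OF wg[of n]] int_pow_int by metis
    then have "incident P (?f n) (enc i g)" using incident_1(2)[OF i g wg[of n]] by blast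
    moreover have "?f n \<in> edges P" using of_rank_P[of 1] wg[of n] by auto
    ultimately show "e \<in> {e \<in> edges P. incident P e (enc i g)}" using n by simp
  next
    fix e assume "e \<in> {e \<in> edges P. incident P e (enc i g)}"
    then obtain h where h: "h \<in> carrier G" "e = enc 1 h" "enc i g = enc i h" using edge_at[OF _ i g] by blast
    obtain n :: int where "h = w [^] n \<otimes> g" using enc[OF h(1)] h(3) by blast
    then have "h = w [^] nat (n mod int r) \<otimes> g"
      using int_pow_eq_nat_pow[OF w(1) _ w(3), of n] pow_ord_eq_1[OF w(1)] w(2) by simp
    then have "e = ?f (nat (n mod int r))" using h(2) by simp
    moreover have "nat (n mod int r) \<in> {..<r}" using w(3) by (simp add: nat_less_iff)
    ultimately show "e \<in> ?f ` {..<r}" by (rule image_eqI)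
  qed
  moreover have "inj_on ?f {..<r}"
  proof (rule inj_onI)
    fix m n :: nat assume mn: "m \<in> {..<r}" "n \<in> {..<r}" "?f m = ?f n"
    have "w [^] n \<otimes> g = w [^] m \<otimes> g \<or> w [^] n \<otimes> g = (z \<otimes> w [^] m) \<otimes> g"
      using enc_1[OF wg[of m] wg[of n]] mn(3) g w(1) by (simp add: m_assoc)
    then have "w [^] n = w [^] m \<or> w [^] n = z \<otimes> w [^] m" using g w(1) by simp
    moreover have "w [^] n \<noteq> z \<otimes> w [^] m"
    proof
      assume "w [^] n = z \<otimes> w [^] m"
      then have "z = w [^] n \<otimes> inv (w [^] m)" using w(1) by (simp add: m_assoc)
      also have "\<dots> = w [^] (int n - int m)" using w(1) by (simp add: int_pow_diff int_pow_int)
      finally show False using zw by blast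
    qed
    ultimately have "w [^] int m = w [^] int n" by (simp add: int_pow_int)
    then have "int r dvd int n - int m" using int_pow_eq[OF w(1)] w(2) by metis
    then have "int n mod int r = int m mod int r" by (simp add: mod_eq_dvd_iff)
    then show "m = n" using mn(1,2) by simp
  qed
  ultimately show "finite {e \<in> edges P. incident P e (enc i g)}" "card {e \<in> edges P. incident P e (enc i g)} = r"
    by (simp_all add: card_image)
qed

lemma tight_P: "tight_of_type P p q"
proof -
  have "has_type P p q"
    unfolding has_type_def
  proof (intro conjI ballI)
    fix f assume "f \<in> faces P"
    then obtain g where g: "g \<in> carrier G" "f = enc 2 g" using of_rank_P[of 2] by auto
    note E = edges_at_P[OF g(1) x_in ord_x p_pos, of 2, OF _ enc_2[OF g(1)] z_neq_x_pow]
    show "finite {e \<in> edges P. incident P e f}" "card {e \<in> edges P. incident P e f} = p" using E g(2) by simp_all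
  next
    fix v assume "v \<in> vertices P"
    then obtain g where g: "g \<in> carrier G" "v = enc 0 g" using of_rank_P[of 0] by auto
    note E = edges_at_P[OF g(1) y_in ord_y q_pos, of 0, OF _ enc_0[OF g(1)] z_neq_y_pow]
    show "finite {e \<in> edges P. incident P e v}" "card {e \<in> edges P. incident P e v} = q" using E g(2) by simp_all
  qed
  moreover have "card (flags P) = 2 * p * q"
  proof -
    have "Fp ` carrier G \<inter> Fm ` carrier G = {}"
    proof (rule equals0I)
      fix \<Psi> assume "\<Psi> \<in> Fp ` carrier G \<inter> Fm ` carrier G"
      then obtain g h where "g \<in> carrier G" "h \<in> carrier G" "\<Psi> = Fp g" "\<Psi> = Fm h" by blast
      then show False using disjoint_P[of g h] by simp
    qed
    then have "card (flags P) = card (Fp ` carrier G) + card (Fm ` carrier G)"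
      unfolding flags_P by (intro card_Un_disjoint) (simp_all add: finite_carrier)
    then show ?thesis using card_image[OF inj_Fp_P] card_image[OF inj_Fm_P] card_carrier by simp
  qed
  moreover have "finite (flags P)" unfolding flags_P by (simp add: finite_carrier)
  ultimately show ?thesis by (simp add: tight_of_type_def)
qed

end

section \<open>Realising quotients as polyhedra on the naturals\<close>

context tight_group
begin

text \<open>A coset is coded by a number for it as a subset of the carrier, paired with its rank.
  The pairing lets the rank be read off the code and keeps elements of different ranks apart even if
  their cosets coincide as sets.\<close>

lemma ex_coset_polyhedron:
  assumes "2 < p" "2 < q"
  shows "\<exists>(Q :: nat ranked_poset) enc. coset_polyhedron G x y p q Q enc"
proof -
  let ?z = "x \<otimes> y"
  have "finite (Pow (carrier G))" using finite_carrier by simp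
  then obtain \<phi> :: "_ \<Rightarrow> nat" where phi: "inj_on \<phi> (Pow (carrier G))" using finite_imp_inj_to_nat_seg by metis
  define C where "C i g = (if i = 0 then {y [^] n \<otimes> g | n :: int. True}
    else if i = 1 then {g, ?z \<otimes> g} else {x [^] n \<otimes> g | n :: int. True})" for i :: nat and g
  have C_sub: "C i g \<in> Pow (carrier G)" if "g \<in> carrier G" for i g using that by (auto simp: C_def)
  define enc where "enc i g = prod_encode (i, \<phi> (C i g))" for i g
  have enc_iff: "enc i g = enc i h \<longleftrightarrow> C i g = C i h" if "g \<in> carrier G" "h \<in> carrier G" for i g h
    unfolding enc_def using inj_on_eq_iff[OF phi C_sub[OF that(1)] C_sub[OF that(2)]] by (simp add: prod_encode_eq)
  have pow: "{w [^] n \<otimes> g | n :: int. True} = {w [^] n \<otimes> h | n :: int. True} \<longleftrightarrow> (\<exists>n::int. h = w [^] n \<otimes> g)"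
    if c: "w \<in> carrier G" "g \<in> carrier G" "h \<in> carrier G" for w g h
  proof
    assume "{w [^] n \<otimes> g | n :: int. True} = {w [^] n \<otimes> h | n :: int. True}"
    moreover have "w [^] (0::int) \<otimes> h \<in> {w [^] n \<otimes> h | n :: int. True}" by blast
    ultimately have "w [^] (0::int) \<otimes> h \<in> {w [^] n \<otimes> g | n :: int. True}" by simp
    then show "\<exists>n::int. h = w [^] n \<otimes> g" using c(3) by auto
  next
    assume "\<exists>n::int. h = w [^] n \<otimes> g"
    then obtain m :: int where m: "h = w [^] m \<otimes> g" by blast
    have "w [^] n \<otimes> h = w [^] (n + m) \<otimes> g" "w [^] n \<otimes> g = w [^] (n - m) \<otimes> h" for n :: int
    proof -
      show "w [^] n \<otimes> h = w [^] (n + m) \<otimes> g" unfolding m int_pow_mult[OF c(1)] using c by (simp add: m_assoc)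
      have "w [^] (n - m) \<otimes> h = w [^] (n - m + m) \<otimes> g" unfolding m int_pow_mult[OF c(1)] using c by (simp add: m_assoc)
      then show "w [^] n \<otimes> g = w [^] (n - m) \<otimes> h" by simp
    qed
    then show "{w [^] n \<otimes> g | n :: int. True} = {w [^] n \<otimes> h | n :: int. True}" by blast
  qed
  define Q where "Q = \<lparr>elems = {enc i g | i g. i \<in> {0, 1, 2} \<and> g \<in> carrier G},
    le_rel = {(enc i g, enc j g) | i j g. i \<in> {0, 1, 2} \<and> j \<in> {0, 1, 2} \<and> i \<le> j \<and> g \<in> carrier G},
    rk = (\<lambda>n. fst (prod_decode n))\<rparr>"
  have "coset_polyhedron G x y p q Q enc"
  proof unfold_locales
    fix g h assume g: "g \<in> carrier G" "h \<in> carrier G"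
    show "enc 0 g = enc 0 h \<longleftrightarrow> (\<exists>n::int. h = y [^] n \<otimes> g)"
      unfolding enc_iff[OF g] using pow[OF y_in g] by (simp add: C_def)
    show "enc 2 g = enc 2 h \<longleftrightarrow> (\<exists>n::int. h = x [^] n \<otimes> g)"
      unfolding enc_iff[OF g] using pow[OF x_in g] by (simp add: C_def)
    have "{g, ?z \<otimes> g} = {h, ?z \<otimes> h} \<longleftrightarrow> h = g \<or> h = ?z \<otimes> g"
      using half.z_z[OF g(1)] half.z_z[OF g(2)] by (auto simp: doubleton_eq_iff)
    then show "enc 1 g = enc 1 h \<longleftrightarrow> h = g \<or> h = ?z \<otimes> g"
      unfolding enc_iff[OF g] by (simp add: C_def)
  next
    show "elems Q = {enc i g | i g. i \<in> {0, 1, 2} \<and> g \<in> carrier G}"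
      "le_rel Q = {(enc i g, enc j g) | i j g. i \<in> {0, 1, 2} \<and> j \<in> {0, 1, 2} \<and> i \<le> j \<and> g \<in> carrier G}"
      by (simp_all only: Q_def ranked_poset.simps)
    show "rk Q (enc i g) = i" for i g by (simp add: Q_def enc_def)
  qed (fact assms)+
  then show ?thesis by blast
qed

lemma relations_of_twist:
  fixes c :: int
  assumes "twist G x y = y [^] c" "x \<otimes> inv (twist G x y) = twist G x y \<otimes> x"
  shows "inv y \<otimes> x = x [^] (3::int) \<otimes> y [^] (1 + c)" "y \<otimes> inv x = x [^] (- 3 :: int) \<otimes> y [^] (- 1 + c)"
proof -
  have x3: "x [^] (3::int) = x \<otimes> (x \<otimes> x)"
    using int_pow_mult[OF x_in, of 1 2] int_pow_mult[OF x_in, of 1 1] by simp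
  have x3': "x [^] (- 3::int) = inv x \<otimes> (inv x \<otimes> inv x)"
    unfolding int_pow_neg[OF x_in] x3 by (simp add: inv_mult_group m_assoc)
  show "inv y \<otimes> x = x [^] (3::int) \<otimes> y [^] (1 + c)"
    unfolding half.inv_y_x assms(1) int_pow_mult[OF y_in] x3 by (simp add: m_assoc)
  show "y \<otimes> inv x = x [^] (- 3 :: int) \<otimes> y [^] (- 1 + c)"
    unfolding half.y_inv_x[OF assms(2)] unfolding assms(1) int_pow_mult[OF y_in] x3'
    by (simp add: m_assoc int_pow_neg)
qed

end

text \<open>The given homomorphism onto generators of H, followed by \<open>R.rot\<close>, is the
  homomorphism required by \<open>covers\<close>; and a group that is not reflexible has a chiral
  coset polyhedron.\<close>

lemma ex_chiral_cover:
  fixes H :: "'b monoid"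
  assumes H: "tight_group H (f x) (f y) p q" "2 < p" "2 < q" "\<not> reflexible H (f x) (f y)"
    and f: "f \<in> hom (rotation_group P \<Phi>) H" and xy: "x = sigma1 P \<Phi>" "y = sigma2 P \<Phi>"
  shows "\<exists>(Q :: nat ranked_poset) \<Psi>. chiral Q \<and> tight_of_type Q p q \<and> \<Psi> \<in> flags Q \<and> covers P \<Phi> Q \<Psi>"
proof -
  obtain Q :: "nat ranked_poset" and enc where Q: "coset_polyhedron H (f x) (f y) p q Q enc"
    using tight_group.ex_coset_polyhedron[OF H(1-3)] by blast
  interpret C: coset_polyhedron H "f x" "f y" p q Q enc by fact
  interpret R: rotary_flags Q H "f x" "f y" p q C.Fp C.Fm by (rule C.rotary_flags_P)
  have "(\<lambda>g. R.rot (f g)) \<in> hom (rotation_group P \<Phi>) (rotation_group Q (C.Fp \<one>\<^bsub>H\<^esub>))"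
    using hom_compose[OF f R.rot_hom] by (simp add: comp_def)
  then have "covers P \<Phi> Q (C.Fp \<one>\<^bsub>H\<^esub>)"
    unfolding covers_def R.sigma_eq_rot xy by (rule bexI[rotated]) simp
  moreover have "chiral Q" by (rule R.chiral_of_not_reflexible[OF H(4)])
  moreover have "C.Fp \<one>\<^bsub>H\<^esub> \<in> flags Q" by (rule R.Fp_in_flags[OF C.one_closed])
  ultimately show ?thesis using C.tight_P by blast
qed

theorem theorem4p11:
  fixes m \<alpha> \<beta> :: nat and P :: "'a ranked_poset" and \<Phi> :: "'a flag"
  assumes "prime m" and "odd m" and "\<alpha> > 0" and "\<beta> > 0"
    and "\<Phi> \<in> flags P"
    and "atomic_chiral P \<Phi> (2 * m ^ \<alpha>) (m ^ (\<alpha> + \<beta>))"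
  shows "\<alpha> = 1 \<and>
    (\<exists>k::int. 1 \<le> k \<and> k \<le> int m - 1 \<and>
      rotation_group_eq_Gamma P \<Phi> (2 * int m) (int m ^ (\<beta> + 1))
        3 (1 + k * int m ^ \<beta>) (- 3) (- 1 + k * int m ^ \<beta>))"
proof -
  define p q where "p = 2 * m ^ \<alpha>" and "q = m ^ (\<alpha> + \<beta>)"
  define G where "G = rotation_group P \<Phi>"
  define x y where "x = sigma1 P \<Phi>" and "y = sigma2 P \<Phi>"
  have atomic: "chiral P" "tight_of_type P p q"
    "\<And>(Q :: nat ranked_poset) \<Psi> p'. p' < p \<Longrightarrow> chiral Q \<Longrightarrow> tight_of_type Q p' q \<Longrightarrow> \<Psi> \<in> flags Q \<Longrightarrow> \<not> covers P \<Phi> Q \<Psi>"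
    "\<And>(Q :: nat ranked_poset) \<Psi> q'. q' < q \<Longrightarrow> chiral Q \<Longrightarrow> tight_of_type Q p q' \<Longrightarrow> \<Psi> \<in> flags Q \<Longrightarrow> \<not> covers P \<Phi> Q \<Psi>"
    using assms(6) unfolding atomic_chiral_def p_def q_def by blast+
  interpret poly P using atomic(1) by unfold_locales (simp add: chiral_def)
  interpret T: tight_chiral P \<Phi> p q G x y
    by unfold_locales (fact atomic(1,2) assms(5) G_def x_def y_def)+
  interpret R: rotary_flags P G x y p q T.Fp T.Fm by (rule T.rotary_flags)
  have nrefl: "\<not> reflexible G x y"
    using R.transitive_of_reflexible atomic(1) unfolding chiral_def by blast
  have m2: "m > 2" using assms(1,2) prime_ge_2_nat[of m] by (cases "m = 2") auto
  have "m \<le> m ^ \<alpha>" "m \<le> m ^ (\<alpha> + \<beta>)"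
    using m2 assms(3) self_le_power[of m \<alpha>] self_le_power[of m "\<alpha> + \<beta>"] by simp_all
  then have p2: "2 < p" and q2: "2 < q" using m2 unfolding p_def q_def by linarith+
  \<comment> \<open>A tight image that is not reflexible would be realised by a chiral polyhedron
    covered by P, which atomicity forbids.\<close>
  have Hq: "reflexible H (f x) (f y)"
    if "f \<in> hom G H" "tight_group H (f x) (f y) p q'" "2 < q'" "q' < q" for H :: "nat monoid" and f q'
  proof (rule ccontr)
    assume "\<not> reflexible H (f x) (f y)"
    from ex_chiral_cover[OF that(2) p2 that(3) this that(1)[unfolded G_def] x_def y_def]
    show False using atomic(4)[OF that(4)] by blast
  qed
  have Hp: "reflexible H (f x) (f y)"
    if "f \<in> hom G H" "tight_group H (f x) (f y) p' q" "2 < p'" "p' < p" for H :: "nat monoid" and f p'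
  proof (rule ccontr)
    assume "\<not> reflexible H (f x) (f y)"
    from ex_chiral_cover[OF that(2,3) q2 this that(1)[unfolded G_def] x_def y_def]
    show False using atomic(3)[OF that(4)] by blast
  qed
  have \<alpha>: "\<alpha> = 1" and ex: "\<exists>k::int. 1 \<le> k \<and> k \<le> int m - 1 \<and> twist G x y = y [^]\<^bsub>G\<^esub> (k * int m ^ \<beta>) \<and>
    x \<otimes>\<^bsub>G\<^esub> inv\<^bsub>G\<^esub> twist G x y = twist G x y \<otimes>\<^bsub>G\<^esub> x"
    by (rule R.twist_of_atomic[OF assms(1-4) p_def q_def nrefl], (rule Hq; assumption), (rule Hp; assumption))+
  obtain k :: int where k: "1 \<le> k" "k \<le> int m - 1" "twist G x y = y [^]\<^bsub>G\<^esub> (k * int m ^ \<beta>)"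
    "x \<otimes>\<^bsub>G\<^esub> inv\<^bsub>G\<^esub> twist G x y = twist G x y \<otimes>\<^bsub>G\<^esub> x"
    using ex by blast
  define Rl where "Rl = Gamma_rels (int p) (int q) 3 (1 + k * int m ^ \<beta>) (- 3) (- 1 + k * int m ^ \<beta>)"
  have "\<exists>h\<in>iso (presented_group Rl) G. h (pres_class Rl [(S1, True)]) = x \<and> h (pres_class Rl [(S2, True)]) = y"
    by (rule R.presented_group_iso[OF R.relations_of_twist[OF k(3,4)] Rl_def])
  moreover have "int p = 2 * int m" "int q = int m ^ (\<beta> + 1)" using \<alpha> by (simp_all add: p_def q_def)
  ultimately have "rotation_group_eq_Gamma P \<Phi> (2 * int m) (int m ^ (\<beta> + 1))
      3 (1 + k * int m ^ \<beta>) (- 3) (- 1 + k * int m ^ \<beta>)"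
    unfolding rotation_group_eq_Gamma_def Let_def Rl_def G_def x_def y_def by simp
  then show ?thesis using \<alpha> k(1,2) by blast
qed

end
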